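(* Let $p\in[1,\infty]$, let $\eta=\min(\alpha-1,\beta,\gamma)$ and fix two constants $C_{\rm i},T>0$. There exist a continuous non-increasing function $\varepsilon_T:[0,\infty)\to(0,\infty)$ and a continuous non-decreasing function $C_T:[0,\infty)\to[C_{\rm i},\infty)$ such that the following holds. For every solution $a\in C^2([0,T],\ell_p(\mathbb Z,\mathbb C))$ of the amplitude equation $i\,\partial_\tau a=\delta^+f(\delta^-a)$, with $N:=\|a\|_{L^\infty([0,T],\ell_p)}$, and for every $\varepsilon\in(0,\varepsilon_T(N)]$, define $$X_a^\varepsilon(t)=\frac{\varepsilon}{\sqrt2}\,a(\varepsilon^{\alpha-1}t)\,e^{it}\begin{pmatrix}1\\ i\end{pmatrix}+\mathrm{c.c.}$$ Then for every $X^0\in\ell_p^2$ satisfying $\|X^0-X_a^\varepsilon(0)\|_p\le C_{\rm i}\,\varepsilon^{1+\eta}$, the solution $X(t)\in\ell_p^2$ of $\dot X=JX+G(X)$ with $X(0)=X^0$ is defined at least for $t\in[0,T/\varepsilon^{\alpha-1}]$ and satisfies $$\|X(t)-X_a^\varepsilon(t)\|_p\le C_T(N)\,\varepsilon^{1+\eta}\quad\text{for all }t\in[0,T/\varepsilon^{\alpha-1}].$$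
   Context: **Lattice model.** Fix $\alpha>1$, real $(k_-,k_+)\ne(0,0)$ and $\beta,\gamma>0$. Let $V\in C^2(\mathbb R,\mathbb R)$, $V=V_\alpha+W$, where $V_\alpha(r)=\frac{k_-}{1+\alpha}|r|^{\alpha+1}$ for $r\le0$, $V_\alpha(r)=\frac{k_+}{1+\alpha}r^{\alpha+1}$ for $r\ge0$, and $W'(0)=0$, $W''(r)=O(|r|^{\alpha-1+\beta})$ as $r\to0$. Let $\phi\in C^2(\mathbb R,\mathbb R)$ with $\phi'(0)=0$, $\phi''(x)=O(|x|^{\alpha-1+\gamma})$ as $x\to0$. For sequences, $(\delta^+x)_n=x_{n+1}-x_n$, $(\delta^-x)_n=x_n-x_{n-1}$, and scalar functions act componentwise. Set $F(x)=\delta^+V'(\delta^-x)-\phi'(x)$. The lattice $\ddot x_n+x_n=F(x)_n$, $n\in\mathbb Z$, is written for $X=(x,\dot x)^T\in\ell_p^2=\ell_p(\mathbb Z,\mathbb R)^2$ as $\dot X=JX+G(X)$, with $J=\begin{pmatrix}0&\mathrm{Id}\\-\mathrm{Id}&0\end{pmatrix}$ and $G(X_1,X_2)=(0,F(X_1))^T$. Norms on $\ell_p^2$: for $X=(x,y)^T$, $\|X\|_p=\big(\sum_n(x_n^2+y_n^2)^{p/2}\big)^{1/p}$ if $p<\infty$, and $\|X\|_\infty=\sup_n(x_n^2+y_n^2)^{1/2}$. **Amplitude equation.** For $a\in\ell_p(\mathbb Z,\mathbb C)$, $(f(a))_n=\omega_0\,a_n|a_n|^{\alpha-1}$ with $$\omega_0=(k_-+k_+)\,2^{\frac{\alpha-3}{2}}\,\frac{\alpha\,\Gamma(\alpha/2)}{\sqrt\pi\,(\alpha+1)\,\Gamma((\alpha+1)/2)}.$$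 **Notation.** "c.c." is the complex conjugate of the preceding term; for $a\in\ell_p(\mathbb Z,\mathbb C)$ and a vector $(z_1,z_2)^T\in\mathbb C^2$, $a\,(z_1,z_2)^T$ is the pair of sequences $(z_1a,z_2a)^T$. The functions $\varepsilon_T,C_T$ may depend on $p$, on the model data $(\alpha,k_\pm,W,\phi,\beta,\gamma)$ and on $C_{\rm i},T$. *)

theory Defs
  imports
    "HOL-Analysis.Analysis"
    "HOL-Library.Landau_Symbols"
    "HOL-Probability.Essential_Supremum"
begin

text \<open>
  The exponent \<open>p\<close> is an extended real, meant for \<open>1 \<le> p\<close>. A pair of real sequences is encoded as
  one sequence with values in \<open>real \<times> real\<close>; as the product norm is
  \<open>norm (x, y) = sqrt (x\<^sup>2 + y\<^sup>2)\<close>, the norm \<open>lp_norm p\<close> below is then the norm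
  \<open>(\<Sum>n. (x\<^sub>n\<^sup>2 + y\<^sub>n\<^sup>2) powr (p/2)) powr (1/p)\<close>, resp. \<open>sup\<^sub>n (x\<^sub>n\<^sup>2 + y\<^sub>n\<^sup>2) powr (1/2)\<close>, on pairs.
  \<open>lp_norm p x\<close> is meaningful only for \<open>x \<in> lp_space p\<close>.
\<close>

definition lp_space :: "ereal \<Rightarrow> (int \<Rightarrow> 'a::real_normed_vector) set" where
  "lp_space p = {x. if p = \<infinity> then bounded (range x)
                    else (\<lambda>n. norm (x n) powr real_of_ereal p) summable_on UNIV}"

definition lp_norm :: "ereal \<Rightarrow> (int \<Rightarrow> 'a::real_normed_vector) \<Rightarrow> real" where
  "lp_norm p x = (if p = \<infinity> then (SUP n. norm (x n))
                  else (\<Sum>\<^sub>\<infinity>n. norm (x n) powr real_of_ereal p) powr (1 / real_of_ereal p))"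

text \<open>Calculus for curves in \<open>\<ell>\<^sub>p\<close>, with limits taken in the \<open>\<ell>\<^sub>p\<close> norm (not componentwise).\<close>

definition lp_tendsto ::
    "ereal \<Rightarrow> ('t \<Rightarrow> int \<Rightarrow> 'a::real_normed_vector) \<Rightarrow> (int \<Rightarrow> 'a) \<Rightarrow> 't filter \<Rightarrow> bool" where
  "lp_tendsto p u l F \<longleftrightarrow> ((\<lambda>s. lp_norm p (\<lambda>n. u s n - l n)) \<longlongrightarrow> 0) F"

definition lp_continuous_on ::
    "ereal \<Rightarrow> real set \<Rightarrow> (real \<Rightarrow> int \<Rightarrow> 'a::real_normed_vector) \<Rightarrow> bool" where
  "lp_continuous_on p S u \<longleftrightarrow>
     u \<in> S \<rightarrow> lp_space p \<and> (\<forall>t\<in>S. lp_tendsto p u (u t) (at t within S))"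

definition lp_has_derivative_on ::
    "ereal \<Rightarrow> real set \<Rightarrow> (real \<Rightarrow> int \<Rightarrow> 'a::real_normed_vector) \<Rightarrow> (real \<Rightarrow> int \<Rightarrow> 'a) \<Rightarrow> bool" where
  "lp_has_derivative_on p S u u' \<longleftrightarrow>
     u \<in> S \<rightarrow> lp_space p \<and> u' \<in> S \<rightarrow> lp_space p \<and>
     (\<forall>t\<in>S. lp_tendsto p (\<lambda>s n. (u s n - u t n) /\<^sub>R (s - t)) (u' t) (at t within S))"

definition lp_C2_on :: "ereal \<Rightarrow> real set \<Rightarrow> (real \<Rightarrow> int \<Rightarrow> 'a::real_normed_vector) \<Rightarrow> bool" where
  "lp_C2_on p S u \<longleftrightarrow>
     (\<exists>u' u''. lp_has_derivative_on p S u u' \<and> lp_has_derivative_on p S u' u'' \<and>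
               lp_continuous_on p S u'')"

definition Linf_lp_norm :: "ereal \<Rightarrow> real set \<Rightarrow> (real \<Rightarrow> int \<Rightarrow> 'a::real_normed_vector) \<Rightarrow> real" where
  "Linf_lp_norm p S u = real_of_ereal (esssup (lebesgue_on S) (\<lambda>t. ereal (lp_norm p (u t))))"

definition C2_real :: "(real \<Rightarrow> real) \<Rightarrow> bool" where
  "C2_real f \<longleftrightarrow> f C1_differentiable_on UNIV \<and> deriv f C1_differentiable_on UNIV"

definition delta_plus :: "(int \<Rightarrow> 'a::ab_group_add) \<Rightarrow> int \<Rightarrow> 'a" where
  "delta_plus x n = x (n + 1) - x n"

definition delta_minus :: "(int \<Rightarrow> 'a::ab_group_add) \<Rightarrow> int \<Rightarrow> 'a" where
  "delta_minus x n = x n - x (n - 1)"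

definition V_alpha :: "real \<Rightarrow> real \<Rightarrow> real \<Rightarrow> real \<Rightarrow> real" where
  "V_alpha \<alpha> kminus kplus r =
     (if r \<le> 0 then kminus / (1 + \<alpha>) * \<bar>r\<bar> powr (\<alpha> + 1) else kplus / (1 + \<alpha>) * r powr (\<alpha> + 1))"

definition lattice_F :: "(real \<Rightarrow> real) \<Rightarrow> (real \<Rightarrow> real) \<Rightarrow> (int \<Rightarrow> real) \<Rightarrow> int \<Rightarrow> real" where
  "lattice_F V \<phi> x n = delta_plus (deriv V \<circ> delta_minus x) n - deriv \<phi> (x n)"

definition lattice_J :: "(int \<Rightarrow> real \<times> real) \<Rightarrow> int \<Rightarrow> real \<times> real" where
  "lattice_J X n = (snd (X n), - fst (X n))"

definition lattice_G ::
    "(real \<Rightarrow> real) \<Rightarrow> (real \<Rightarrow> real) \<Rightarrow> (int \<Rightarrow> real \<times> real) \<Rightarrow> int \<Rightarrow> real \<times> real" where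
  "lattice_G V \<phi> X n = (0, lattice_F V \<phi> (fst \<circ> X) n)"

definition lattice_solution ::
    "ereal \<Rightarrow> (real \<Rightarrow> real) \<Rightarrow> (real \<Rightarrow> real) \<Rightarrow> real set \<Rightarrow> (real \<Rightarrow> int \<Rightarrow> real \<times> real) \<Rightarrow> bool" where
  "lattice_solution p V \<phi> S X \<longleftrightarrow>
     lp_has_derivative_on p S X (\<lambda>t n. lattice_J (X t) n + lattice_G V \<phi> (X t) n)"

definition omega0 :: "real \<Rightarrow> real \<Rightarrow> real \<Rightarrow> real" where
  "omega0 \<alpha> kminus kplus =
     (kminus + kplus) * 2 powr ((\<alpha> - 3) / 2) *
     (\<alpha> * Gamma (\<alpha> / 2) / (sqrt pi * (\<alpha> + 1) * Gamma ((\<alpha> + 1) / 2)))"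

definition amplitude_f :: "real \<Rightarrow> real \<Rightarrow> real \<Rightarrow> (int \<Rightarrow> complex) \<Rightarrow> int \<Rightarrow> complex" where
  "amplitude_f \<alpha> kminus kplus a n =
     of_real (omega0 \<alpha> kminus kplus) * a n * of_real (norm (a n) powr (\<alpha> - 1))"

definition amplitude_solution ::
    "ereal \<Rightarrow> real \<Rightarrow> real \<Rightarrow> real \<Rightarrow> real set \<Rightarrow> (real \<Rightarrow> int \<Rightarrow> complex) \<Rightarrow> bool" where
  "amplitude_solution p \<alpha> kminus kplus S a \<longleftrightarrow>
     (\<exists>a'. lp_has_derivative_on p S a a' \<and>
       (\<forall>\<tau>\<in>S. \<forall>n. \<i> * a' \<tau> n = delta_plus (amplitude_f \<alpha> kminus kplus (delta_minus (a \<tau>))) n))"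

text \<open>A complex number plus its conjugate is real; \<open>Re\<close> only changes the type.\<close>

definition plus_cc :: "complex \<Rightarrow> real" where
  "plus_cc z = Re (z + cnj z)"

definition X_approx :: "real \<Rightarrow> (real \<Rightarrow> int \<Rightarrow> complex) \<Rightarrow> real \<Rightarrow> real \<Rightarrow> int \<Rightarrow> real \<times> real" where
  "X_approx \<alpha> a \<epsilon> t n =
     (let z = of_real (\<epsilon> / sqrt 2) * a (\<epsilon> powr (\<alpha> - 1) * t) n * exp (\<i> * of_real t)
      in (plus_cc (z * 1), plus_cc (z * \<i>)))"

end

theory Submission
  imports Defs
begin

text \<open>
  In the rotating frame \<open>w = exp (-i t) (x - i \<dot>x) / \<surd>2\<close> the linear part of the lattice disappears and \<open>w\<close>
  moves only through the force, \<open>w' = - i exp (-i t) F (\<surd>2 Re (exp (i t) w)) / \<surd>2\<close>. For \<open>w\<close> of size \<open>\<epsilon>\<close> the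
  right-hand side is of size \<open>\<epsilon>\<^sup>\<alpha>\<close>, so \<open>w\<close> changes appreciably only on the time scale \<open>\<epsilon>\<^sup>1\<^sup>-\<^sup>\<alpha>\<close>, while the
  explicit time dependence has period \<open>2 \<pi>\<close>. The mean over a period of the leading force
  (\<open>leading_force_average\<close>) is exactly the nonlinearity of the amplitude equation, \<open>\<omega>\<^sub>0\<close> being a Beta
  integral. Because that nonlinearity is homogeneous of degree \<open>\<alpha>\<close>, the rescaled amplitude
  \<open>w\<^sub>a t = \<epsilon> a (\<epsilon>\<^sup>\<alpha>\<^sup>-\<^sup>1 t)\<close> solves the averaged equation.

  The theorem is therefore a first-order averaging statement. Inserting \<open>w\<^sub>a\<close> into the equation for \<open>w\<close>
  leaves a residual whose time integral has norm \<open>O(\<epsilon>\<^sup>1\<^sup>+\<^sup>\<eta>)\<close> (lemma \<open>r_bound\<close>):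
  the oscillating part cancels over each period up to the variation of \<open>w\<^sub>a\<close> during that
  period (\<open>lp_averaging\<close>), which leaves \<open>O(\<epsilon>\<^sup>\<alpha>)\<close>, and the perturbations \<open>W'\<close>, \<open>\<phi>'\<close> are of order \<open>\<epsilon>\<^sup>\<alpha>\<^sup>+\<^sup>\<beta>\<close>,
  \<open>\<epsilon>\<^sup>\<alpha>\<^sup>+\<^sup>\<gamma>\<close> pointwise and act during a time \<open>O(\<epsilon>\<^sup>1\<^sup>-\<^sup>\<alpha>)\<close>. Since the vector field has Lipschitz constant
  \<open>O(\<epsilon>\<^sup>\<alpha>\<^sup>-\<^sup>1)\<close> near the origin, Gronwall's inequality on this time interval multiplies the error only by a
  constant (\<open>error_bound\<close>).

  Existence comes from truncation. The force is cut off outside a ball of radius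
  proportional to \<open>\<epsilon>\<close>, which makes the field globally Lipschitz; Picard iteration then gives a solution on
  the whole interval, and the error bound shows that it never reaches the truncated region
  (\<open>lattice_solution_near_approximation\<close>).

  All of this takes place in \<open>\<ell>\<^sub>p\<close> for arbitrary \<open>p\<close>. The exponent is eliminated at the start by duality:
  \<open>\<parallel>x\<parallel>\<^sub>p \<le> M\<close> holds if and only if \<open>\<Sum>n. c n * norm (x n) \<le> M\<close> for all finitely supported weights \<open>c\<close> of
  dual norm at most one (\<open>lp_le_iff_pairing\<close>). Every further estimate is a statement about finite
  weighted sums of components, so that components can be differentiated and integrated one by one;
  in particular the mean value inequality \<open>lp_le_mean_value\<close> replaces integration of \<open>\<ell>\<^sub>p\<close>-valued functions.
\<close>

section \<open>Sequence norms by duality\<close>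

text \<open>
  Membership and norm bound are kept together because \<open>lp_norm\<close> has an arbitrary value off \<open>lp_space\<close>;
  every estimate below then also proves summability.
\<close>
definition lp_le :: "ereal \<Rightarrow> (int \<Rightarrow> 'a::real_normed_vector) \<Rightarrow> real \<Rightarrow> bool" where
  "lp_le p x M \<longleftrightarrow> x \<in> lp_space p \<and> lp_norm p x \<le> M"

definition pairing :: "(int \<Rightarrow> real) \<Rightarrow> (int \<Rightarrow> 'a::real_normed_vector) \<Rightarrow> real" where
  "pairing c x = (\<Sum>n | c n \<noteq> 0. c n * norm (x n))"

text \<open>
  The nonnegative, finitely supported elements of the unit ball of the dual of \<open>\<ell>\<^sub>p\<close>, described through the
  pairing itself so that the conjugate exponent and the cases \<open>p = 1\<close>, \<open>p = \<infinity>\<close> need no separate treatment.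
\<close>
definition dual_weights :: "ereal \<Rightarrow> (int \<Rightarrow> real) set" where
  "dual_weights p = {c. finite {n. c n \<noteq> 0} \<and> (\<forall>n. 0 \<le> c n) \<and>
     (\<forall>x::int \<Rightarrow> real. x \<in> lp_space p \<longrightarrow> pairing c x \<le> lp_norm p x)}"

lemma lp_space_norm: "(\<lambda>n. norm (x n)) \<in> lp_space p \<longleftrightarrow> x \<in> lp_space p"
  by (simp add: lp_space_def bounded_norm_comp)

lemma lp_norm_norm: "lp_norm p (\<lambda>n. norm (x n)) = lp_norm p x"
  by (simp add: lp_norm_def)

lemma lp_norm_nonneg:
  assumes "x \<in> lp_space p"
  shows "0 \<le> lp_norm p x"
proof (cases "p = \<infinity>")
  case True
  then have "bdd_above (range (\<lambda>n. norm (x n)))"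
    using assms by (auto simp: lp_space_def bounded_iff bdd_above_def)
  then have "norm (x 0) \<le> lp_norm p x"
    using True by (auto simp: lp_norm_def intro: cSUP_upper)
  then show ?thesis
    using norm_ge_zero order_trans by blast
next
  case False
  then show ?thesis by (simp add: lp_norm_def)
qed

lemma Young_powr:
  fixes a b r :: real
  assumes "1 \<le> r" "0 \<le> a" "0 \<le> b"
  shows "a powr (r - 1) * b \<le> ((r - 1) * a powr r + b powr r) / r"
proof (cases "a = 0 \<or> b = 0")
  case True
  then show ?thesis using assms by auto
next
  case False
  then have pos: "a > 0" "b > 0" using assms by auto
  have "(a powr r) powr ((r - 1) / r) * (b powr r) powr (1 / r)
      \<le> (r - 1) / r * a powr r + 1 / r * b powr r"
    using assms pos by (intro Youngs_inequality_0) (auto simp: field_simps)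
  then show ?thesis
    using assms pos by (simp add: powr_powr add_divide_distrib)
qed

lemma pairing_delta: "pairing (\<lambda>m. if m = n then 1 else 0) x = norm (x n)"
proof -
  have "{m. (if m = n then 1 else 0 :: real) \<noteq> 0} = {n}" by auto
  then have "pairing (\<lambda>m. if m = n then 1 else 0) x = (\<Sum>m\<in>{n}. (if m = n then 1 else 0) * norm (x m))"
    unfolding pairing_def by (rule arg_cong)
  then show ?thesis by simp
qed

lemma dual_weights_delta: "(\<lambda>m. if m = n then 1 else 0) \<in> dual_weights \<infinity>"
proof -
  have "norm (x n) \<le> lp_norm \<infinity> x" if "x \<in> lp_space \<infinity>" for x :: "int \<Rightarrow> real"
    using that by (auto simp: lp_norm_def lp_space_def bounded_iff bdd_above_def intro!: cSUP_upper)
  then show ?thesis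
    by (auto simp: dual_weights_def pairing_delta)
qed

text \<open>
  The extremal functional in Hoelder's inequality, restricted to a finite set \<open>S\<close>: it attains the \<open>\<ell>\<^sub>p\<close> norm
  of the restriction of \<open>x\<close> to \<open>S\<close>. Membership is Young's inequality summed over \<open>S\<close> after normalising
  both sequences.
\<close>
lemma dual_weights_extremal:
  fixes x :: "int \<Rightarrow> 'a::real_normed_vector"
  assumes r: "1 \<le> r" and S: "finite S" and A: "A = (\<Sum>n\<in>S. norm (x n) powr r) powr (1 / r)" "A > 0"
  defines "c \<equiv> (\<lambda>n. if n \<in> S then (norm (x n) / A) powr (r - 1) else 0)"
  shows "c \<in> dual_weights (ereal r)" "pairing c x = A"
proof -
  have supp: "{n. c n \<noteq> 0} \<subseteq> S"
    by (auto simp: c_def)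
  have pair: "pairing c y = (\<Sum>n\<in>S. (norm (x n) / A) powr (r - 1) * norm (y n))"
    for y :: "int \<Rightarrow> 'b::real_normed_vector"
  proof -
    have "pairing c y = (\<Sum>n\<in>S. c n * norm (y n))"
      unfolding pairing_def by (rule sum.mono_neutral_left) (use S supp in auto)
    then show ?thesis by (simp add: c_def)
  qed
  have sumA: "(\<Sum>n\<in>S. norm (x n) powr r) = A powr r"
    using r A(2) by (simp add: A(1) powr_powr sum_nonneg)
  have normalised: "(\<Sum>n\<in>S. (norm (x n) / A) powr r) = 1"
    using A(2) sumA by (simp add: powr_divide flip: sum_divide_distrib)
  have "(norm (x n) / A) powr (r - 1) * norm (x n) = A * (norm (x n) / A) powr r" for n
    using A(2) r by (cases "x n = 0") (auto simp: powr_diff field_simps)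
  then show "pairing c x = A"
    by (simp add: pair normalised flip: sum_distrib_left)
  \<comment> \<open>Comparing with every \<open>B\<close> strictly above the norm of \<open>y\<close> avoids dividing by a vanishing norm.\<close>
  have "pairing c y \<le> lp_norm (ereal r) y" if y: "y \<in> lp_space (ereal r)" for y :: "int \<Rightarrow> real"
  proof (rule dense_ge)
    fix B assume B: "lp_norm (ereal r) y < B"
    then have B0: "0 < B" using lp_norm_nonneg[OF y] by simp
    have "(\<Sum>n\<in>S. norm (y n) powr r) \<le> (\<Sum>\<^sub>\<infinity>n. norm (y n) powr r)"
      using y S by (intro finite_sum_le_infsum) (auto simp: lp_space_def)
    also have "\<dots> = (lp_norm (ereal r) y) powr r"
      using r by (simp add: lp_norm_def powr_powr infsum_nonneg)
    also have "\<dots> \<le> B powr r"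
      using B r lp_norm_nonneg[OF y] by (intro powr_mono2) auto
    finally have yB: "(\<Sum>n\<in>S. (norm (y n) / B) powr r) \<le> 1"
      using B0 by (simp add: powr_divide flip: sum_divide_distrib)
    have "pairing c y = (\<Sum>n\<in>S. (norm (x n) / A) powr (r - 1) * (norm (y n) / B)) * B"
      using B0 by (simp add: pair sum_distrib_right)
    also have "\<dots> \<le> (\<Sum>n\<in>S. ((r - 1) * (norm (x n) / A) powr r + (norm (y n) / B) powr r) / r) * B"
      using B0 A(2) r by (intro mult_right_mono sum_mono Young_powr) auto
    also have "(\<Sum>n\<in>S. ((r - 1) * (norm (x n) / A) powr r + (norm (y n) / B) powr r) / r)
        = ((r - 1) + (\<Sum>n\<in>S. (norm (y n) / B) powr r)) / r"
      by (simp add: sum.distrib normalised flip: sum_divide_distrib sum_distrib_left)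
    also have "\<dots> * B \<le> 1 * B"
      using yB r B0 by (intro mult_right_mono) auto
    finally show "pairing c y \<le> B" by simp
  qed
  then show "c \<in> dual_weights (ereal r)"
    unfolding dual_weights_def using finite_subset[OF supp S] by (auto simp: c_def)
qed

text \<open>
  This is the point at which the exponent disappears: the triangle inequality, monotonicity, limits and the
  mean value inequality all follow from the corresponding facts about finite weighted sums.
\<close>
lemma lp_le_iff_pairing:
  fixes x :: "int \<Rightarrow> 'a::real_normed_vector"
  assumes p: "1 \<le> p"
  shows "lp_le p x M \<longleftrightarrow> (\<forall>c\<in>dual_weights p. pairing c x \<le> M)"
proof
  assume "lp_le p x M"
  then have "pairing c (\<lambda>n. norm (x n)) \<le> M" if "c \<in> dual_weights p" for c
    using that unfolding dual_weights_def lp_le_def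
    by (metis (mono_tags, lifting) lp_norm_norm lp_space_norm mem_Collect_eq order_trans)
  then show "\<forall>c\<in>dual_weights p. pairing c x \<le> M"
    by (simp add: pairing_def)
next
  assume dual: "\<forall>c\<in>dual_weights p. pairing c x \<le> M"
  show "lp_le p x M"
  proof (cases p)
    case PInf
    have "norm (x n) \<le> M" for n
      using bspec[OF dual[unfolded PInf] dual_weights_delta[of n]] by (simp add: pairing_delta)
    then show ?thesis
      by (auto simp: lp_le_def PInf lp_space_def lp_norm_def bounded_iff intro!: cSUP_least)
  next
    case MInf
    then show ?thesis using p by simp
  next
    case (real r)
    then have r: "1 \<le> r" using p by simp
    have "(\<lambda>n. 0) \<in> dual_weights p"
      by (auto simp: dual_weights_def pairing_def lp_norm_nonneg)
    then have M0: "0 \<le> M" using dual by (force simp: pairing_def)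
    have fin: "(\<Sum>n\<in>S. norm (x n) powr r) \<le> M powr r" if S: "finite S" for S
    proof -
      define A where "A = (\<Sum>n\<in>S. norm (x n) powr r) powr (1 / r)"
      have "A \<le> M"
      proof (cases "A = 0")
        case False
        then have "A > 0" by (simp add: A_def)
        from dual_weights_extremal[OF r S A_def this] bspec[OF dual[unfolded real]] show ?thesis
          by fastforce
      qed (use M0 in simp)
      then have "A powr r \<le> M powr r"
        using r by (intro powr_mono2) (auto simp: A_def)
      then show ?thesis using r by (simp add: A_def powr_powr sum_nonneg)
    qed
    have summ: "(\<lambda>n. norm (x n) powr r) summable_on UNIV"
      by (rule nonneg_bdd_above_summable_on) (use fin in \<open>auto intro!: bdd_aboveI[where M = "M powr r"]\<close>)
    have "(\<Sum>\<^sub>\<infinity>n. norm (x n) powr r) \<le> M powr r"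
      by (rule infsum_le_finite_sums[OF summ]) (use fin in auto)
    then have "(\<Sum>\<^sub>\<infinity>n. norm (x n) powr r) powr (1 / r) \<le> (M powr r) powr (1 / r)"
      using r by (intro powr_mono2) (auto simp: infsum_nonneg)
    also have "\<dots> = M" using r M0 by (simp add: powr_powr)
    finally show ?thesis
      using summ by (simp add: lp_le_def real lp_space_def lp_norm_def)
  qed
qed

lemma lp_le_norm: "x \<in> lp_space p \<Longrightarrow> lp_le p x (lp_norm p x)"
  by (simp add: lp_le_def)

lemma lp_le_nonneg: "lp_le p x M \<Longrightarrow> 0 \<le> M"
  using lp_norm_nonneg unfolding lp_le_def by fastforce

lemma lp_le_weaken: "lp_le p x M \<Longrightarrow> M \<le> M' \<Longrightarrow> lp_le p x M'"
  by (auto simp: lp_le_def)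

lemma pairing_mono:
  assumes "c \<in> dual_weights p" and "\<And>n. norm (x n) \<le> norm (y n)"
  shows "pairing c x \<le> pairing c y"
  unfolding pairing_def by (rule sum_mono) (use assms in \<open>auto simp: dual_weights_def intro: mult_left_mono\<close>)

lemma has_real_derivative_imp_nondecreasing_within:
  fixes f :: "real \<Rightarrow> real"
  assumes "a \<le> b"
    and f: "\<And>t. t \<in> {a..b} \<Longrightarrow> (f has_real_derivative f' t) (at t within {a..b})"
    and nonneg: "\<And>t. t \<in> {a..b} \<Longrightarrow> 0 \<le> f' t"
  shows "f a \<le> f b"
proof -
  obtain x where x: "x \<in> {a..b}" "f b - f a = f' x * (b - a)"
    using mvt_very_simple[OF \<open>a \<le> b\<close>, of f "\<lambda>t. (*) (f' t)"] f
    by (auto simp: has_field_derivative_def)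
  then show ?thesis
    using mult_nonneg_nonneg[OF nonneg[OF x(1)], of "b - a"] \<open>a \<le> b\<close> by simp
qed

context
  fixes p :: ereal
  assumes p: "1 \<le> p"
begin

lemma lp_le_scale:
  assumes "lp_le p x M" "0 \<le> k" and le: "\<And>n. norm (y n) \<le> k * norm (x n)"
  shows "lp_le p y (k * M)"
  unfolding lp_le_iff_pairing[OF p]
proof
  fix c assume c: "c \<in> dual_weights p"
  have "pairing c y \<le> pairing c (\<lambda>n. k * norm (x n))"
    by (rule pairing_mono[OF c]) (use le assms(2) in \<open>simp add: abs_mult\<close>)
  also have "\<dots> = k * pairing c x"
    using assms(2) by (simp add: pairing_def sum_distrib_left mult_ac abs_mult)
  also have "\<dots> \<le> k * M"
    using assms c by (intro mult_left_mono) (auto simp: lp_le_iff_pairing[OF p])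
  finally show "pairing c y \<le> k * M" .
qed

lemma lp_le_mono: "lp_le p x M \<Longrightarrow> (\<And>n. norm (y n) \<le> norm (x n)) \<Longrightarrow> lp_le p y M"
  using lp_le_scale[of x M 1 y] by simp

lemma lp_le_zero: "lp_le p (\<lambda>n. 0) 0"
  by (auto simp: lp_le_iff_pairing[OF p] pairing_def)

lemma lp_le_sum_bound:
  assumes "lp_le p x M" "lp_le p y N" and le: "\<And>n. norm (z n) \<le> norm (x n) + norm (y n)"
  shows "lp_le p z (M + N)"
  unfolding lp_le_iff_pairing[OF p]
proof
  fix c assume c: "c \<in> dual_weights p"
  have "pairing c z \<le> pairing c (\<lambda>n. norm (x n) + norm (y n))"
    by (rule pairing_mono[OF c]) (use le in simp)
  also have "\<dots> = pairing c x + pairing c y"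
    by (simp add: pairing_def sum.distrib distrib_left)
  also have "\<dots> \<le> M + N"
    using assms c by (intro add_mono) (auto simp: lp_le_iff_pairing[OF p])
  finally show "pairing c z \<le> M + N" .
qed

lemma lp_le_add: "lp_le p x M \<Longrightarrow> lp_le p y N \<Longrightarrow> lp_le p (\<lambda>n. x n + y n) (M + N)"
  by (erule lp_le_sum_bound) (auto intro: norm_triangle_ineq)

lemma lp_le_diff: "lp_le p x M \<Longrightarrow> lp_le p y N \<Longrightarrow> lp_le p (\<lambda>n. x n - y n) (M + N)"
  by (erule lp_le_sum_bound) (auto intro: norm_triangle_ineq4)

lemma lp_le_shift:
  assumes "lp_le p x M"
  shows "lp_le p (\<lambda>n. x (n + k)) M"
proof -
  have bij: "bij_betw (\<lambda>n. n + k) UNIV (UNIV :: int set)"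
    by (rule bij_betwI[where g = "\<lambda>n. n - k"]) auto
  then have range: "range (\<lambda>n. x (n + k)) = range x"
    by (metis bij_betw_def image_image)
  show ?thesis
  proof (cases "p = \<infinity>")
    case True
    have "(SUP n. norm (x (n + k))) = (SUP n. norm (x n))"
      using range by (metis image_image)
    then show ?thesis using assms range by (simp add: lp_le_def lp_space_def lp_norm_def True)
  next
    case False
    then show ?thesis
      using assms summable_on_reindex_bij_betw[OF bij, of "\<lambda>n. norm (x n) powr real_of_ereal p"]
        infsum_reindex_bij_betw[OF bij, of "\<lambda>n. norm (x n) powr real_of_ereal p"]
      by (simp add: lp_le_def lp_space_def lp_norm_def)
  qed
qed

lemma lp_le_component:
  assumes "lp_le p x M"
  shows "norm (x n) \<le> M"
proof (cases p)
  case PInf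
  then show ?thesis
    using bspec[OF iffD1[OF lp_le_iff_pairing[OF p] assms], unfolded PInf, OF dual_weights_delta[of n]]
    by (simp only: pairing_delta)
next
  case MInf
  then show ?thesis using p by simp
next
  case (real r)
  then have r: "1 \<le> r" using p by simp
  show ?thesis
  proof (cases "x n = 0")
    case False
    have "norm (x n) = (\<Sum>m\<in>{n}. norm (x m) powr r) powr (1 / r)"
      using r by (simp add: powr_powr)
    from dual_weights_extremal[OF r _ this] False
      bspec[OF iffD1[OF lp_le_iff_pairing[OF p] assms], unfolded real]
    show ?thesis by fastforce
  qed (use lp_le_nonneg[OF assms] in simp)
qed

text \<open>
  Lower semicontinuity under componentwise convergence: each pairing involves finitely many components.
\<close>
lemma lp_le_limit:
  assumes le: "eventually (\<lambda>k. lp_le p (x k) (M k)) F" and lim: "\<And>n. ((\<lambda>k. x k n) \<longlongrightarrow> y n) F"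
    and "(M \<longlongrightarrow> N) F" "F \<noteq> bot"
  shows "lp_le p y N"
  unfolding lp_le_iff_pairing[OF p]
proof
  fix c assume c: "c \<in> dual_weights p"
  have "((\<lambda>k. pairing c (x k)) \<longlongrightarrow> pairing c y) F"
    unfolding pairing_def by (intro tendsto_intros lim)
  then show "pairing c y \<le> N"
    by (rule tendsto_le[OF assms(4,3)])
      (use eventually_mono[OF le] c in \<open>simp add: lp_le_iff_pairing[OF p]\<close>)
qed

text \<open>
  The curve is only assumed to be differentiable componentwise. For each weight \<open>c\<close> the pairing of
  \<open>u b - u a\<close> with \<open>c\<close> equals \<open>\<Sum>n. c n * (e n \<bullet> (u b n - u a n))\<close> for fixed unit vectors \<open>e n\<close>, a finite sum of real
  functions to which the classical mean value theorem applies.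
\<close>
lemma lp_le_mean_value:
  fixes u :: "real \<Rightarrow> int \<Rightarrow> 'a::real_inner"
  assumes "a \<le> b"
    and u: "\<And>n t. t \<in> {a..b} \<Longrightarrow> ((\<lambda>t. u t n) has_vector_derivative u' t n) (at t within {a..b})"
    and \<psi>: "\<And>t. t \<in> {a..b} \<Longrightarrow> (\<psi> has_real_derivative \<psi>' t) (at t within {a..b})"
    and le: "\<And>t. t \<in> {a..b} \<Longrightarrow> lp_le p (u' t) (\<psi>' t)"
  shows "lp_le p (\<lambda>n. u b n - u a n) (\<psi> b - \<psi> a)"
  unfolding lp_le_iff_pairing[OF p]
proof
  fix c assume c: "c \<in> dual_weights p"
  define e where "e n = sgn (u b n - u a n)" for n
  define f where "f t = \<psi> t - (\<Sum>n | c n \<noteq> 0. c n * (e n \<bullet> u t n))" for t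
  have "(f has_real_derivative \<psi>' t - (\<Sum>n | c n \<noteq> 0. c n * (e n \<bullet> u' t n))) (at t within {a..b})"
    if t: "t \<in> {a..b}" for t
  proof -
    have "((\<lambda>t. e n \<bullet> u t n) has_real_derivative e n \<bullet> u' t n) (at t within {a..b})" for n
      unfolding has_real_derivative_iff_has_vector_derivative
      by (rule bounded_linear.has_vector_derivative[OF bounded_linear_inner_right u[OF t]])
    then show ?thesis
      unfolding f_def by (intro DERIV_diff \<psi>[OF t] DERIV_sum DERIV_cmult)
  qed
  moreover have "0 \<le> \<psi>' t - (\<Sum>n | c n \<noteq> 0. c n * (e n \<bullet> u' t n))" if t: "t \<in> {a..b}" for t
  proof -
    have "e n \<bullet> y \<le> norm y" for n y
      using norm_cauchy_schwarz[of "e n" y] mult_right_mono[of "norm (e n)" 1 "norm y"]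
      by (simp add: e_def norm_sgn split: if_splits)
    then have "(\<Sum>n | c n \<noteq> 0. c n * (e n \<bullet> u' t n)) \<le> pairing c (u' t)"
      unfolding pairing_def using c by (intro sum_mono mult_left_mono) (auto simp: dual_weights_def)
    also have "\<dots> \<le> \<psi>' t"
      using le[OF t] c by (auto simp: lp_le_iff_pairing[OF p])
    finally show ?thesis by simp
  qed
  ultimately have "f a \<le> f b"
    by (rule has_real_derivative_imp_nondecreasing_within[OF \<open>a \<le> b\<close>])
  moreover have "c n * norm (u b n - u a n) = c n * (e n \<bullet> u b n) - c n * (e n \<bullet> u a n)" for n
    by (cases "u b n = u a n")
      (simp_all add: e_def sgn_div_norm dot_square_norm power2_eq_square
        flip: inner_diff_right right_diff_distrib)
  ultimately show "pairing c (\<lambda>n. u b n - u a n) \<le> \<psi> b - \<psi> a"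
    by (simp add: f_def pairing_def sum_subtractf)
qed

end

section \<open>Differential calculus and initial value problems in sequence spaces\<close>

lemma tendsto_vector_difference_quotient:
  fixes f :: "real \<Rightarrow> 'a::real_normed_vector"
  shows "(f has_vector_derivative D) (at t within S) \<longleftrightarrow>
    ((\<lambda>s. (f s - f t) /\<^sub>R (s - t)) \<longlongrightarrow> D) (at t within S)"
proof -
  have ev: "eventually (\<lambda>s. norm (f s - f t - (s - t) *\<^sub>R D) / norm (s - t) =
      norm ((f s - f t) /\<^sub>R (s - t) - D)) (at t within S)"
    unfolding eventually_at_filter
  proof (intro always_eventually allI impI)
    fix s assume "s \<noteq> t"
    then have "f s - f t - (s - t) *\<^sub>R D = (s - t) *\<^sub>R ((f s - f t) /\<^sub>R (s - t) - D)"
      by (simp add: scaleR_diff_right)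
    then show "norm (f s - f t - (s - t) *\<^sub>R D) / norm (s - t) = norm ((f s - f t) /\<^sub>R (s - t) - D)"
      using \<open>s \<noteq> t\<close> by simp
  qed
  show ?thesis
    unfolding has_vector_derivative_def has_derivative_iff_norm tendsto_cong[OF ev]
      tendsto_norm_zero_iff LIM_zero_iff
    by (simp add: bounded_linear_scaleR_left)
qed

context
  fixes p :: ereal
  assumes p: "1 \<le> p"
begin

lemma lp_space_diff: "x \<in> lp_space p \<Longrightarrow> y \<in> lp_space p \<Longrightarrow> (\<lambda>n. x n - y n) \<in> lp_space p"
  using lp_le_diff[OF p lp_le_norm lp_le_norm] by (auto simp: lp_le_def)

lemma lp_space_scale: "x \<in> lp_space p \<Longrightarrow> (\<lambda>n. k *\<^sub>R x n) \<in> lp_space p"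
  using lp_le_scale[OF p lp_le_norm, of x "\<bar>k\<bar>" "\<lambda>n. k *\<^sub>R x n"] by (auto simp: lp_le_def)

lemma norm_le_lp_norm: "x \<in> lp_space p \<Longrightarrow> norm (x n) \<le> lp_norm p x"
  using lp_le_component[OF p lp_le_norm] .

lemma norm_lp_norm_le: "lp_le p x M \<Longrightarrow> norm (lp_norm p x) \<le> M"
  using lp_norm_nonneg[of x p] by (simp add: lp_le_def)

lemma lp_has_derivative_on_component:
  assumes "lp_has_derivative_on p S u u'" "t \<in> S"
  shows "((\<lambda>t. u t n) has_vector_derivative u' t n) (at t within S)"
proof -
  have le: "norm ((u s n - u t n) /\<^sub>R (s - t) - u' t n)
      \<le> lp_norm p (\<lambda>n. (u s n - u t n) /\<^sub>R (s - t) - u' t n)" if "s \<in> S" for s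
  proof -
    have "(\<lambda>n. (u s n - u t n) /\<^sub>R (s - t) - u' t n) \<in> lp_space p"
      using assms that unfolding lp_has_derivative_on_def by (intro lp_space_diff lp_space_scale) auto
    from norm_le_lp_norm[OF this, of n] show ?thesis .
  qed
  have "eventually (\<lambda>s. norm ((u s n - u t n) /\<^sub>R (s - t) - u' t n)
      \<le> lp_norm p (\<lambda>n. (u s n - u t n) /\<^sub>R (s - t) - u' t n)) (at t within S)"
    unfolding eventually_at_filter using le by (intro always_eventually allI impI)
  moreover have "((\<lambda>s. lp_norm p (\<lambda>n. (u s n - u t n) /\<^sub>R (s - t) - u' t n)) \<longlongrightarrow> 0) (at t within S)"
    using assms unfolding lp_has_derivative_on_def lp_tendsto_def by blast
  ultimately have "((\<lambda>s. (u s n - u t n) /\<^sub>R (s - t) - u' t n) \<longlongrightarrow> 0) (at t within S)"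
    by (rule Lim_null_comparison)
  then show ?thesis
    unfolding tendsto_vector_difference_quotient LIM_zero_iff .
qed

lemma lp_le_lipschitz:
  fixes u :: "real \<Rightarrow> int \<Rightarrow> 'a::real_inner"
  assumes u: "\<And>n t. t \<in> {a..b} \<Longrightarrow> ((\<lambda>t. u t n) has_vector_derivative u' t n) (at t within {a..b})"
    and le: "\<And>t. t \<in> {a..b} \<Longrightarrow> lp_le p (u' t) B"
    and st: "s \<in> {a..b}" "t \<in> {a..b}"
  shows "lp_le p (\<lambda>n. u s n - u t n) (B * \<bar>s - t\<bar>)"
proof -
  have *: "lp_le p (\<lambda>n. u d n - u c n) (B * (d - c))" if cd: "a \<le> c" "c \<le> d" "d \<le> b" for c d
  proof -
    have "lp_le p (\<lambda>n. u d n - u c n) (B * d - B * c)"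
    proof (rule lp_le_mean_value[OF p cd(2), where u = u and u' = u' and \<psi> = "\<lambda>t. B * t" and \<psi>' = "\<lambda>_. B"])
      fix t assume t: "t \<in> {c..d}"
      show "((\<lambda>t. u t n) has_vector_derivative u' t n) (at t within {c..d})" for n
        by (rule has_vector_derivative_within_subset[OF u]) (use t cd in auto)
      show "((\<lambda>t. B * t) has_real_derivative B) (at t within {c..d})" by (rule DERIV_cmult_Id)
      show "lp_le p (u' t) B" using t cd by (intro le) auto
    qed
    then show ?thesis by (simp only: right_diff_distrib)
  qed
  show ?thesis
  proof (cases "t \<le> s")
    case True
    then show ?thesis using *[of t s] st by simp
  next
    case False
    then have "lp_le p (\<lambda>n. u t n - u s n) (B * \<bar>s - t\<bar>)"
      using *[of s t] st by simp
    then show ?thesis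
      by (rule lp_le_mono[OF p]) (simp add: norm_minus_commute)
  qed
qed

text \<open>
  A componentwise derivative is a derivative in the \<open>\<ell>\<^sub>p\<close> norm once it is Lipschitz in that norm. This turns
  the componentwise solutions constructed below into solutions in \<open>\<ell>\<^sub>p\<close>.
\<close>
lemma lp_has_derivative_onI:
  fixes u u' :: "real \<Rightarrow> int \<Rightarrow> 'a::real_inner" and a b C :: real
  assumes u: "\<And>n t. t \<in> {a..b} \<Longrightarrow> ((\<lambda>t. u t n) has_vector_derivative u' t n) (at t within {a..b})"
    and lp: "\<And>t. t \<in> {a..b} \<Longrightarrow> u t \<in> lp_space p" "\<And>t. t \<in> {a..b} \<Longrightarrow> u' t \<in> lp_space p"
    and lip: "\<And>s t. s \<in> {a..b} \<Longrightarrow> t \<in> {a..b} \<Longrightarrow> lp_le p (\<lambda>n. u' s n - u' t n) (C * \<bar>s - t\<bar>)"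
  shows "lp_has_derivative_on p {a..b} u u'"
proof -
  have "((\<lambda>s. lp_norm p (\<lambda>n. (u s n - u t n) /\<^sub>R (s - t) - u' t n)) \<longlongrightarrow> 0) (at t within {a..b})"
    if t: "t \<in> {a..b}" for t
  proof -
  \<comment> \<open>On an interval between \<open>s\<close> and \<open>t\<close> the curve \<open>\<sigma> \<mapsto> u \<sigma> - \<sigma> u' t\<close> has speed at most \<open>C * \<bar>s - t\<bar>\<close>.\<close>
  have remainder: "lp_le p (\<lambda>n. (u d n - d *\<^sub>R u' t n) - (u c n - c *\<^sub>R u' t n)) (C * \<bar>d - c\<bar> * d - C * \<bar>d - c\<bar> * c)"
    if cd: "a \<le> c" "c \<le> d" "d \<le> b" "t = c \<or> t = d" for c d
  proof (rule lp_le_mean_value[OF p \<open>c \<le> d\<close>, where u = "\<lambda>\<sigma> n. u \<sigma> n - \<sigma> *\<^sub>R u' t n"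
          and u' = "\<lambda>\<sigma> n. u' \<sigma> n - u' t n" and \<psi> = "\<lambda>\<sigma>. C * \<bar>d - c\<bar> * \<sigma>"
          and \<psi>' = "\<lambda>\<sigma>. C * \<bar>d - c\<bar>"])
    fix n \<sigma> assume \<sigma>: "\<sigma> \<in> {c..d}"
    have d1: "((\<lambda>t. u t n) has_vector_derivative u' \<sigma> n) (at \<sigma> within {c..d})"
      by (rule has_vector_derivative_within_subset[OF u]) (use \<sigma> cd in auto)
    have d2: "((\<lambda>\<sigma>. \<sigma> *\<^sub>R u' t n) has_vector_derivative u' t n) (at \<sigma> within {c..d})"
      by (simp add: has_vector_derivative_def bounded_linear_imp_has_derivative bounded_linear_scaleR_left)
    show "((\<lambda>\<sigma>. u \<sigma> n - \<sigma> *\<^sub>R u' t n) has_vector_derivative u' \<sigma> n - u' t n) (at \<sigma> within {c..d})"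
      by (rule has_vector_derivative_diff[OF d1 d2])
  next
    fix \<sigma> assume \<sigma>: "\<sigma> \<in> {c..d}"
    show "((\<lambda>\<sigma>. C * \<bar>d - c\<bar> * \<sigma>) has_real_derivative C * \<bar>d - c\<bar>) (at \<sigma> within {c..d})"
      by (intro DERIV_cmult_Id)
    have le: "lp_le p (\<lambda>n. u' \<sigma> n - u' t n) (C * \<bar>\<sigma> - t\<bar>)"
      using lip[OF _ t] \<sigma> cd by simp
    have "C * \<bar>\<sigma> - t\<bar> \<le> C * \<bar>d - c\<bar>"
    proof (cases "\<sigma> = t")
      case True
      then show ?thesis using lp_le_nonneg[OF lip[of c d]] cd by (auto simp: abs_minus_commute)
    next
      case False
      then have "0 \<le> C" using lp_le_nonneg[OF le] by (simp add: zero_le_mult_iff)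
      then show ?thesis using \<sigma> cd by (intro mult_left_mono) auto
    qed
    with le show "lp_le p (\<lambda>n. u' \<sigma> n - u' t n) (C * \<bar>d - c\<bar>)"
      by (rule lp_le_weaken)
  qed
  have quotient: "lp_le p (\<lambda>n. (u s n - u t n) /\<^sub>R (s - t) - u' t n) (C * \<bar>s - t\<bar>)"
    if s: "s \<in> {a..b}" "s \<noteq> t" for s
  proof -
    have "lp_le p (\<lambda>n. u s n - u t n - (s - t) *\<^sub>R u' t n) (C * \<bar>s - t\<bar> * \<bar>s - t\<bar>)"
    proof (cases "t \<le> s")
      case True
      then show ?thesis
        using remainder[of t s] s t by (simp add: algebra_simps)
    next
      case False
      then have "lp_le p (\<lambda>n. (u t n - t *\<^sub>R u' t n) - (u s n - s *\<^sub>R u' t n)) (C * \<bar>s - t\<bar> * \<bar>s - t\<bar>)"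
        using remainder[of s t] s t by (simp add: algebra_simps)
      then show ?thesis
      proof (rule lp_le_mono[OF p])
        show "norm (u s n - u t n - (s - t) *\<^sub>R u' t n)
          \<le> norm (u t n - t *\<^sub>R u' t n - (u s n - s *\<^sub>R u' t n))" for n
          by (rule eq_refl, subst norm_minus_cancel[symmetric]) (simp add: algebra_simps)
      qed
    qed
    then have "lp_le p (\<lambda>n. (u s n - u t n) /\<^sub>R (s - t) - u' t n) (inverse \<bar>s - t\<bar> * (C * \<bar>s - t\<bar> * \<bar>s - t\<bar>))"
    proof (rule lp_le_scale[OF p])
      fix n
      have "(u s n - u t n) /\<^sub>R (s - t) - u' t n = (u s n - u t n - (s - t) *\<^sub>R u' t n) /\<^sub>R (s - t)"
        using s by (simp add: scaleR_diff_right)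
      then show "norm ((u s n - u t n) /\<^sub>R (s - t) - u' t n)
          \<le> inverse \<bar>s - t\<bar> * norm (u s n - u t n - (s - t) *\<^sub>R u' t n)"
        by simp
    qed simp
    moreover have "inverse \<bar>s - t\<bar> * (C * \<bar>s - t\<bar> * \<bar>s - t\<bar>) = C * \<bar>s - t\<bar>"
      using s by (simp add: field_simps)
    ultimately show ?thesis by (simp only:)
  qed
  have "eventually (\<lambda>s. norm (lp_norm p (\<lambda>n. (u s n - u t n) /\<^sub>R (s - t) - u' t n)) \<le> C * \<bar>s - t\<bar>)
      (at t within {a..b})"
    unfolding eventually_at_filter
    by (intro always_eventually allI impI) (rule norm_lp_norm_le[OF quotient])
  moreover have "((\<lambda>s. C * \<bar>s - t\<bar>) \<longlongrightarrow> 0) (at t within {a..b})"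
    by (auto intro!: tendsto_eq_intros)
  ultimately show ?thesis
    by (rule Lim_null_comparison)
  qed
  then show ?thesis
    using lp by (simp add: lp_has_derivative_on_def lp_tendsto_def)
qed

lemma lp_has_derivative_on_continuous_norm:
  fixes u :: "real \<Rightarrow> int \<Rightarrow> 'a::real_inner"
  assumes der: "lp_has_derivative_on p {a..b} u u'"
  shows "continuous_on {a..b} (\<lambda>t. lp_norm p (u t))"
proof -
  have lpu: "u t \<in> lp_space p" if "t \<in> {a..b}" for t
    using der that by (auto simp: lp_has_derivative_on_def)
  have cont: "((\<lambda>s. lp_norm p (u s)) \<longlongrightarrow> lp_norm p (u t)) (at t within {a..b})" if t: "t \<in> {a..b}" for t
  proof -
    let ?q = "\<lambda>s n. (u s n - u t n) /\<^sub>R (s - t) - u' t n"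
    have u't: "u' t \<in> lp_space p" 
      and lim: "((\<lambda>s. lp_norm p (?q s)) \<longlongrightarrow> 0) (at t within {a..b})"
      using der t by (auto simp: lp_has_derivative_on_def lp_tendsto_def)
    have bound: "\<bar>lp_norm p (u s) - lp_norm p (u t)\<bar> \<le> \<bar>s - t\<bar> * (lp_norm p (?q s) + lp_norm p (u' t))"
      (is "_ \<le> ?B s") if s: "s \<in> {a..b}" "s \<noteq> t" for s
    proof -
      have "?q s \<in> lp_space p"
        using s t u't by (intro lp_space_diff lp_space_scale lpu)
      then have "lp_le p (\<lambda>n. ?q s n + u' t n) (lp_norm p (?q s) + lp_norm p (u' t))"
        using u't by (intro lp_le_add[OF p] lp_le_norm)
      then have d: "lp_le p (\<lambda>n. u s n - u t n) (?B s)"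
        by (rule lp_le_scale[OF p]) (use s in \<open>simp_all add: abs_inverse flip: mult.assoc\<close>)
      have "lp_le p (u s) (?B s + lp_norm p (u t))"
        using lp_le_add[OF p d lp_le_norm[OF lpu[OF t]]] by simp
      moreover have "lp_le p (u t) (lp_norm p (u s) + ?B s)"
        using lp_le_diff[OF p lp_le_norm[OF lpu[OF s(1)]] d] by simp
      ultimately show ?thesis unfolding lp_le_def by linarith
    qed
    have "((\<lambda>s. ?B s) \<longlongrightarrow> \<bar>t - t\<bar> * (0 + lp_norm p (u' t))) (at t within {a..b})"
      by (intro tendsto_intros lim)
    then have "((\<lambda>s. ?B s) \<longlongrightarrow> 0) (at t within {a..b})"
      by simp
    moreover have "eventually (\<lambda>s. norm (lp_norm p (u s) - lp_norm p (u t)) \<le> ?B s) (at t within {a..b})"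
      unfolding eventually_at_filter
      by (intro always_eventually allI impI) (use bound in auto)
    ultimately show ?thesis
      by (rule Lim_null_comparison[THEN LIM_zero_cancel, rotated])
  qed
  then show ?thesis by (auto simp: continuous_on_def)
qed

text \<open>
  In the weighted supremum norm with weight \<open>exp (-2 L t)\<close>, integrating a Lipschitz right-hand side with constant
  \<open>L\<close> halves the norm. Both the Gronwall inequality and the Picard iteration rest on this contraction.
\<close>
lemma lp_le_exp_weight:
  fixes v v' :: "real \<Rightarrow> int \<Rightarrow> 'a::real_inner" and K L t :: real
  assumes t: "t \<in> {0..\<tau>}" and v0: "\<And>n. v 0 n = 0" and K: "0 \<le> K"
    and v: "\<And>n t. t \<in> {0..\<tau>} \<Longrightarrow> ((\<lambda>t. v t n) has_vector_derivative v' t n) (at t within {0..\<tau>})"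
    and v': "\<And>t. t \<in> {0..\<tau>} \<Longrightarrow> lp_le p (v' t) (L * (K * exp (2 * L * t)))"
  shows "lp_le p (v t) (K / 2 * exp (2 * L * t))"
proof -
  have "lp_le p (\<lambda>n. v t n - v 0 n) (K / 2 * exp (2 * L * t) - K / 2 * exp (2 * L * 0))"
  proof (rule lp_le_mean_value[OF p, where u = v and u' = v' and \<psi> = "\<lambda>t. K / 2 * exp (2 * L * t)"])
    show "0 \<le> t" using t by simp
  next
    fix n s assume s: "s \<in> {0..t}"
    show "((\<lambda>t. v t n) has_vector_derivative v' s n) (at s within {0..t})"
      by (rule has_vector_derivative_within_subset[OF v]) (use s t in auto)
  next
    fix s assume s: "s \<in> {0..t}"
    show "((\<lambda>t. K / 2 * exp (2 * L * t)) has_real_derivative L * (K * exp (2 * L * s))) (at s within {0..t})"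
      by (auto intro!: derivative_eq_intros)
    show "lp_le p (v' s) (L * (K * exp (2 * L * s)))"
      using s t by (intro v') auto
  qed
  then show ?thesis
    by (rule lp_le_weaken[OF lp_le_mono[OF p]]) (use K in \<open>auto simp: v0\<close>)
qed

text \<open>
  A crude a priori bound \<open>K0\<close> is improved repeatedly: a bound \<open>K exp (2 L t)\<close> on \<open>u\<close> yields
  \<open>(A + K / 2) exp (2 L t)\<close>, and the iterates converge to \<open>2 A exp (2 L t)\<close>. The norm of \<open>u\<close> never has to be integrated
  in time.
\<close>
lemma lp_gronwall:
  fixes u v :: "real \<Rightarrow> int \<Rightarrow> 'a::real_inner"
  assumes L: "0 \<le> L" and \<tau>: "0 \<le> \<tau>"
    and v: "\<And>n t. t \<in> {0..\<tau>} \<Longrightarrow> ((\<lambda>t. v t n) has_vector_derivative v' t n) (at t within {0..\<tau>})"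
    and v0: "\<And>n. v 0 n = 0"
    and rest: "\<And>t. t \<in> {0..\<tau>} \<Longrightarrow> lp_le p (\<lambda>n. u t n - v t n) A"
    and lip: "\<And>t K. t \<in> {0..\<tau>} \<Longrightarrow> lp_le p (u t) K \<Longrightarrow> lp_le p (v' t) (L * K)"
    and bdd: "\<And>t. t \<in> {0..\<tau>} \<Longrightarrow> lp_le p (u t) K0"
    and t: "t \<in> {0..\<tau>}"
  shows "lp_le p (u t) (2 * A * exp (2 * L * t))"
proof -
  have A: "0 \<le> A" using lp_le_nonneg[OF rest[OF t]] .
  have K0: "0 \<le> K0" using lp_le_nonneg[OF bdd[OF t]] .
  have "lp_le p (u t) ((2 * A + K0 / 2 ^ k) * exp (2 * L * t))" if "t \<in> {0..\<tau>}" for k t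
    using that
  proof (induction k arbitrary: t)
    case 0
    have "K0 * 1 \<le> (2 * A + K0) * exp (2 * L * t)"
      using A K0 L 0 by (intro mult_mono) auto
    then show ?case using bdd[OF 0] by (auto intro: lp_le_weaken)
  next
    case (Suc k)
    define K where "K = 2 * A + K0 / 2 ^ k"
    have "lp_le p (v t) (K / 2 * exp (2 * L * t))"
    proof (rule lp_le_exp_weight[OF Suc.prems v0 _ v])
      show "0 \<le> K" using A K0 by (simp add: K_def)
      show "lp_le p (v' s) (L * (K * exp (2 * L * s)))" if "s \<in> {0..\<tau>}" for s
        using Suc.IH[OF that] that by (intro lip) (simp_all add: K_def)
    qed
    then have "lp_le p (u t) (A + K / 2 * exp (2 * L * t))"
      using lp_le_add[OF p rest[OF Suc.prems]] by fastforce
    then show ?case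
    proof (rule lp_le_weaken)
      have "A * 1 \<le> A * exp (2 * L * t)"
        using A L Suc.prems by (intro mult_left_mono) auto
      then show "A + K / 2 * exp (2 * L * t) \<le> (2 * A + K0 / 2 ^ Suc k) * exp (2 * L * t)"
        unfolding K_def by (simp add: distrib_right add_divide_distrib)
    qed
  qed
  then have "eventually (\<lambda>k. lp_le p (u t) ((2 * A + K0 / 2 ^ k) * exp (2 * L * t))) sequentially"
    using t by simp
  then show ?thesis
  proof (rule lp_le_limit[OF p])
    have "(\<lambda>k. (2 * A + K0 * (1 / 2) ^ k) * exp (2 * L * t)) \<longlonglongrightarrow> (2 * A + K0 * 0) * exp (2 * L * t)"
      by (intro tendsto_intros LIMSEQ_power_zero) auto
    then show "(\<lambda>k. (2 * A + K0 / 2 ^ k) * exp (2 * L * t)) \<longlonglongrightarrow> 2 * A * exp (2 * L * t)"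
      by (simp add: power_one_over)
  qed auto
qed

end

context
  fixes p :: ereal
  assumes p: "1 \<le> p"
begin

text \<open>
  Existence for a globally Lipschitz field. The field is integrated component by component, so continuity in
  time is needed for components only, whereas convergence of the iterates is measured in \<open>\<ell>\<^sub>p\<close>.
\<close>
lemma lp_picard:
  fixes \<Phi> :: "real \<Rightarrow> (int \<Rightarrow> 'a::euclidean_space) \<Rightarrow> int \<Rightarrow> 'a" and \<tau> L A :: real
  assumes L: "0 \<le> L" and \<tau>: "0 \<le> \<tau>"
    and lip: "\<And>t x y M. t \<in> {0..\<tau>} \<Longrightarrow> lp_le p (\<lambda>n. x n - y n) M \<Longrightarrow>
      lp_le p (\<lambda>n. \<Phi> t x n - \<Phi> t y n) (L * M)"
    and zero: "\<And>t. t \<in> {0..\<tau>} \<Longrightarrow> \<Phi> t (\<lambda>_. 0) = (\<lambda>_. 0)"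
    and cont: "\<And>u n. (\<And>m. continuous_on {0..\<tau>} (\<lambda>t. u t m)) \<Longrightarrow> continuous_on {0..\<tau>} (\<lambda>t. \<Phi> t (u t) n)"
    and x0: "lp_le p x0 A"
  obtains u K where "u 0 = x0"
    and "\<And>n t. t \<in> {0..\<tau>} \<Longrightarrow> ((\<lambda>t. u t n) has_vector_derivative \<Phi> t (u t) n) (at t within {0..\<tau>})"
    and "\<And>t. t \<in> {0..\<tau>} \<Longrightarrow> lp_le p (u t) K"
proof -
  define it where "it k = ((\<lambda>u t n. x0 n + integral {0..t} (\<lambda>s. \<Phi> s (u s) n)) ^^ k) (\<lambda>t. x0)" for k
  have it_0: "it 0 t n = x0 n" and it_Suc: "it (Suc k) t n = x0 n + integral {0..t} (\<lambda>s. \<Phi> s (it k s) n)" for k t n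
    by (simp_all add: it_def)
  have A: "0 \<le> A" using lp_le_nonneg[OF x0] .
  have deriv_integral: "((\<lambda>t. x0 n + integral {0..t} (\<lambda>s. \<Phi> s (u s) n)) has_vector_derivative \<Phi> t (u t) n) (at t within {0..\<tau>})"
    if "\<And>m. continuous_on {0..\<tau>} (\<lambda>t. u t m)" "t \<in> {0..\<tau>}" for u t n
  proof -
    have "((\<lambda>t. integral {0..t} (\<lambda>s. \<Phi> s (u s) n)) has_vector_derivative \<Phi> t (u t) n) (at t within {0..\<tau>})"
      by (rule integral_has_vector_derivative[OF cont[OF that(1)] that(2)])
    then show ?thesis
      using has_vector_derivative_add[OF has_vector_derivative_const[of "x0 n"]] by fastforce
  qed
  have it_cont: "continuous_on {0..\<tau>} (\<lambda>t. it k t m)" for k m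
  proof (induction k arbitrary: m)
    case 0
    then show ?case by (simp add: it_0)
  next
    case (Suc k)
    show ?case
      unfolding it_Suc by (rule continuous_on_vector_derivative[OF deriv_integral[OF Suc]])
  qed
  have it_deriv: "((\<lambda>t. it (Suc k) t n) has_vector_derivative \<Phi> t (it k t) n) (at t within {0..\<tau>})"
    if "t \<in> {0..\<tau>}" for k n t
    unfolding it_Suc by (rule deriv_integral[OF it_cont that])
  have size: "lp_le p (\<Phi> t x) (L * M)" if "t \<in> {0..\<tau>}" "lp_le p x M" for t x M
    using lip[of t x "\<lambda>_. 0" M] that by (simp add: zero)
  have step: "lp_le p (\<lambda>n. it (Suc k) t n - it k t n) (A / 2 ^ k * exp (2 * L * t))"
    if "t \<in> {0..\<tau>}" for k t
    using that
  proof (induction k arbitrary: t)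
    case 0
    have "lp_le p (\<lambda>n. it (Suc 0) t n - x0 n) (A / 2 * exp (2 * L * t))"
    proof (rule lp_le_exp_weight[OF p 0 _ A, where v = "\<lambda>t n. it (Suc 0) t n - x0 n" and v' = "\<lambda>t. \<Phi> t x0"])
      fix s n assume s: "s \<in> {0..\<tau>}"
      have "it 0 s = x0" by (auto simp: it_0)
      with has_vector_derivative_diff[OF it_deriv[OF s, of 0 n] has_vector_derivative_const[of "x0 n"]]
      show "((\<lambda>t. it (Suc 0) t n - x0 n) has_vector_derivative \<Phi> s x0 n) (at s within {0..\<tau>})"
        by simp
    next
      fix s assume s: "s \<in> {0..\<tau>}"
      have "A * 1 \<le> A * exp (2 * L * s)"
        using A L s by (intro mult_left_mono) auto
      then have "lp_le p x0 (A * exp (2 * L * s))"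
        using x0 by (auto intro: lp_le_weaken)
      from size[OF s this] show "lp_le p (\<Phi> s x0) (L * (A * exp (2 * L * s)))" .
    qed (simp add: it_Suc)
    then show ?case
      by (rule lp_le_weaken[OF lp_le_mono[OF p]]) (use A in \<open>auto simp: it_0\<close>)
  next
    case (Suc k)
    have "lp_le p (\<lambda>n. it (Suc (Suc k)) t n - it (Suc k) t n) (A / 2 ^ k / 2 * exp (2 * L * t))"
    proof (rule lp_le_exp_weight[OF p Suc.prems, where v = "\<lambda>t n. it (Suc (Suc k)) t n - it (Suc k) t n"
            and v' = "\<lambda>t n. \<Phi> t (it (Suc k) t) n - \<Phi> t (it k t) n"])
      show "((\<lambda>t. it (Suc (Suc k)) t n - it (Suc k) t n) has_vector_derivative
          \<Phi> s (it (Suc k) s) n - \<Phi> s (it k s) n) (at s within {0..\<tau>})" if "s \<in> {0..\<tau>}" for s n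
        by (intro has_vector_derivative_diff it_deriv that)
      show "lp_le p (\<lambda>n. \<Phi> s (it (Suc k) s) n - \<Phi> s (it k s) n) (L * (A / 2 ^ k * exp (2 * L * s)))"
        if "s \<in> {0..\<tau>}" for s
        by (rule lip[OF that Suc.IH[OF that]])
    qed (use A in \<open>simp_all add: it_Suc\<close>)
    then show ?case by (simp add: mult.commute)
  qed

  define B where "B = A * exp (2 * L * \<tau>)"
  have B: "0 \<le> B" using A by (simp add: B_def)
  have step': "lp_le p (\<lambda>n. it (Suc k) t n - it k t n) (B / 2 ^ k)" if "t \<in> {0..\<tau>}" for k t
  proof -
    have "A * exp (2 * L * t) \<le> B"
      unfolding B_def using A L that by (intro mult_left_mono) (auto intro: mult_left_mono)
    then have "A * exp (2 * L * t) / 2 ^ k \<le> B / 2 ^ k"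
      by (rule divide_right_mono) simp
    then show ?thesis using step[OF that] by (auto intro: lp_le_weaken)
  qed
  have far: "lp_le p (\<lambda>n. it (k + j) t n - it k t n) (2 * B / 2 ^ k)" if t: "t \<in> {0..\<tau>}" for k j t
  proof -
    have "lp_le p (\<lambda>n. it (k + j) t n - it k t n) (2 * B / 2 ^ k - 2 * B / 2 ^ (k + j))"
    proof (induction j)
      case 0
      then show ?case using lp_le_zero[OF p] by simp
    next
      case (Suc j)
      have "lp_le p (\<lambda>n. it (k + Suc j) t n - it k t n) ((2 * B / 2 ^ k - 2 * B / 2 ^ (k + j)) + B / 2 ^ (k + j))"
        by (rule lp_le_mono[OF p lp_le_add[OF p Suc step'[OF t, of "k + j"]]]) simp
      then show ?case
        by (rule lp_le_weaken) (simp add: field_simps)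
    qed
    then show ?thesis by (rule lp_le_weaken) (use B in simp)
  qed
  have small: "(\<lambda>k. c / 2 ^ k) \<longlonglongrightarrow> 0" for c :: real
    using tendsto_mult_right_zero[OF LIMSEQ_power_zero[of "1 / 2 :: real"], of c]
    by (simp add: power_one_over)

  define u where "u t n = lim (\<lambda>k. it k t n)" for t n
  have conv: "(\<lambda>k. it k t n) \<longlonglongrightarrow> u t n" if t: "t \<in> {0..\<tau>}" for t n
  proof -
    have "Cauchy (\<lambda>k. it k t n)"
    proof (rule CauchyI)
      fix e :: real assume "0 < e"
      then obtain M where M: "2 * B / 2 ^ M < e / 2"
        using order_tendstoD(2)[OF small[of "2 * B"], of "e / 2"] by (auto simp: eventually_sequentially)
      have near: "norm (it m t n - it M t n) < e / 2" if "M \<le> m" for m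
        using lp_le_component[OF p far[OF t, of M "m - M"], of n] that M by simp
      have "norm (it m t n - it l t n) < e" if "M \<le> m" "M \<le> l" for m l
        using norm_triangle_ineq4[of "it m t n - it M t n" "it l t n - it M t n"] near[OF that(1)] near[OF that(2)] by simp
      then show "\<exists>M. \<forall>m\<ge>M. \<forall>l\<ge>M. norm (it m t n - it l t n) < e"
        by (intro exI[of _ M]) auto
    qed
    then show ?thesis
      unfolding u_def by (simp add: Cauchy_convergent_iff convergent_LIMSEQ_iff)
  qed
  have close: "lp_le p (\<lambda>n. u t n - it k t n) (2 * B / 2 ^ k)" if t: "t \<in> {0..\<tau>}" for t k
  proof (rule lp_le_limit[OF p, where F = sequentially and x = "\<lambda>j n. it (k + j) t n - it k t n" and M = "\<lambda>_. 2 * B / 2 ^ k"])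
    show "(\<lambda>j. it (k + j) t n - it k t n) \<longlonglongrightarrow> u t n - it k t n" for n
      using LIMSEQ_ignore_initial_segment[OF conv[OF t], of k] by (intro tendsto_diff) (simp_all add: add.commute)
  qed (use far[OF t] in auto)
  have uniform: "uniform_limit {0..\<tau>} (\<lambda>k t. it k t n) (\<lambda>t. u t n) sequentially" for n
  proof (rule uniform_limitI)
    fix e :: real assume "0 < e"
    from order_tendstoD(2)[OF small[of "2 * B"] this]
    show "\<forall>\<^sub>F k in sequentially. \<forall>t\<in>{0..\<tau>}. dist (it k t n) (u t n) < e"
    proof eventually_elim
      case (elim k)
      show ?case
      proof
        fix t assume "t \<in> {0..\<tau>}"
        from lp_le_component[OF p close[OF this, of k], of n] elim
        show "dist (it k t n) (u t n) < e"
          by (simp add: dist_norm norm_minus_commute)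
      qed
    qed
  qed
  have u_cont: "continuous_on {0..\<tau>} (\<lambda>t. u t n)" for n
    by (rule uniform_limit_theorem[OF _ uniform]) (auto intro: it_cont always_eventually)
  have u_eq: "u t n = x0 n + integral {0..t} (\<lambda>s. \<Phi> s (u s) n)" if t: "t \<in> {0..\<tau>}" for t n
  proof -
    have sub: "{0..t} \<subseteq> {0..\<tau>}" using t by auto
    have "uniform_limit {0..t} (\<lambda>k s. \<Phi> s (it k s) n) (\<lambda>s. \<Phi> s (u s) n) sequentially"
    proof (rule uniform_limitI)
      fix e :: real assume "0 < e"
      from order_tendstoD(2)[OF small[of "L * (2 * B)"] this]
      show "\<forall>\<^sub>F k in sequentially. \<forall>s\<in>{0..t}. dist (\<Phi> s (it k s) n) (\<Phi> s (u s) n) < e"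
      proof eventually_elim
        case (elim k)
        show ?case
        proof
          fix s assume "s \<in> {0..t}"
          then have s: "s \<in> {0..\<tau>}" using sub by auto
          show "dist (\<Phi> s (it k s) n) (\<Phi> s (u s) n) < e"
            using lp_le_component[OF p lip[OF s close[OF s, of k]], of n] elim
            by (simp add: dist_norm norm_minus_commute)
        qed
      qed
    qed
    then obtain I J where IJ: "\<And>k. ((\<lambda>s. \<Phi> s (it k s) n) has_integral I k) {0..t}"
        "((\<lambda>s. \<Phi> s (u s) n) has_integral J) {0..t}" "I \<longlonglongrightarrow> J"
      by (rule uniform_limit_integral)
        (auto intro: continuous_on_subset[OF cont[OF it_cont] sub])
    have "(\<lambda>k. it (Suc k) t n) \<longlonglongrightarrow> x0 n + J"
      using tendsto_add[OF tendsto_const IJ(3), of "x0 n"] by (simp add: it_Suc integral_unique[OF IJ(1)])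
    then have "u t n = x0 n + J"
      using LIMSEQ_unique LIMSEQ_Suc[OF conv[OF t]] by blast
    then show ?thesis using IJ(2) by (simp add: integral_unique)
  qed
  show thesis
  proof
    show "u 0 = x0" using u_eq[of 0] \<tau> by auto
    show "((\<lambda>t. u t n) has_vector_derivative \<Phi> t (u t) n) (at t within {0..\<tau>})" if "t \<in> {0..\<tau>}" for t n
      by (rule has_vector_derivative_transform[OF that _ deriv_integral[OF u_cont that]]) (use u_eq in auto)
    show "lp_le p (u t) (A + 2 * B)" if "t \<in> {0..\<tau>}" for t
      by (rule lp_le_mono[OF p lp_le_add[OF p x0 close[OF that, of 0, simplified]]]) (simp add: it_0)
  qed
qed

end

section \<open>The leading force and its average over a period\<close>

definition pos_powr :: "real \<Rightarrow> real \<Rightarrow> real" where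
  "pos_powr e x = (max 0 x) powr e"

lemma pos_powr_pos [simp]: "0 \<le> x \<Longrightarrow> pos_powr e x = x powr e"
  by (simp add: pos_powr_def)

lemma pos_powr_neg [simp]: "x \<le> 0 \<Longrightarrow> pos_powr e x = 0"
  by (simp add: pos_powr_def)

lemma pos_powr_mult: "0 \<le> c \<Longrightarrow> pos_powr e (c * x) = c powr e * pos_powr e x"
  by (cases "0 \<le> x") (simp_all add: powr_mult mult_nonneg_nonpos)

lemma pos_powr_bounds: "0 \<le> e \<Longrightarrow> 0 \<le> pos_powr e x \<and> pos_powr e x \<le> \<bar>x\<bar> powr e"
  by (cases "0 \<le> x") simp_all

lemma continuous_on_abs_powr: "0 < e \<Longrightarrow> continuous_on S (\<lambda>x::real. \<bar>x\<bar> powr e)"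
  by (intro continuous_on_powr' continuous_intros) auto

lemma continuous_on_pos_powr [continuous_intros]:
  "0 < e \<Longrightarrow> continuous_on S f \<Longrightarrow> continuous_on S (\<lambda>x. pos_powr e (f x))"
  unfolding pos_powr_def by (intro continuous_on_powr' continuous_intros) auto

text \<open>
  At the origin the difference quotient is at most \<open>\<bar>y\<bar> powr (e - 1)\<close>; this is where \<open>\<alpha> > 1\<close> makes the force
  continuously differentiable.
\<close>
lemma has_real_derivative_pos_powr:
  assumes e: "1 < e"
  shows "(pos_powr e has_real_derivative e * pos_powr (e - 1) x) (at x)"
proof (cases x "0 :: real" rule: linorder_cases)
  case greater
  have "((\<lambda>x. x powr e) has_real_derivative e * pos_powr (e - 1) x) (at x)"
    using greater has_real_derivative_powr[of x e] by simp
  then show ?thesis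
    by (rule has_field_derivative_transform_within_open[of _ _ _ "{0<..}"]) (use greater in auto)
next
  case less
  have "((\<lambda>x. 0) has_real_derivative e * pos_powr (e - 1) x) (at x)"
    using less by simp
  then show ?thesis
    by (rule has_field_derivative_transform_within_open[of _ _ _ "{..<0}"]) (use less in auto)
next
  case equal
  have "isCont (\<lambda>y::real. \<bar>y\<bar> powr (e - 1)) 0"
    using continuous_on_abs_powr[of "e - 1" UNIV] e by (simp add: continuous_on_eq_continuous_at)
  then have lim: "((\<lambda>y. \<bar>y\<bar> powr (e - 1)) \<longlongrightarrow> 0) (at (0::real))"
    using isContD by fastforce
  have "norm (pos_powr e y / y) \<le> \<bar>y\<bar> powr (e - 1)" if "y \<noteq> 0" for y
    using pos_powr_bounds[of e y] e that by (simp add: powr_diff divide_right_mono)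
  then have "eventually (\<lambda>y. norm (pos_powr e y / y) \<le> \<bar>y\<bar> powr (e - 1)) (at 0)"
    by (simp add: eventually_at_filter)
  from Lim_null_comparison[OF this lim] show ?thesis
    using e equal by (simp add: has_field_derivative_iff)
qed

lemma has_real_derivative_pos_powr_chain [derivative_intros]:
  "1 < e \<Longrightarrow> (f has_real_derivative f') (at x within S) \<Longrightarrow>
    ((\<lambda>x. pos_powr e (f x)) has_real_derivative e * pos_powr (e - 1) (f x) * f') (at x within S)"
  by (rule DERIV_chain2[OF has_real_derivative_pos_powr])

text \<open>
  The integral over a period does not depend on the starting point nor on a shift of the argument.
\<close>
lemma periodic_has_integral_shift:
  fixes F :: "real \<Rightarrow> 'a::euclidean_space"
  assumes cont: "continuous_on UNIV F" and per: "\<And>x. F (x + T) = F x" and "0 \<le> T"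
    and I: "(F has_integral I) {a..a + T}"
  shows "((\<lambda>x. F (x + \<theta>)) has_integral I) {b..b + T}"
proof -
  have int: "F integrable_on {c..d}" for c d
    using cont by (intro integrable_continuous_real) (auto intro: continuous_on_subset)
  have shift: "integral {c..d} (\<lambda>x. F (x + s)) = integral {c + s..d + s} F" for c d s
    using integral_shift[of c s d F] cont by (auto intro: continuous_on_subset simp: o_def)
  have indep: "integral {c..c + T} F = integral {d..d + T} F" if "c \<le> d" for c d
  proof -
    have "integral {c..c + T} F + integral {c + T..d + T} F = integral {c..d} F + integral {d..d + T} F"
      using Henstock_Kurzweil_Integration.integral_combine[where a = c and c = "c + T" and b = "d + T" and f = F]
        Henstock_Kurzweil_Integration.integral_combine[where a = c and c = d and b = "d + T" and f = F]
        that \<open>0 \<le> T\<close> int by simp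
    moreover have "integral {c + T..d + T} F = integral {c..d} F"
      using shift[of c d T] by (simp add: per)
    ultimately show ?thesis by simp
  qed
  have "integral {b + \<theta>..b + \<theta> + T} F = I"
    using indep[of a "b + \<theta>"] indep[of "b + \<theta>" a] integral_unique[OF I] by fastforce
  then have "integral {b..b + T} (\<lambda>x. F (x + \<theta>)) = I"
    using shift[of b "b + T" \<theta>] by (simp add: add.commute add.left_commute)
  moreover have "(\<lambda>x. F (x + \<theta>)) integrable_on {b..b + T}"
    by (intro integrable_continuous_real continuous_on_compose2[OF cont] continuous_intros) auto
  ultimately show ?thesis
    using has_integral_integral by blast
qed

lemma Gamma_legendre_duplication_real:
  assumes "0 < (z::real)"
  shows "Gamma z * Gamma (z + 1 / 2) = 2 powr (1 - 2 * z) * sqrt pi * Gamma (2 * z)"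
proof -
  have not_pole: "complex_of_real x \<notin> \<int>\<^sub>\<le>\<^sub>0" if "0 < x" for x :: real
    using nonpos_Ints_nonpos[of x] that by (metis leD of_real_in_nonpos_Ints_iff)
  have "Gamma (complex_of_real z) * Gamma (complex_of_real z + 1 / 2) =
      exp ((1 - 2 * complex_of_real z) * of_real (ln 2)) * of_real (sqrt pi) * Gamma (2 * complex_of_real z)"
    using not_pole[of z] not_pole[of "z + 1 / 2"] assms by (intro Gamma_legendre_duplication) auto
  moreover have "complex_of_real z + 1 / 2 = of_real (z + 1 / 2)"
    "(1 - 2 * complex_of_real z) * of_real (ln 2) = of_real ((1 - 2 * z) * ln 2)"
    "2 * complex_of_real z = of_real (2 * z)" by simp_all
  ultimately have "complex_of_real (Gamma z) * of_real (Gamma (z + 1 / 2))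
      = of_real (exp ((1 - 2 * z) * ln 2)) * of_real (sqrt pi) * of_real (Gamma (2 * z))"
    by (simp only: Gamma_complex_of_real exp_of_real)
  then have "complex_of_real (Gamma z * Gamma (z + 1 / 2))
      = complex_of_real (exp ((1 - 2 * z) * ln 2) * sqrt pi * Gamma (2 * z))"
    by (simp only: of_real_mult)
  then show ?thesis
    unfolding of_real_eq_iff by (simp add: powr_def)
qed

text \<open>
  The substitution \<open>t = (1 + sin x) / 2\<close> gives \<open>cos x / 2 = sqrt (t (1 - t))\<close> and turns the integral into
  \<open>2 powr e * Beta ((e + 1) / 2) ((e + 1) / 2)\<close>, whose integrand is continuous on the closed interval; the duplication
  formula reduces it to a quotient of two Gamma values.
\<close>
lemma has_integral_cos_powr:
  assumes e: "1 < e"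
  shows "((\<lambda>x. cos x powr e) has_integral sqrt pi * Gamma ((e + 1) / 2) / Gamma (e / 2 + 1)) {- (pi / 2)..pi / 2}"
proof -
  define a where "a = (e + 1) / 2"
  have a: "1 < a" "e = 2 * a - 1" using e by (simp_all add: a_def field_simps)
  define f where "f t = 2 powr e * (t powr (a - 1) * (1 - t) powr (a - 1))" for t :: real
  have "(f has_integral 2 powr e * Beta a a) {0..1}"
    unfolding f_def using a by (intro has_integral_mult_right has_integral_Beta_real) auto
  moreover have "2 powr e * Beta a a = sqrt pi * Gamma a / Gamma (a + 1 / 2)"
  proof -
    have "Gamma a \<noteq> 0" "Gamma (2 * a) \<noteq> 0" "Gamma (a + 1 / 2) \<noteq> 0"
      by (rule less_imp_neq[OF Gamma_real_pos, symmetric], use a in simp)+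
    moreover have "2 powr e * (Gamma a * Gamma (a + 1 / 2)) = sqrt pi * Gamma (2 * a)"
    proof -
      have "2 powr e * 2 powr (1 - 2 * a) = 1"
        using a by (simp flip: powr_add)
      then show ?thesis
        using Gamma_legendre_duplication_real[of a] a(1) by (simp flip: mult.assoc)
    qed
    moreover have "a + a = 2 * a" by simp
    ultimately show ?thesis
      unfolding Beta_def by (simp add: frac_eq_eq mult_ac)
  qed
  ultimately have int_f: "integral {0..1} f = sqrt pi * Gamma a / Gamma (a + 1 / 2)"
    by (simp add: integral_unique)
  define g where "g x = (1 + sin x) / 2" for x :: real
  have g_bounds: "0 \<le> g x \<and> g x \<le> 1" for x
    unfolding g_def using sin_ge_minus_one[of x] sin_le_one[of x] by argo
  have "((\<lambda>x. (cos x / 2) *\<^sub>R f (g x)) has_integral integral {g (- (pi / 2))..g (pi / 2)} f) {- (pi / 2)..pi / 2}"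
  proof (rule has_integral_substitution[where c = 0 and d = 1])
    show "- (pi / 2) \<le> pi / 2" "g (- (pi / 2)) \<le> g (pi / 2)" by (auto simp: g_def)
    show "g ` {- (pi / 2)..pi / 2} \<subseteq> {0..1}"
      using g_bounds by auto
    show "continuous_on {0..1} f"
      unfolding f_def using a by (intro continuous_intros continuous_on_powr') auto
    show "(g has_field_derivative cos x / 2) (at x within {- (pi / 2)..pi / 2})" for x
      unfolding g_def by (auto intro!: derivative_eq_intros)
  qed
  then have "((\<lambda>x. (cos x / 2) *\<^sub>R f (g x)) has_integral sqrt pi * Gamma a / Gamma (a + 1 / 2)) {- (pi / 2)..pi / 2}"
    by (simp add: g_def int_f)
  moreover have "(cos x / 2) *\<^sub>R f (g x) = cos x powr e" if "x \<in> {- (pi / 2)..pi / 2}" for x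
  proof (cases "cos x = 0")
    case False
    have c: "0 < cos x" using cos_ge_zero[of x] that False by auto
    have "g x powr (a - 1) * (1 - g x) powr (a - 1) = (g x * (1 - g x)) powr (a - 1)"
      using g_bounds[of x] by (simp add: powr_mult)
    also have "g x * (1 - g x) = (1 - (sin x)\<^sup>2) / 4"
      by (simp add: g_def field_simps power2_eq_square)
    also have "\<dots> = (cos x / 2) powr 2"
      using c by (simp add: power_divide flip: cos_squared_eq)
    also have "\<dots> powr (a - 1) = (cos x / 2) powr (e - 1)"
    proof -
      have "2 * (a - 1) = e - 1" using a by simp
      then show ?thesis by (simp only: powr_powr)
    qed
    finally have "(cos x / 2) *\<^sub>R f (g x) = 2 powr e * ((cos x / 2) powr (e - 1) * (cos x / 2) powr 1)"
      using c by (simp add: f_def)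
    also have "(cos x / 2) powr (e - 1) * (cos x / 2) powr 1 = (cos x / 2) powr e"
      by (subst powr_add[symmetric]) simp
    also have "2 powr e * \<dots> = (2 * (cos x / 2)) powr e"
      using c by (intro powr_mult[symmetric])
    finally show ?thesis by simp
  qed simp
  ultimately have "((\<lambda>x. cos x powr e) has_integral sqrt pi * Gamma a / Gamma (a + 1 / 2)) {- (pi / 2)..pi / 2}"
    by (rule has_integral_eq[rotated])
  moreover have "a + 1 / 2 = e / 2 + 1" by (simp add: a_def add_divide_distrib)
  ultimately show ?thesis
    by (simp only: a_def)
qed

text \<open>
  The positive part of the cosine is supported in half a period, where the real part is the integral above.
  The imaginary part vanishes because the integrand is the derivative of \<open>- pos_powr (e + 1) (cos x) / (e + 1)\<close>.
\<close>
lemma has_integral_cis_pos_powr_cos: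
  assumes e: "1 < e"
  shows "((\<lambda>x. cis (- (x + \<theta>)) * of_real (pos_powr e (cos (x + \<theta>)))) has_integral
    of_real (sqrt pi * Gamma (e / 2 + 1) / Gamma (e / 2 + 3 / 2))) {0..2 * pi}"
proof -
  define c where "c = sqrt pi * Gamma (e / 2 + 1) / Gamma (e / 2 + 3 / 2)"
  define F where "F x = cis (- x) * of_real (pos_powr e (cos x))" for x
  have F_eq: "F x = of_real (cos x * pos_powr e (cos x)) - \<i> * of_real (sin x * pos_powr e (cos x))" for x
    by (simp add: F_def complex_eq_iff)
  have front: "((\<lambda>x. cos x * pos_powr e (cos x)) has_integral c) {- (pi / 2)..pi / 2}"
  proof (rule has_integral_eq)
    show "((\<lambda>x. cos x powr (e + 1)) has_integral c) {- (pi / 2)..pi / 2}"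
      using has_integral_cos_powr[of "e + 1"] e by (simp add: c_def add_divide_distrib add_ac)
    show "cos x powr (e + 1) = cos x * pos_powr e (cos x)" if "x \<in> {- (pi / 2)..pi / 2}" for x
      using that cos_ge_zero[of x] by (simp add: powr_add)
  qed
  have rear: "((\<lambda>x. cos x * pos_powr e (cos x)) has_integral 0) {pi / 2..3 * pi / 2}"
  proof (rule has_integral_eq)
    show "((\<lambda>x::real. 0::real) has_integral 0) {pi / 2..3 * pi / 2}" by simp
    show "0 = cos x * pos_powr e (cos x)" if "x \<in> {pi / 2..3 * pi / 2}" for x
    proof -
      have "0 \<le> cos (x - pi)" using that by (intro cos_ge_zero) auto
      then show ?thesis by simp
    qed
  qed
  have re: "((\<lambda>x. cos x * pos_powr e (cos x)) has_integral c) {- (pi / 2)..3 * pi / 2}"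
    using has_integral_combine[OF _ _ front rear] by simp
  have "((\<lambda>x. sin x * pos_powr e (cos x)) has_integral
      (- pos_powr (e + 1) (cos (3 * pi / 2)) / (e + 1)) - (- pos_powr (e + 1) (cos (- (pi / 2))) / (e + 1)))
      {- (pi / 2)..3 * pi / 2}"
    using e by (intro fundamental_theorem_of_calculus)
      (auto intro!: derivative_eq_intros simp flip: has_real_derivative_iff_has_vector_derivative)
  moreover have "cos (3 * pi / 2) = 0"
    using cos_periodic_pi[of "pi / 2"] by (simp add: field_simps)
  ultimately have im: "((\<lambda>x. sin x * pos_powr e (cos x)) has_integral 0) {- (pi / 2)..3 * pi / 2}"
    by simp
  have "(F has_integral of_real c) {- (pi / 2)..3 * pi / 2}"
  proof (rule has_integral_eq)
    show "((\<lambda>x. of_real (cos x * pos_powr e (cos x)) - \<i> * of_real (sin x * pos_powr e (cos x)))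
        has_integral of_real c) {- (pi / 2)..3 * pi / 2}"
      using has_integral_diff[OF has_integral_of_real[OF re]
          has_integral_mult_right[OF has_integral_of_real[OF im], of \<i>]] by simp
  qed (simp add: F_eq)
  moreover have "3 * pi / 2 = - (pi / 2) + 2 * pi" by simp
  ultimately have F_int: "(F has_integral of_real c) {- (pi / 2)..- (pi / 2) + 2 * pi}"
    by (simp only:)
  have F_cont: "continuous_on UNIV F"
    unfolding F_def using e by (intro continuous_intros) auto
  have F_per: "F (x + 2 * pi) = F x" for x
    by (simp add: F_eq)
  have "((\<lambda>x. F (x + \<theta>)) has_integral of_real c) {0..0 + 2 * pi}"
    by (rule periodic_has_integral_shift[OF F_cont F_per _ F_int]) simp
  then show ?thesis
    unfolding F_def c_def add_0 .
qed

text \<open>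
  The derivative of the homogeneous part \<open>V_alpha\<close> of the potential.
\<close>
definition leading_force :: "real \<Rightarrow> real \<Rightarrow> real \<Rightarrow> real \<Rightarrow> real" where
  "leading_force \<alpha> kminus kplus r = kplus * pos_powr \<alpha> r - kminus * pos_powr \<alpha> (- r)"

lemma leading_force_mult:
  "0 \<le> c \<Longrightarrow> leading_force \<alpha> kminus kplus (c * r) = c powr \<alpha> * leading_force \<alpha> kminus kplus r"
  using pos_powr_mult[of c \<alpha> "- r"] by (simp add: leading_force_def pos_powr_mult algebra_simps)

text \<open>
  The identity that determines \<open>\<omega>\<^sub>0\<close>. By homogeneity and a shift of time by the argument of \<open>b\<close> only the
  case \<open>b = 1\<close> remains, in which the two one-sided powers contribute equally, the one for \<open>kminus\<close> after a half
  turn.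
\<close>
lemma leading_force_average:
  fixes b :: complex
  assumes \<alpha>: "1 < \<alpha>"
  shows "((\<lambda>s. cis (- s) * of_real (leading_force \<alpha> kminus kplus (sqrt 2 * Re (cis s * b)) / sqrt 2))
    has_integral 2 * pi * (of_real (omega0 \<alpha> kminus kplus) * b * of_real (norm b powr (\<alpha> - 1)))) {0..2 * pi}"
proof -
  define c where "c = sqrt pi * Gamma (\<alpha> / 2 + 1) / Gamma (\<alpha> / 2 + 3 / 2)"
  define \<theta> where "\<theta> = Arg b"
  define r where "r = norm b"
  define P where "P x = cis (- x) * of_real (pos_powr \<alpha> (cos x))" for x
  have P: "((\<lambda>x. P (x + \<theta>)) has_integral of_real c) {0..2 * pi}" for \<theta>
    unfolding P_def c_def by (rule has_integral_cis_pos_powr_cos[OF \<alpha>])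
  have b: "b = of_real r * cis \<theta>"
    using rcis_cmod_Arg[of b] by (simp add: rcis_def r_def \<theta>_def)
  \<comment> \<open>With \<open>b = r exp (i \<theta>)\<close> the integrand is a combination of \<open>P\<close> shifted by \<open>\<theta>\<close> and by \<open>\<theta> + \<pi>\<close>.\<close>
  have integrand: "cis (- s) * of_real (leading_force \<alpha> kminus kplus (sqrt 2 * Re (cis s * b)) / sqrt 2)
      = cis \<theta> * of_real ((sqrt 2 * r) powr \<alpha> / sqrt 2) *
        (of_real kplus * P (s + \<theta>) + of_real kminus * P (s + (\<theta> + pi)))" for s
  proof -
    have "Re (cis s * b) = r * cos (s + \<theta>)"
      by (simp add: b cos_add algebra_simps)
    then have lf: "leading_force \<alpha> kminus kplus (sqrt 2 * Re (cis s * b))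
        = (sqrt 2 * r) powr \<alpha> * leading_force \<alpha> kminus kplus (cos (s + \<theta>))"
      using leading_force_mult[of "sqrt 2 * r" \<alpha> kminus kplus "cos (s + \<theta>)"]
      unfolding r_def by (simp add: mult.assoc)
    have cis_s: "cis (- s) = cis \<theta> * cis (- (s + \<theta>))"
      by (simp add: cis_mult)
    have half_turn: "cis (- (s + (\<theta> + pi))) = - cis (- (s + \<theta>))" "cos (s + (\<theta> + pi)) = - cos (s + \<theta>)"
      using cos_minus[of "s + \<theta> + pi"] sin_minus[of "s + \<theta> + pi"] cos_minus[of "s + \<theta>"] sin_minus[of "s + \<theta>"]
      by (simp_all only: complex_eq_iff cis.sel uminus_complex.sel add.assoc[symmetric] cos_periodic_pi sin_periodic_pi)
    show ?thesis
      unfolding lf cis_s P_def half_turn unfolding leading_force_def by (simp add: algebra_simps diff_divide_distrib)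
  qed
  have "2 * pi * omega0 \<alpha> kminus kplus = (kplus + kminus) * c * (sqrt 2 powr \<alpha> / sqrt 2)"
  proof -
    have nz: "Gamma ((\<alpha> + 1) / 2) \<noteq> 0"
      by (rule less_imp_neq[OF Gamma_real_pos, symmetric]) (use \<alpha> in simp)
    have G: "Gamma (\<alpha> / 2 + 1) = \<alpha> / 2 * Gamma (\<alpha> / 2)"
      by (intro Gamma_plus1 notI, drule nonpos_Ints_nonpos) (use \<alpha> in simp)
    have "\<alpha> / 2 + 3 / 2 = (\<alpha> + 1) / 2 + 1" by (simp add: field_simps)
    moreover have "Gamma ((\<alpha> + 1) / 2 + 1) = (\<alpha> + 1) / 2 * Gamma ((\<alpha> + 1) / 2)"
      by (intro Gamma_plus1 notI, drule nonpos_Ints_nonpos) (use \<alpha> in simp)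
    ultimately have G': "Gamma (\<alpha> / 2 + 3 / 2) = (\<alpha> + 1) / 2 * Gamma ((\<alpha> + 1) / 2)" by (simp only:)
    have sq: "sqrt 2 powr \<alpha> / sqrt 2 = 2 * 2 powr ((\<alpha> - 3) / 2)"
    proof -
      have "sqrt 2 = 2 powr (1 / 2)" by (simp add: powr_half_sqrt)
      then have "sqrt 2 powr \<alpha> / sqrt 2 = 2 powr (1 / 2 * \<alpha>) / 2 powr (1 / 2)"
        by (simp only: powr_powr)
      also have "\<dots> = 2 powr (1 / 2 * \<alpha> - 1 / 2)"
        by (simp only: powr_diff)
      also have "\<dots> = 2 powr (1 + (\<alpha> - 3) / 2)"
        by (simp add: field_simps)
      finally show ?thesis by (simp add: powr_add)
    qed
    have cancel: "2 * (s * s) * (k * P * (\<alpha> * H / (s * m * G))) = k * (s * (\<alpha> / 2 * H) / (m / 2 * G)) * (2 * P)"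
      if "s \<noteq> 0" "G \<noteq> 0" "m \<noteq> 0" for s G H P k m :: real
      using that by (simp add: field_simps)
    have "2 * (sqrt pi * sqrt pi) * omega0 \<alpha> kminus kplus = (kminus + kplus) * c * (2 * 2 powr ((\<alpha> - 3) / 2))"
      unfolding omega0_def c_def G G' by (rule cancel) (use nz \<alpha> in auto)
    then show ?thesis
      unfolding sq by (simp add: add.commute)
  qed
  moreover have "(sqrt 2 * r) powr \<alpha> = sqrt 2 powr \<alpha> * r * r powr (\<alpha> - 1)"
    by (cases "r = 0") (simp_all add: r_def powr_mult powr_diff)
  ultimately have "of_real (2 * pi * omega0 \<alpha> kminus kplus * r * r powr (\<alpha> - 1))
      = complex_of_real ((sqrt 2 * r) powr \<alpha> / sqrt 2 * ((kplus + kminus) * c))"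
    unfolding of_real_eq_iff by simp
  note key = this
  have "norm b = r" by (simp add: r_def)
  then have "2 * pi * (of_real (omega0 \<alpha> kminus kplus) * b * of_real (norm b powr (\<alpha> - 1)))
      = cis \<theta> * of_real (2 * pi * omega0 \<alpha> kminus kplus * r * r powr (\<alpha> - 1))"
    by (simp only: ) (subst b, simp)
  also have "\<dots> = cis \<theta> * of_real ((sqrt 2 * r) powr \<alpha> / sqrt 2) * (of_real kplus * of_real c + of_real kminus * of_real c)"
    unfolding key by (simp add: algebra_simps)
  finally have "2 * pi * (of_real (omega0 \<alpha> kminus kplus) * b * of_real (norm b powr (\<alpha> - 1)))
      = cis \<theta> * of_real ((sqrt 2 * r) powr \<alpha> / sqrt 2) * (of_real kplus * of_real c + of_real kminus * of_real c)" .
  then show ?thesis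
    unfolding integrand by (simp only:) (intro has_integral_mult_right has_integral_add P)
qed

section \<open>Averaging in sequence spaces\<close>

context
  fixes p :: ereal
  assumes p: "1 \<le> p"
begin

text \<open>
  Averaging by freezing: on each period the slow argument \<open>b\<close> is replaced by its value at the beginning. The frozen
  integral over a full period vanishes and the replacement costs \<open>\<Lambda> * P * D\<close> per unit of time. Only the last, incomplete
  period contributes the term that does not grow with \<open>t\<close>.
\<close>
lemma lp_averaging:
  fixes q :: "real \<Rightarrow> 'a::euclidean_space \<Rightarrow> 'a" and b :: "real \<Rightarrow> int \<Rightarrow> 'a" and \<tau> \<Lambda> R D P :: real
  assumes P: "0 < P" and \<Lambda>: "0 \<le> \<Lambda>" and D: "0 \<le> D"
    and cont: "continuous_on UNIV (\<lambda>(s, z). q s z)"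
    and period: "\<And>s z. q (s + P) z = q s z"
    and mean: "\<And>z. ((\<lambda>s. q s z) has_integral 0) {0..P}"
    and lip: "\<And>s z z'. norm z \<le> R \<Longrightarrow> norm z' \<le> R \<Longrightarrow> norm (q s z - q s z') \<le> \<Lambda> * norm (z - z')"
    and zero: "\<And>s. q s 0 = 0"
    and b_cont: "\<And>n. continuous_on {0..\<tau>} (\<lambda>s. b s n)"
    and b: "\<And>s. s \<in> {0..\<tau>} \<Longrightarrow> lp_le p (b s) R"
    and b_lip: "\<And>s t. s \<in> {0..\<tau>} \<Longrightarrow> t \<in> {0..\<tau>} \<Longrightarrow> lp_le p (\<lambda>n. b s n - b t n) (D * \<bar>s - t\<bar>)"
    and t: "t \<in> {0..\<tau>}"
  shows "lp_le p (\<lambda>n. integral {0..t} (\<lambda>s. q s (b s n))) (\<Lambda> * P * (D * t + R))"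
proof -
  define r where "r t n = integral {0..t} (\<lambda>s. q s (b s n))" for t n
  define frozen where "frozen c t n = integral {c..t} (\<lambda>s. q s (b c n))" for c t n
  have q_cont: "continuous_on S (\<lambda>s. q s (f s))" if "continuous_on S f" for S f
    using continuous_on_compose2[OF cont, of S "\<lambda>s. (s, f s)"] that
    by (simp add: continuous_on_Pair continuous_on_id)
  have r_deriv: "((\<lambda>t. r t n) has_vector_derivative q t (b t n)) (at t within {0..\<tau>})"
    if "t \<in> {0..\<tau>}" for t n
    unfolding r_def by (rule integral_has_vector_derivative[OF q_cont[OF b_cont] that])
  have frozen_deriv: "((\<lambda>t. frozen c t n) has_vector_derivative q t (b c n)) (at t within {c..d})"
    if "t \<in> {c..d}" for c d t n
    unfolding frozen_def by (rule integral_has_vector_derivative[OF q_cont[OF continuous_on_const] that])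
  have freeze: "lp_le p (\<lambda>n. r d n - r c n - frozen c d n) (\<Lambda> * P * D * (d - c))"
    if cd: "0 \<le> c" "c \<le> d" "d \<le> \<tau>" "d - c \<le> P" for c d
  proof -
    have "lp_le p (\<lambda>n. (r d n - frozen c d n) - (r c n - frozen c c n)) (\<Lambda> * P * D * d - \<Lambda> * P * D * c)"
    proof (rule lp_le_mean_value[OF p cd(2), where u = "\<lambda>t n. r t n - frozen c t n"
          and u' = "\<lambda>t n. q t (b t n) - q t (b c n)" and \<psi> = "\<lambda>t. \<Lambda> * P * D * t" and \<psi>' = "\<lambda>_. \<Lambda> * P * D"])
      fix n s assume s: "s \<in> {c..d}"
      have "((\<lambda>t. r t n) has_vector_derivative q s (b s n)) (at s within {c..d})"
        by (rule has_vector_derivative_within_subset[OF r_deriv]) (use s cd in auto)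
      then show "((\<lambda>t. r t n - frozen c t n) has_vector_derivative q s (b s n) - q s (b c n)) (at s within {c..d})"
        by (rule has_vector_derivative_diff[OF _ frozen_deriv[OF s]])
    next
      fix s assume s: "s \<in> {c..d}"
      show "((\<lambda>t. \<Lambda> * P * D * t) has_real_derivative \<Lambda> * P * D) (at s within {c..d})"
        by (rule DERIV_cmult_Id)
      have mem: "s \<in> {0..\<tau>}" "c \<in> {0..\<tau>}" using s cd by auto
      have "lp_le p (\<lambda>n. q s (b s n) - q s (b c n)) (\<Lambda> * (D * \<bar>s - c\<bar>))"
        by (rule lp_le_scale[OF p b_lip[OF mem] \<Lambda> lip])
          (use lp_le_component[OF p b] mem in auto)
      moreover have "D * \<bar>s - c\<bar> \<le> P * D"
        using mult_left_mono[OF _ D, of "\<bar>s - c\<bar>" P] s cd by (simp add: mult.commute)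
      then have "\<Lambda> * (D * \<bar>s - c\<bar>) \<le> \<Lambda> * P * D"
        using mult_left_mono[OF _ \<Lambda>] by (simp add: mult.assoc)
      ultimately show "lp_le p (\<lambda>n. q s (b s n) - q s (b c n)) (\<Lambda> * P * D)"
        by (rule lp_le_weaken)
    qed
    then show ?thesis
      by (simp add: frozen_def algebra_simps)
  qed
  have full: "lp_le p (r (real k * P)) (\<Lambda> * P * (D * (real k * P)))" if "real k * P \<le> \<tau>" for k
    using that
  proof (induction k)
    case 0
    then show ?case using lp_le_zero[OF p] by (simp add: r_def)
  next
    case (Suc k)
    have frozen_0: "frozen (real k * P) (real (Suc k) * P) n = 0" for n
    proof -
      have "((\<lambda>s. q (s + 0) (b (real k * P) n)) has_integral 0) {real k * P..real k * P + P}"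
        using P by (intro periodic_has_integral_shift[OF q_cont[OF continuous_on_const] period _ , where a = 0])
          (use mean in auto)
      then show ?thesis by (simp add: frozen_def integral_unique algebra_simps)
    qed
    have k: "0 \<le> real k * P" "real k * P \<le> real (Suc k) * P" using P by auto
    have "lp_le p (\<lambda>n. (r (real (Suc k) * P) n - r (real k * P) n - frozen (real k * P) (real (Suc k) * P) n)
        + r (real k * P) n) (\<Lambda> * P * D * (real (Suc k) * P - real k * P) + \<Lambda> * P * (D * (real k * P)))"
      by (rule lp_le_add[OF p freeze Suc.IH]) (use k Suc.prems in \<open>auto simp: algebra_simps\<close>)
    moreover have "\<Lambda> * P * D * (real (Suc k) * P - real k * P) + \<Lambda> * P * (D * (real k * P))
        = \<Lambda> * P * (D * (real (Suc k) * P))"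
      by (simp add: algebra_simps)
    ultimately show ?case by (simp only: frozen_0 diff_add_cancel diff_0_right)
  qed
  define k where "k = nat \<lfloor>t / P\<rfloor>"
  define c where "c = real k * P"
  have k_eq: "real k = of_int \<lfloor>t / P\<rfloor>" using t P by (simp add: k_def)
  have ct: "0 \<le> c" "c \<le> t" "t \<le> \<tau>" "t - c \<le> P"
  proof -
    have "of_int \<lfloor>t / P\<rfloor> \<le> t / P" "t / P < of_int \<lfloor>t / P\<rfloor> + 1"
      by linarith+
    then have "real k \<le> t / P" "t / P < real k + 1"
      by (simp_all only: k_eq)
    then show "0 \<le> c" "c \<le> t" "t \<le> \<tau>" "t - c \<le> P"
      using t P unfolding c_def by (auto simp: field_simps)
  qed
  have "lp_le p (\<lambda>n. frozen c t n - frozen c c n) (\<Lambda> * R * t - \<Lambda> * R * c)"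
  proof (rule lp_le_mean_value[OF p ct(2), where u = "frozen c" and u' = "\<lambda>t n. q t (b c n)"
        and \<psi> = "\<lambda>t. \<Lambda> * R * t" and \<psi>' = "\<lambda>_. \<Lambda> * R"])
    fix s assume s: "s \<in> {c..t}"
    show "((\<lambda>t. \<Lambda> * R * t) has_real_derivative \<Lambda> * R) (at s within {c..t})"
      by (rule DERIV_cmult_Id)
    have bc: "lp_le p (b c) R" using b ct by auto
    show "lp_le p (\<lambda>n. q s (b c n)) (\<Lambda> * R)"
    proof (rule lp_le_scale[OF p bc \<Lambda>])
      show "norm (q s (b c n)) \<le> \<Lambda> * norm (b c n)" for n
        using lip[of "b c n" 0 s] lp_le_component[OF p bc, of n] lp_le_nonneg[OF bc] by (simp add: zero)
    qed
  qed (rule frozen_deriv)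
  moreover have "(\<lambda>n. frozen c t n - frozen c c n) = frozen c t"
    by (simp add: fun_eq_iff frozen_def)
  ultimately have "lp_le p (frozen c t) (\<Lambda> * R * (t - c))"
    by (simp only: right_diff_distrib)
  then have tail: "lp_le p (frozen c t) (\<Lambda> * P * R)"
  proof (rule lp_le_weaken)
    have "0 \<le> \<Lambda> * R" using \<Lambda> lp_le_nonneg[OF b[OF t]] by simp
    then show "\<Lambda> * R * (t - c) \<le> \<Lambda> * P * R"
      using mult_left_mono[OF ct(4), of "\<Lambda> * R"] by (simp add: mult_ac)
  qed
  have "lp_le p (\<lambda>n. (r t n - r c n - frozen c t n) + r c n + frozen c t n)
      (\<Lambda> * P * D * (t - c) + \<Lambda> * P * (D * c) + \<Lambda> * P * R)"
    using full[of k] ct by (intro lp_le_add[OF p] freeze tail) (auto simp: c_def)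
  then have "lp_le p (r t) (\<Lambda> * P * D * (t - c) + \<Lambda> * P * (D * c) + \<Lambda> * P * R)"
    by simp
  moreover have "r t = (\<lambda>n. integral {0..t} (\<lambda>s. q s (b s n)))"
    by (simp add: fun_eq_iff r_def)
  moreover have "\<Lambda> * P * D * (t - c) + \<Lambda> * P * (D * c) + \<Lambda> * P * R = \<Lambda> * P * (D * t + R)"
    by (simp add: algebra_simps)
  ultimately show ?thesis by (simp only:)
qed

end

section \<open>Regularity of the potentials and Lipschitz bounds for the lattice\<close>

text \<open>
  Lipschitz constant \<open>C * \<rho> powr \<kappa>\<close> on each ball \<open>\<bar>r\<bar> \<le> \<rho>\<close>: the form in which the growth conditions on
  \<open>W''\<close> and \<open>\<phi>''\<close> are used, since the radius is later taken proportional to \<open>\<epsilon>\<close>.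
\<close>
definition lip_near_zero :: "(real \<Rightarrow> real) \<Rightarrow> real \<Rightarrow> real \<Rightarrow> real \<Rightarrow> bool" where
  "lip_near_zero g C \<kappa> \<rho>0 \<longleftrightarrow> (\<forall>\<rho> r s. 0 < \<rho> \<longrightarrow> \<rho> \<le> \<rho>0 \<longrightarrow> \<bar>r\<bar> \<le> \<rho> \<longrightarrow> \<bar>s\<bar> \<le> \<rho> \<longrightarrow>
     \<bar>g r - g s\<bar> \<le> C * \<rho> powr \<kappa> * \<bar>r - s\<bar>)"

lemma lip_near_zeroD:
  "lip_near_zero g C \<kappa> \<rho>0 \<Longrightarrow> 0 < \<rho> \<Longrightarrow> \<rho> \<le> \<rho>0 \<Longrightarrow> \<bar>r\<bar> \<le> \<rho> \<Longrightarrow> \<bar>s\<bar> \<le> \<rho> \<Longrightarrow>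
    \<bar>g r - g s\<bar> \<le> C * \<rho> powr \<kappa> * \<bar>r - s\<bar>"
  by (auto simp: lip_near_zero_def)

lemma lip_near_zero_weaken:
  assumes "lip_near_zero g C \<kappa> \<rho>0" "C \<le> C'" "\<kappa>' \<le> \<kappa>" "\<rho>0' \<le> \<rho>0" "\<rho>0' \<le> 1" "0 \<le> C'"
  shows "lip_near_zero g C' \<kappa>' \<rho>0'"
  unfolding lip_near_zero_def
proof (intro allI impI)
  fix \<rho> r s :: real assume \<rho>: "0 < \<rho>" "\<rho> \<le> \<rho>0'" and rs: "\<bar>r\<bar> \<le> \<rho>" "\<bar>s\<bar> \<le> \<rho>"
  have "\<bar>g r - g s\<bar> \<le> C * \<rho> powr \<kappa> * \<bar>r - s\<bar>"
    using assms \<rho> rs by (intro lip_near_zeroD[OF assms(1)]) auto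
  also have "\<dots> \<le> C' * \<rho> powr \<kappa>' * \<bar>r - s\<bar>"
    using assms \<rho> by (intro mult_right_mono mult_mono powr_mono') auto
  finally show "\<bar>g r - g s\<bar> \<le> C' * \<rho> powr \<kappa>' * \<bar>r - s\<bar>" .
qed

lemma lip_near_zero_deriv:
  assumes g: "\<And>x. (g has_real_derivative g' x) (at x)"
    and bound: "\<And>x. \<bar>x\<bar> \<le> \<rho>0 \<Longrightarrow> \<bar>g' x\<bar> \<le> C * \<bar>x\<bar> powr \<kappa>" and "0 \<le> C" "0 \<le> \<kappa>"
  shows "lip_near_zero g C \<kappa> \<rho>0"
  unfolding lip_near_zero_def
proof (intro allI impI)
  fix \<rho> r s :: real assume \<rho>: "0 < \<rho>" "\<rho> \<le> \<rho>0" and rs: "\<bar>r\<bar> \<le> \<rho>" "\<bar>s\<bar> \<le> \<rho>"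
  have "norm (g r - g s) \<le> C * \<rho> powr \<kappa> * norm (r - s)"
  proof (rule field_differentiable_bound[where S = "{-\<rho>..\<rho>}" and f' = g'])
    show "norm (g' x) \<le> C * \<rho> powr \<kappa>" if "x \<in> {-\<rho>..\<rho>}" for x
    proof -
      have "\<bar>x\<bar> \<le> \<rho>" using that by auto
      then have "\<bar>g' x\<bar> \<le> C * \<bar>x\<bar> powr \<kappa>" using bound \<rho> by auto
      also have "\<dots> \<le> C * \<rho> powr \<kappa>"
        using \<open>\<bar>x\<bar> \<le> \<rho>\<close> assms by (intro mult_left_mono powr_mono2) auto
      finally show ?thesis by simp
    qed
  qed (use rs in \<open>auto intro: has_field_derivative_at_within g\<close>)
  then show "\<bar>g r - g s\<bar> \<le> C * \<rho> powr \<kappa> * \<bar>r - s\<bar>" by simp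
qed

text \<open>
  The growth condition says nothing at the origin itself; there the second derivative vanishes by continuity.
\<close>
lemma lip_near_zero_bigo:
  assumes g: "\<And>x. (g has_real_derivative g' x) (at x)" and cont: "continuous_on UNIV g'"
    and O: "g' \<in> O[at 0](\<lambda>x. \<bar>x\<bar> powr \<kappa>)" and \<kappa>: "0 < \<kappa>"
  obtains C \<rho>0 where "0 \<le> C" "0 < \<rho>0" "lip_near_zero g C \<kappa> \<rho>0"
proof -
  obtain C where C: "0 < C" and ev: "eventually (\<lambda>x. norm (g' x) \<le> C * norm (\<bar>x\<bar> powr \<kappa>)) (at 0)"
    using landau_o.bigE[OF O] by blast
  then obtain d where d: "0 < d" and le: "\<And>x. x \<noteq> 0 \<Longrightarrow> \<bar>x\<bar> < d \<Longrightarrow> \<bar>g' x\<bar> \<le> C * \<bar>x\<bar> powr \<kappa>"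
    unfolding eventually_at by (auto simp: dist_norm)
  have "continuous_on UNIV (\<lambda>x::real. C * \<bar>x\<bar> powr \<kappa>)"
    by (intro continuous_on_mult_left continuous_on_abs_powr \<kappa>)
  then have "isCont (\<lambda>x::real. C * \<bar>x\<bar> powr \<kappa>) 0"
    by (simp add: continuous_on_eq_continuous_at)
  then have "((\<lambda>x::real. C * \<bar>x\<bar> powr \<kappa>) \<longlongrightarrow> 0) (at 0)"
    using isContD by fastforce
  then have "(g' \<longlongrightarrow> 0) (at 0)"
    using Lim_null_comparison[of g' "\<lambda>x. C * \<bar>x\<bar> powr \<kappa>"] ev by simp
  moreover have "(g' \<longlongrightarrow> g' 0) (at 0)"
    using cont by (simp add: continuous_on_eq_continuous_at isContD)
  ultimately have zero: "g' 0 = 0"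
    using LIM_unique by blast
  show thesis
  proof (rule that)
    show "0 \<le> C" "0 < d / 2" using C d by auto
    show "lip_near_zero g C \<kappa> (d / 2)"
    proof (rule lip_near_zero_deriv[OF g])
      show "\<bar>g' x\<bar> \<le> C * \<bar>x\<bar> powr \<kappa>" if "\<bar>x\<bar> \<le> d / 2" for x
        using le[of x] that d C by (cases "x = 0") (auto simp: zero)
    qed (use C \<kappa> in auto)
  qed
qed

lemma C2_real_derivatives:
  assumes "C2_real f"
  shows "(f has_real_derivative deriv f x) (at x)"
    and "(deriv f has_real_derivative deriv (deriv f) x) (at x)"
    and "continuous_on UNIV (deriv (deriv f))"
proof -
  have C1: "(g has_real_derivative deriv g x) (at x)" "continuous_on UNIV (deriv g)"
    if "g C1_differentiable_on UNIV" for g :: "real \<Rightarrow> real" and x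
  proof -
    have d: "(g has_real_derivative deriv g x) (at x)" for x
      using that by (simp add: C1_differentiable_on_eq DERIV_deriv_iff_real_differentiable)
    then show "(g has_real_derivative deriv g x) (at x)" .
    have "vector_derivative g (at x) = deriv g x" for x
      using d by (intro vector_derivative_at) (simp add: has_real_derivative_iff_has_vector_derivative)
    then show "continuous_on UNIV (deriv g)"
      using that by (simp add: C1_differentiable_on_eq)
  qed
  show "(f has_real_derivative deriv f x) (at x)" "(deriv f has_real_derivative deriv (deriv f) x) (at x)"
    "continuous_on UNIV (deriv (deriv f))"
    using assms C1 unfolding C2_real_def by blast+
qed

lemma has_real_derivative_leading_force:
  assumes "1 < \<alpha>"
  shows "(leading_force \<alpha> kminus kplus has_real_derivative
    \<alpha> * (kplus * pos_powr (\<alpha> - 1) x + kminus * pos_powr (\<alpha> - 1) (- x))) (at x)"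
  unfolding leading_force_def using assms by (auto intro!: derivative_eq_intros simp: algebra_simps)

lemma has_real_derivative_V_alpha:
  assumes "1 < \<alpha>"
  shows "(V_alpha \<alpha> kminus kplus has_real_derivative leading_force \<alpha> kminus kplus x) (at x)"
proof -
  have "V_alpha \<alpha> kminus kplus = (\<lambda>r. kminus / (1 + \<alpha>) * pos_powr (\<alpha> + 1) (- r) + kplus / (1 + \<alpha>) * pos_powr (\<alpha> + 1) r)"
    by (auto simp: V_alpha_def fun_eq_iff)
  moreover have "((\<lambda>r. kminus / (1 + \<alpha>) * pos_powr (\<alpha> + 1) (- r) + kplus / (1 + \<alpha>) * pos_powr (\<alpha> + 1) r) has_real_derivative
      kminus / (1 + \<alpha>) * ((\<alpha> + 1) * pos_powr (\<alpha> + 1 - 1) (- x) * - 1) + kplus / (1 + \<alpha>) * ((\<alpha> + 1) * pos_powr (\<alpha> + 1 - 1) x * 1)) (at x)"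
    using assms by (intro DERIV_add DERIV_cmult has_real_derivative_pos_powr_chain DERIV_minus DERIV_ident) auto
  moreover have "kminus / (1 + \<alpha>) * ((\<alpha> + 1) * pos_powr (\<alpha> + 1 - 1) (- x) * - 1) + kplus / (1 + \<alpha>) * ((\<alpha> + 1) * pos_powr (\<alpha> + 1 - 1) x * 1)
      = leading_force \<alpha> kminus kplus x"
    using assms by (simp add: leading_force_def divide_simps) (simp add: algebra_simps)
  ultimately show ?thesis by (simp only:)
qed

lemma lip_near_zero_leading_force:
  assumes "1 < \<alpha>"
  shows "lip_near_zero (leading_force \<alpha> kminus kplus) (\<alpha> * (\<bar>kplus\<bar> + \<bar>kminus\<bar>)) (\<alpha> - 1) \<rho>0"
proof (rule lip_near_zero_deriv[OF has_real_derivative_leading_force[OF assms]])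
  fix x :: real
  have "\<bar>kplus * pos_powr (\<alpha> - 1) x + kminus * pos_powr (\<alpha> - 1) (- x)\<bar>
      \<le> \<bar>kplus\<bar> * \<bar>x\<bar> powr (\<alpha> - 1) + \<bar>kminus\<bar> * \<bar>x\<bar> powr (\<alpha> - 1)"
    using assms pos_powr_bounds[of "\<alpha> - 1" x] pos_powr_bounds[of "\<alpha> - 1" "- x"]
    by (intro order_trans[OF abs_triangle_ineq] add_mono) (auto simp: abs_mult intro: mult_left_mono)
  then have "\<alpha> * \<bar>kplus * pos_powr (\<alpha> - 1) x + kminus * pos_powr (\<alpha> - 1) (- x)\<bar>
      \<le> \<alpha> * (\<bar>kplus\<bar> * \<bar>x\<bar> powr (\<alpha> - 1) + \<bar>kminus\<bar> * \<bar>x\<bar> powr (\<alpha> - 1))"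
    using assms by (intro mult_left_mono) auto
  then show "\<bar>\<alpha> * (kplus * pos_powr (\<alpha> - 1) x + kminus * pos_powr (\<alpha> - 1) (- x))\<bar>
      \<le> \<alpha> * (\<bar>kplus\<bar> + \<bar>kminus\<bar>) * \<bar>x\<bar> powr (\<alpha> - 1)"
    using assms unfolding abs_mult[of \<alpha>] by (simp add: algebra_simps del: abs_mult_pos abs_mult_pos')
qed (use assms in auto)

text \<open>
  As \<open>V_alpha\<close> is twice continuously differentiable for \<open>\<alpha> > 1\<close>, the perturbation inherits this regularity from \<open>V\<close>.
\<close>
lemma perturbation_derivatives:
  assumes \<alpha>: "1 < \<alpha>" and V: "C2_real V" and W: "\<And>r. V r = V_alpha \<alpha> kminus kplus r + W r"
  shows "deriv V x = leading_force \<alpha> kminus kplus x + deriv W x"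
    and "(deriv W has_real_derivative deriv (deriv W) x) (at x)"
    and "continuous_on UNIV (deriv (deriv W))"
proof -
  let ?h' = "\<lambda>x. \<alpha> * (kplus * pos_powr (\<alpha> - 1) x + kminus * pos_powr (\<alpha> - 1) (- x))"
  have "W = (\<lambda>r. V r - V_alpha \<alpha> kminus kplus r)" using W by auto
  then have "deriv W x = deriv V x - leading_force \<alpha> kminus kplus x" for x
    using DERIV_imp_deriv[OF DERIV_diff[OF C2_real_derivatives(1)[OF V] has_real_derivative_V_alpha[OF \<alpha>]]] by simp
  then have W1: "deriv W = (\<lambda>x. deriv V x - leading_force \<alpha> kminus kplus x)" by auto
  then show "deriv V x = leading_force \<alpha> kminus kplus x + deriv W x" by simp
  have d: "(deriv W has_real_derivative deriv (deriv V) x - ?h' x) (at x)" for x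
    unfolding W1 by (intro DERIV_diff C2_real_derivatives(2)[OF V] has_real_derivative_leading_force[OF \<alpha>])
  then have W2: "deriv (deriv W) = (\<lambda>x. deriv (deriv V) x - ?h' x)"
    using DERIV_imp_deriv by blast
  show "(deriv W has_real_derivative deriv (deriv W) x) (at x)"
    unfolding W2 by (rule d)
  show "continuous_on UNIV (deriv (deriv W))"
    unfolding W2 using \<alpha> by (intro continuous_intros C2_real_derivatives(3)[OF V]) auto
qed

text \<open>
  The force of the lattice for arbitrary scalar functions in place of \<open>V'\<close> and \<open>\<phi>'\<close>, so that it can also be formed
  with truncated functions and with the leading and perturbing parts separately.
\<close>
definition chain_force :: "(real \<Rightarrow> real) \<Rightarrow> (real \<Rightarrow> real) \<Rightarrow> (int \<Rightarrow> real) \<Rightarrow> int \<Rightarrow> real" where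
  "chain_force v f x n = v (x (n + 1) - x n) - v (x n - x (n - 1)) - f (x n)"

definition chain_field :: "(real \<Rightarrow> real) \<Rightarrow> (real \<Rightarrow> real) \<Rightarrow> (int \<Rightarrow> real \<times> real) \<Rightarrow> int \<Rightarrow> real \<times> real" where
  "chain_field v f X n = (snd (X n), - fst (X n) + chain_force v f (\<lambda>m. fst (X m)) n)"

text \<open>
  The same lattice seen in the rotating frame.
\<close>
definition rot_field :: "(real \<Rightarrow> real) \<Rightarrow> (real \<Rightarrow> real) \<Rightarrow> real \<Rightarrow> (int \<Rightarrow> complex) \<Rightarrow> int \<Rightarrow> complex" where
  "rot_field v f t w n = - \<i> * cis (- t) * of_real (chain_force v f (\<lambda>m. sqrt 2 * Re (cis t * w m)) n / sqrt 2)"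

lemma chain_field_lattice: "chain_field (deriv V) (deriv \<phi>) X n = lattice_J X n + lattice_G V \<phi> X n"
  by (simp add: chain_field_def chain_force_def lattice_J_def lattice_G_def lattice_F_def
      delta_plus_def delta_minus_def o_def)

lemma chain_force_lipschitz:
  assumes v: "\<And>r s. r \<in> A \<Longrightarrow> s \<in> A \<Longrightarrow> \<bar>v r - v s\<bar> \<le> \<Lambda> * \<bar>r - s\<bar>"
    and f: "\<And>r s. r \<in> A \<Longrightarrow> s \<in> A \<Longrightarrow> \<bar>f r - f s\<bar> \<le> \<Lambda> * \<bar>r - s\<bar>"
    and "0 \<le> \<Lambda>"
    and x: "\<And>n. x n \<in> A" "\<And>n. x n - x (n - 1) \<in> A" and y: "\<And>n. y n \<in> A" "\<And>n. y n - y (n - 1) \<in> A"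
  shows "\<bar>chain_force v f x n - chain_force v f y n\<bar>
    \<le> \<Lambda> * (\<bar>x (n + 1) - y (n + 1)\<bar> + 3 * \<bar>x n - y n\<bar> + \<bar>x (n - 1) - y (n - 1)\<bar>)"
proof -
  let ?u = "\<lambda>n. \<bar>x n - y n\<bar>"
  have step: "\<bar>v (x n - x (n - 1)) - v (y n - y (n - 1))\<bar> \<le> \<Lambda> * (?u n + ?u (n - 1))" for n
  proof -
    have "\<bar>v (x n - x (n - 1)) - v (y n - y (n - 1))\<bar> \<le> \<Lambda> * \<bar>(x n - x (n - 1)) - (y n - y (n - 1))\<bar>"
      by (intro v x y)
    also have "\<dots> \<le> \<Lambda> * (?u n + ?u (n - 1))"
      by (intro mult_left_mono \<open>0 \<le> \<Lambda>\<close>) linarith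
    finally show ?thesis .
  qed
  have "\<bar>f (x n) - f (y n)\<bar> \<le> \<Lambda> * ?u n" by (intro f x y)
  moreover have "\<bar>v (x (n + 1) - x n) - v (y (n + 1) - y n)\<bar> \<le> \<Lambda> * (?u (n + 1) + ?u n)"
    using step[of "n + 1"] by simp
  moreover have "\<Lambda> * (?u (n + 1) + 3 * ?u n + ?u (n - 1)) = \<Lambda> * (?u (n + 1) + ?u n) + \<Lambda> * (?u n + ?u (n - 1)) + \<Lambda> * ?u n"
    by (simp add: algebra_simps)
  ultimately show ?thesis
    unfolding chain_force_def using step[of n] by linarith
qed

lemma chain_force_zero: "f 0 = 0 \<Longrightarrow> chain_force v f (\<lambda>_. 0) n = 0"
  by (simp add: chain_force_def)

lemma chain_force_add: "chain_force (\<lambda>r. h r + g r) f x n = chain_force h (\<lambda>_. 0) x n + chain_force g f x n"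
  by (simp add: chain_force_def)

lemma rot_field_add: "rot_field (\<lambda>r. h r + g r) f t w n = rot_field h (\<lambda>_. 0) t w n + rot_field g f t w n"
  unfolding rot_field_def by (subst chain_force_add) (simp add: add_divide_distrib distrib_left)

lemma abs_Re_cis_mult_le: "\<bar>Re (cis t * w)\<bar> \<le> norm w"
  using abs_Re_le_cmod[of "cis t * w"] by (simp add: norm_mult)

lemma sqrt2_bounds: "1 \<le> sqrt 2" "sqrt 2 \<le> 2"
  by (auto intro: real_le_rsqrt real_le_lsqrt)

text \<open>
  The factor \<open>4\<close> leaves room for \<open>\<surd>2\<close> from the change of frame and \<open>2\<close> from the difference of neighbours, so that
  all arguments of \<open>v\<close> and \<open>f\<close> stay in the ball of radius \<open>\<rho>\<close>.
\<close>
lemma rot_field_lipschitz: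
  assumes v: "\<And>r s. \<bar>r\<bar> \<le> \<rho> \<Longrightarrow> \<bar>s\<bar> \<le> \<rho> \<Longrightarrow> \<bar>v r - v s\<bar> \<le> \<Lambda> * \<bar>r - s\<bar>"
    and f: "\<And>r s. \<bar>r\<bar> \<le> \<rho> \<Longrightarrow> \<bar>s\<bar> \<le> \<rho> \<Longrightarrow> \<bar>f r - f s\<bar> \<le> \<Lambda> * \<bar>r - s\<bar>"
    and "0 \<le> \<Lambda>"
    and w: "\<And>n. 4 * norm (w n) \<le> \<rho>" and z: "\<And>n. 4 * norm (z n) \<le> \<rho>"
  shows "norm (rot_field v f t w n - rot_field v f t z n)
    \<le> \<Lambda> * (norm (w (n + 1) - z (n + 1)) + 3 * norm (w n - z n) + norm (w (n - 1) - z (n - 1)))"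
proof -
  define x where "x w m = sqrt 2 * Re (cis t * w m)" for w :: "int \<Rightarrow> complex" and m
  have small: "\<bar>x w m\<bar> \<le> \<rho>" "\<bar>x w m - x w (m - 1)\<bar> \<le> \<rho>" if "\<And>n. 4 * norm (w n) \<le> \<rho>" for w m
  proof -
    have le: "\<bar>x w m\<bar> \<le> \<rho> / 2" for m
    proof -
      have "\<bar>x w m\<bar> \<le> 2 * norm (w m)"
        unfolding x_def abs_mult using sqrt2_bounds abs_Re_cis_mult_le[of t "w m"] by (intro mult_mono) auto
      then show ?thesis using that[of m] by simp
    qed
    show "\<bar>x w m\<bar> \<le> \<rho>" "\<bar>x w m - x w (m - 1)\<bar> \<le> \<rho>"
      using le[of m] le[of "m - 1"] by linarith+
  qed
  have diff: "\<bar>x w m - x z m\<bar> \<le> sqrt 2 * norm (w m - z m)" for m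
  proof -
    have "x w m - x z m = sqrt 2 * Re (cis t * (w m - z m))"
      by (simp add: x_def algebra_simps)
    then show ?thesis
      using abs_Re_cis_mult_le[of t "w m - z m"] by (simp add: abs_mult)
  qed
  have "rot_field v f t w n - rot_field v f t z n
      = - \<i> * cis (- t) * of_real ((chain_force v f (x w) n - chain_force v f (x z) n) / sqrt 2)"
    by (simp add: rot_field_def x_def[abs_def] algebra_simps diff_divide_distrib)
  then have "norm (rot_field v f t w n - rot_field v f t z n)
      = \<bar>chain_force v f (x w) n - chain_force v f (x z) n\<bar> / sqrt 2"
    by (simp only: norm_mult norm_of_real) simp
  also have "\<bar>chain_force v f (x w) n - chain_force v f (x z) n\<bar>
      \<le> \<Lambda> * (\<bar>x w (n + 1) - x z (n + 1)\<bar> + 3 * \<bar>x w n - x z n\<bar> + \<bar>x w (n - 1) - x z (n - 1)\<bar>)"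
    by (rule chain_force_lipschitz[where A = "{r. \<bar>r\<bar> \<le> \<rho>}"])
      (use small[of w] small[of z] v f w z \<open>0 \<le> \<Lambda>\<close> in auto)
  also have "\<dots> \<le> \<Lambda> * (sqrt 2 * norm (w (n + 1) - z (n + 1)) + 3 * (sqrt 2 * norm (w n - z n))
      + sqrt 2 * norm (w (n - 1) - z (n - 1)))"
    using \<open>0 \<le> \<Lambda>\<close> by (intro mult_left_mono add_mono diff) auto
  also have "\<dots> / sqrt 2 = \<Lambda> * (norm (w (n + 1) - z (n + 1)) + 3 * norm (w n - z n) + norm (w (n - 1) - z (n - 1)))"
    by (simp add: field_simps)
  finally show ?thesis by (simp add: divide_right_mono)
qed

context
  fixes p :: ereal
  assumes p: "1 \<le> p"
begin

lemma lp_le_neighbours: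
  assumes u: "lp_le p u M" and "0 \<le> \<Lambda>"
    and le: "\<And>n. norm (z n) \<le> \<Lambda> * (norm (u (n + 1)) + 3 * norm (u n) + norm (u (n - 1)))"
  shows "lp_le p z (5 * \<Lambda> * M)"
proof -
  have "lp_le p (\<lambda>n. 3 * norm (u n)) (3 * M)"
    by (rule lp_le_scale[OF p u]) auto
  moreover have "lp_le p (\<lambda>n. norm (u (n + k))) M" for k
    by (rule lp_le_mono[OF p lp_le_shift[OF p u, of k]]) simp
  from this[of 1] this[of "- 1"] have "lp_le p (\<lambda>n. norm (u (n + 1))) M" "lp_le p (\<lambda>n. norm (u (n - 1))) M"
    by simp_all
  ultimately have "lp_le p (\<lambda>n. norm (u (n + 1)) + 3 * norm (u n) + norm (u (n - 1))) (M + 3 * M + M)"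
    by (intro lp_le_add[OF p])
  then have "lp_le p z (\<Lambda> * (M + 3 * M + M))"
    by (rule lp_le_scale[OF p _ \<open>0 \<le> \<Lambda>\<close>]) (use le in simp)
  then show ?thesis by (simp add: algebra_simps)
qed

lemma lp_le_difference:
  assumes "lp_le p u M"
  shows "lp_le p (\<lambda>n. u n - u (n - 1)) (2 * M)" "lp_le p (\<lambda>n. u (n + 1) - u n) (2 * M)"
  using lp_le_diff[OF p assms lp_le_shift[OF p assms, of "- 1"]]
    lp_le_diff[OF p lp_le_shift[OF p assms, of 1] assms] by simp_all

lemma rot_field_lp_lipschitz:
  assumes "\<And>r s. \<bar>r\<bar> \<le> \<rho> \<Longrightarrow> \<bar>s\<bar> \<le> \<rho> \<Longrightarrow> \<bar>v r - v s\<bar> \<le> \<Lambda> * \<bar>r - s\<bar>"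
    and "\<And>r s. \<bar>r\<bar> \<le> \<rho> \<Longrightarrow> \<bar>s\<bar> \<le> \<rho> \<Longrightarrow> \<bar>f r - f s\<bar> \<le> \<Lambda> * \<bar>r - s\<bar>"
    and \<Lambda>: "0 \<le> \<Lambda>"
    and "\<And>n. 4 * norm (w n) \<le> \<rho>" and "\<And>n. 4 * norm (z n) \<le> \<rho>"
    and u: "lp_le p (\<lambda>n. w n - z n) M"
  shows "lp_le p (\<lambda>n. rot_field v f t w n - rot_field v f t z n) (5 * \<Lambda> * M)"
  by (rule lp_le_neighbours[OF u \<Lambda>], rule rot_field_lipschitz[where \<rho> = \<rho>]) (fact assms)+

lemma chain_field_lp_lipschitz:
  assumes v: "\<And>r s. r \<in> A \<Longrightarrow> s \<in> A \<Longrightarrow> \<bar>v r - v s\<bar> \<le> \<Lambda> * \<bar>r - s\<bar>"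
    and f: "\<And>r s. r \<in> A \<Longrightarrow> s \<in> A \<Longrightarrow> \<bar>f r - f s\<bar> \<le> \<Lambda> * \<bar>r - s\<bar>"
    and \<Lambda>: "0 \<le> \<Lambda>"
    and x: "\<And>n. fst (X n) \<in> A" "\<And>n. fst (X n) - fst (X (n - 1)) \<in> A"
    and y: "\<And>n. fst (Y n) \<in> A" "\<And>n. fst (Y n) - fst (Y (n - 1)) \<in> A"
    and u: "lp_le p (\<lambda>n. X n - Y n) M"
  shows "lp_le p (\<lambda>n. chain_field v f X n - chain_field v f Y n) ((1 + 5 * \<Lambda>) * M)"
proof -
  let ?F = "\<lambda>n. chain_force v f (\<lambda>m. fst (X m)) n - chain_force v f (\<lambda>m. fst (Y m)) n"
  have fst_le: "\<bar>fst (X m) - fst (Y m)\<bar> \<le> norm (X m - Y m)" for m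
    using norm_fst_le[of "fst (X m - Y m)" "snd (X m - Y m)", unfolded prod.collapse] by simp
  have "lp_le p ?F (5 * \<Lambda> * M)"
  proof (rule lp_le_neighbours[OF u \<Lambda>])
    fix n
    have "norm (?F n) \<le> \<Lambda> * (\<bar>fst (X (n + 1)) - fst (Y (n + 1))\<bar> + 3 * \<bar>fst (X n) - fst (Y n)\<bar>
        + \<bar>fst (X (n - 1)) - fst (Y (n - 1))\<bar>)"
      unfolding real_norm_def 
      by (rule chain_force_lipschitz[where A = A and x = "\<lambda>m. fst (X m)" and y = "\<lambda>m. fst (Y m)"])
        (fact v f \<Lambda> x y)+
    also have "\<dots> \<le> \<Lambda> * (norm (X (n + 1) - Y (n + 1)) + 3 * norm (X n - Y n) + norm (X (n - 1) - Y (n - 1)))"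
      by (intro mult_left_mono \<Lambda> add_mono fst_le order_refl) auto
    finally show "norm (?F n) \<le> \<dots>" .
  qed
  from lp_le_mono[OF p this, of "\<lambda>n. norm (?F n)"]
  have F: "lp_le p (\<lambda>n. norm (?F n)) (5 * \<Lambda> * M)" by simp
  from lp_le_mono[OF p u, of "\<lambda>n. norm (X n - Y n)"]
  have "lp_le p (\<lambda>n. norm (X n - Y n)) M" by simp
  from lp_le_add[OF p this F]
  have "lp_le p (\<lambda>n. chain_field v f X n - chain_field v f Y n) (M + 5 * \<Lambda> * M)"
  proof (rule lp_le_mono[OF p])
    fix n
    have "chain_field v f X n - chain_field v f Y n
        = (snd (X n - Y n), - fst (X n - Y n)) + (0, ?F n)"
      by (simp add: chain_field_def)
    also have "norm \<dots> \<le> norm (snd (X n - Y n), - fst (X n - Y n)) + norm (0 :: real, ?F n)"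
      by (rule norm_triangle_ineq)
    also have "\<dots> = norm (X n - Y n) + norm (?F n)"
      by (simp add: norm_Pair norm_prod_def add.commute power2_commute)
    finally show "norm (chain_field v f X n - chain_field v f Y n) \<le> norm (norm (X n - Y n) + norm (?F n))"
      by simp
  qed
  then show ?thesis by (simp add: algebra_simps)
qed

end

section \<open>The residual and the error bound\<close>

text \<open>
  The first summand comes from averaging the leading force, the second from the perturbations; \<open>N + 1\<close> instead
  of \<open>N\<close> allows the solution to exceed the approximation by \<open>\<epsilon>\<close>.
\<close>
definition residual_const :: "real \<Rightarrow> real \<Rightarrow> real \<Rightarrow> real \<Rightarrow> real \<Rightarrow> real" where
  "residual_const \<alpha> \<eta> C T N =
     (let A = C * (4 * (N + 1)) powr (\<alpha> - 1)
      in 16 * pi * A * (N + 1) * (4 * A * T + 1) + 5 * C * (4 * (N + 1)) powr (\<alpha> - 1 + \<eta>) * T * (N + 1))"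

text \<open>
  Initial error plus residual, times the growth factor in Gronwall's inequality, whose exponent is the Lipschitz constant
  \<open>O(\<epsilon> powr (\<alpha> - 1))\<close> times the length \<open>T / \<epsilon> powr (\<alpha> - 1)\<close> of the time interval and hence independent of \<open>\<epsilon>\<close>.
\<close>
definition error_const :: "real \<Rightarrow> real \<Rightarrow> real \<Rightarrow> real \<Rightarrow> real \<Rightarrow> real \<Rightarrow> real" where
  "error_const \<alpha> \<eta> C T Ci N =
     2 * (Ci + residual_const \<alpha> \<eta> C T N) * exp (20 * C * (4 * (N + 1)) powr (\<alpha> - 1) * T)"

text \<open>
  One amplitude, one value of \<open>\<epsilon>\<close> and the Lipschitz data of the forces; \<open>g\<close> and \<open>f\<close> stand for \<open>W'\<close> and \<open>\<phi>'\<close>.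
\<close>
locale modulation =
  fixes p :: ereal and \<alpha> \<eta> kminus kplus C \<rho>0 T N \<epsilon> :: real and g f :: "real \<Rightarrow> real"
    and a a' :: "real \<Rightarrow> int \<Rightarrow> complex"
  assumes p: "1 \<le> p" and \<alpha>: "1 < \<alpha>" and \<eta>: "0 < \<eta>" "\<eta> \<le> \<alpha> - 1" and T: "0 < T" and N: "0 \<le> N"
    and \<epsilon>: "0 < \<epsilon>" "\<epsilon> \<le> 1" and \<epsilon>_small: "4 * (N + 1) * \<epsilon> \<le> \<rho>0" and \<rho>0: "\<rho>0 \<le> 1" and C: "0 \<le> C"
    and h_lip: "lip_near_zero (leading_force \<alpha> kminus kplus) C (\<alpha> - 1) \<rho>0"
    and g_lip: "lip_near_zero g C (\<alpha> - 1 + \<eta>) \<rho>0"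
    and f_lip: "lip_near_zero f C (\<alpha> - 1 + \<eta>) \<rho>0" and f_0: "f 0 = 0"
    and a_deriv: "\<And>t n. t \<in> {0..T} \<Longrightarrow> ((\<lambda>t. a t n) has_vector_derivative a' t n) (at t within {0..T})"
    and a_eq: "\<And>t n. t \<in> {0..T} \<Longrightarrow>
      \<i> * a' t n = delta_plus (amplitude_f \<alpha> kminus kplus (delta_minus (a t))) n"
    and a_bound: "\<And>t. t \<in> {0..T} \<Longrightarrow> lp_le p (a t) N"
begin

text \<open>
  All arguments of the forces along the approximation lie in the ball of radius \<open>\<rho>\<close>. There \<open>\<Lambda>\<close> is a Lipschitz
  constant of the leading force and \<open>\<Lambda>'\<close>, smaller by a factor of order \<open>\<epsilon> powr \<eta>\<close>, one of the perturbations.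
  \<open>osc\<close> is the oscillating leading force, \<open>avg\<close> its mean, \<open>wa\<close> the approximation in the rotating frame,
  \<open>b\<close> its difference sequence and \<open>wa'\<close> its velocity according to the averaged equation.
\<close>
definition "h = leading_force \<alpha> kminus kplus"
definition "\<rho> = 4 * (N + 1) * \<epsilon>"
definition "\<Lambda> = C * \<rho> powr (\<alpha> - 1)"
definition "\<Lambda>' = C * \<rho> powr (\<alpha> - 1 + \<eta>)"
definition "\<tau> = T / \<epsilon> powr (\<alpha> - 1)"
definition osc :: "real \<Rightarrow> complex \<Rightarrow> complex" where
  "osc s z = cis (- s) * of_real (h (sqrt 2 * Re (cis s * z)) / sqrt 2)"
definition avg :: "complex \<Rightarrow> complex" where
  "avg z = of_real (omega0 \<alpha> kminus kplus) * z * of_real (norm z powr (\<alpha> - 1))"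
definition wa :: "real \<Rightarrow> int \<Rightarrow> complex" where
  "wa t n = of_real \<epsilon> * a (\<epsilon> powr (\<alpha> - 1) * t) n"
definition b :: "real \<Rightarrow> int \<Rightarrow> complex" where
  "b t n = wa t n - wa t (n - 1)"
definition wa' :: "real \<Rightarrow> int \<Rightarrow> complex" where
  "wa' t n = - \<i> * (avg (b t (n + 1)) - avg (b t n))"

lemma \<rho>: "0 < \<rho>" "\<rho> \<le> \<rho>0" "\<rho> \<le> 1"
  using N \<epsilon> \<epsilon>_small \<rho>0 by (auto simp: \<rho>_def)

lemma \<Lambda>: "0 \<le> \<Lambda>" "0 \<le> \<Lambda>'" "\<Lambda>' \<le> \<Lambda>"
  using C \<rho> \<eta> by (auto simp: \<Lambda>_def \<Lambda>'_def intro!: mult_left_mono powr_mono')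

lemma \<tau>: "0 < \<tau>" using T \<epsilon> by (simp add: \<tau>_def)

lemma \<Lambda>_eq: "\<Lambda> = C * (4 * (N + 1)) powr (\<alpha> - 1) * \<epsilon> powr (\<alpha> - 1)"
  "\<Lambda>' = C * (4 * (N + 1)) powr (\<alpha> - 1 + \<eta>) * \<epsilon> powr (\<alpha> - 1 + \<eta>)"
  using N \<epsilon> by (simp_all add: \<Lambda>_def \<Lambda>'_def \<rho>_def powr_mult)

lemma \<Lambda>_time: "\<Lambda> * \<tau> = C * (4 * (N + 1)) powr (\<alpha> - 1) * T"
  "\<Lambda>' * \<tau> = C * (4 * (N + 1)) powr (\<alpha> - 1 + \<eta>) * T * \<epsilon> powr \<eta>"
  using \<epsilon> by (simp_all add: \<Lambda>_eq \<tau>_def powr_add)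

lemma h_diff: "\<bar>r\<bar> \<le> \<rho> \<Longrightarrow> \<bar>s\<bar> \<le> \<rho> \<Longrightarrow> \<bar>h r - h s\<bar> \<le> \<Lambda> * \<bar>r - s\<bar>"
  unfolding h_def \<Lambda>_def by (rule lip_near_zeroD[OF h_lip \<rho>(1,2)])

lemma g_diff: "\<bar>r\<bar> \<le> \<rho> \<Longrightarrow> \<bar>s\<bar> \<le> \<rho> \<Longrightarrow> \<bar>g r - g s\<bar> \<le> \<Lambda>' * \<bar>r - s\<bar>"
  unfolding \<Lambda>'_def by (rule lip_near_zeroD[OF g_lip \<rho>(1,2)])

lemma f_diff: "\<bar>r\<bar> \<le> \<rho> \<Longrightarrow> \<bar>s\<bar> \<le> \<rho> \<Longrightarrow> \<bar>f r - f s\<bar> \<le> \<Lambda>' * \<bar>r - s\<bar>"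
  unfolding \<Lambda>'_def by (rule lip_near_zeroD[OF f_lip \<rho>(1,2)])

lemma h_0: "h 0 = 0"
  by (simp add: h_def leading_force_def)

lemma continuous_on_h: "continuous_on S h"
  unfolding h_def
  by (intro continuous_at_imp_continuous_on ballI DERIV_isCont[OF has_real_derivative_leading_force[OF \<alpha>]])

lemma osc_diff:
  assumes z: "2 * norm z \<le> \<rho>" "2 * norm z' \<le> \<rho>"
  shows "norm (osc s z - osc s z') \<le> \<Lambda> * norm (z - z')"
proof -
  have small: "\<bar>sqrt 2 * Re (cis s * z)\<bar> \<le> \<rho>" if "2 * norm z \<le> \<rho>" for z
  proof -
    have "\<bar>sqrt 2 * Re (cis s * z)\<bar> \<le> 2 * norm z"
      unfolding abs_mult using sqrt2_bounds abs_Re_cis_mult_le[of s z] by (intro mult_mono) auto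
    then show ?thesis using that by simp
  qed
  have "osc s z - osc s z' = cis (- s) * of_real ((h (sqrt 2 * Re (cis s * z)) - h (sqrt 2 * Re (cis s * z'))) / sqrt 2)"
    by (simp add: osc_def diff_divide_distrib algebra_simps)
  then have "norm (osc s z - osc s z') = \<bar>h (sqrt 2 * Re (cis s * z)) - h (sqrt 2 * Re (cis s * z'))\<bar> / sqrt 2"
    by (simp only: norm_mult norm_of_real) simp
  also have "\<dots> \<le> \<Lambda> * \<bar>sqrt 2 * Re (cis s * z) - sqrt 2 * Re (cis s * z')\<bar> / sqrt 2"
    by (intro divide_right_mono h_diff small z) simp
  also have "sqrt 2 * Re (cis s * z) - sqrt 2 * Re (cis s * z') = sqrt 2 * Re (cis s * (z - z'))"
    by (simp add: algebra_simps)
  also have "\<Lambda> * \<bar>sqrt 2 * Re (cis s * (z - z'))\<bar> / sqrt 2 = \<Lambda> * \<bar>Re (cis s * (z - z'))\<bar>"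
    by (simp only: abs_mult) simp
  also have "\<dots> \<le> \<Lambda> * norm (z - z')"
    by (intro mult_left_mono abs_Re_cis_mult_le \<Lambda>)
  finally show ?thesis .
qed

lemma has_integral_osc: "((\<lambda>s. osc s z) has_integral of_real (2 * pi) * avg z) {0..2 * pi}"
  unfolding osc_def avg_def h_def by (rule leading_force_average[OF \<alpha>])

text \<open>
  As a mean of \<open>osc\<close> over a period, \<open>avg\<close> inherits its Lipschitz constant.
\<close>
lemma avg_diff:
  assumes z: "2 * norm z \<le> \<rho>" "2 * norm z' \<le> \<rho>"
  shows "norm (avg z - avg z') \<le> \<Lambda> * norm (z - z')"
proof -
  have "norm (of_real (2 * pi) * avg z - of_real (2 * pi) * avg z') \<le> \<Lambda> * norm (z - z') * measure lborel (cbox 0 (2 * pi))"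
  proof (rule has_integral_bound)
    show "((\<lambda>s. osc s z - osc s z') has_integral (of_real (2 * pi) * avg z - of_real (2 * pi) * avg z')) (cbox 0 (2 * pi))"
      using has_integral_diff[OF has_integral_osc has_integral_osc] by simp
  qed (use osc_diff[OF z] \<Lambda> in auto)
  moreover have eq: "of_real (2 * pi) * avg z - of_real (2 * pi) * avg z' = of_real (2 * pi) * (avg z - avg z')"
    by (simp only: right_diff_distrib)
  ultimately have "2 * pi * norm (avg z - avg z') \<le> 2 * pi * (\<Lambda> * norm (z - z'))"
    unfolding eq norm_mult norm_of_real by (simp add: mult_ac)
  then show ?thesis by simp
qed

lemma avg_0: "avg 0 = 0" by (simp add: avg_def)

lemma avg_scale: "of_real (\<epsilon> powr (\<alpha> - 1)) * (of_real \<epsilon> * avg z) = avg (of_real \<epsilon> * z)"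
  using \<epsilon> by (simp add: avg_def norm_mult powr_mult algebra_simps)

lemma slow_time: "t \<in> {0..\<tau>} \<Longrightarrow> \<epsilon> powr (\<alpha> - 1) * t \<in> {0..T}"
  using \<epsilon> T by (auto simp: \<tau>_def field_simps)

lemma wa_bound: "t \<in> {0..\<tau>} \<Longrightarrow> lp_le p (wa t) (\<epsilon> * N)"
  using \<epsilon> by (intro lp_le_scale[OF p a_bound[OF slow_time]]) (auto simp: wa_def norm_mult)

lemma b_bound: "t \<in> {0..\<tau>} \<Longrightarrow> lp_le p (b t) (2 * (\<epsilon> * N))"
  unfolding b_def[abs_def] by (rule lp_le_difference[OF p wa_bound])

lemma small_wa: "t \<in> {0..\<tau>} \<Longrightarrow> 4 * norm (wa t n) \<le> \<rho>"
  using lp_le_component[OF p wa_bound, of t n] \<epsilon> by (simp add: \<rho>_def algebra_simps)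

lemma small_b: "t \<in> {0..\<tau>} \<Longrightarrow> 2 * norm (b t n) \<le> \<rho>"
  using lp_le_component[OF p b_bound, of t n] \<epsilon> by (simp add: \<rho>_def algebra_simps)

lemma wa_deriv:
  assumes t: "t \<in> {0..\<tau>}"
  shows "((\<lambda>t. wa t n) has_vector_derivative wa' t n) (at t within {0..\<tau>})"
proof -
  define \<kappa> where "\<kappa> = \<epsilon> powr (\<alpha> - 1)"
  have k: "((\<lambda>t. \<kappa> * t) has_vector_derivative \<kappa>) (at t within {0..\<tau>})"
    by (auto intro!: derivative_eq_intros simp flip: has_real_derivative_iff_has_vector_derivative)
  have "((\<lambda>t. a t n) has_vector_derivative a' (\<kappa> * t) n) (at (\<kappa> * t) within (\<lambda>t. \<kappa> * t) ` {0..\<tau>})"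
    by (rule has_vector_derivative_within_subset[OF a_deriv]) (use t slow_time in \<open>auto simp: \<kappa>_def\<close>)
  from vector_diff_chain_within[OF k this]
  have "((\<lambda>t. a (\<kappa> * t) n) has_vector_derivative \<kappa> *\<^sub>R a' (\<kappa> * t) n) (at t within {0..\<tau>})"
    by (simp add: o_def)
  from has_vector_derivative_mult_right[OF this, of "of_real \<epsilon>"]
  have "((\<lambda>t. wa t n) has_vector_derivative of_real \<epsilon> * (\<kappa> *\<^sub>R a' (\<kappa> * t) n)) (at t within {0..\<tau>})"
    by (simp add: wa_def \<kappa>_def)
  moreover have "of_real \<epsilon> * (\<kappa> *\<^sub>R a' (\<kappa> * t) n) = wa' t n"
  proof -
    have "\<kappa> * t \<in> {0..T}" using slow_time[OF t] by (simp add: \<kappa>_def)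
    from a_eq[OF this, of n]
    have eq: "\<i> * a' (\<kappa> * t) n = avg (a (\<kappa> * t) (n + 1) - a (\<kappa> * t) n) - avg (a (\<kappa> * t) n - a (\<kappa> * t) (n - 1))"
      by (simp add: delta_plus_def delta_minus_def amplitude_f_def avg_def)
    have "a' (\<kappa> * t) n = - \<i> * (\<i> * a' (\<kappa> * t) n)"
      by (simp flip: mult.assoc)
    then have "a' (\<kappa> * t) n = - \<i> * (avg (a (\<kappa> * t) (n + 1) - a (\<kappa> * t) n) - avg (a (\<kappa> * t) n - a (\<kappa> * t) (n - 1)))"
      by (simp only: eq)
    moreover have avg_b: "avg (b t m) = of_real \<kappa> * (of_real \<epsilon> * avg (a (\<kappa> * t) m - a (\<kappa> * t) (m - 1)))" for m
      unfolding \<kappa>_def avg_scale by (simp add: b_def wa_def right_diff_distrib)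
    ultimately show ?thesis
      using avg_b[of n] avg_b[of "n + 1"] by (simp only: wa'_def scaleR_conv_of_real add_diff_cancel_right') (simp add: algebra_simps)
  qed
  ultimately show ?thesis by simp
qed

lemma wa'_bound:
  assumes t: "t \<in> {0..\<tau>}"
  shows "lp_le p (wa' t) (4 * \<Lambda> * (\<epsilon> * N))"
proof -
  have "lp_le p (\<lambda>n. avg (b t n)) (\<Lambda> * (2 * (\<epsilon> * N)))"
    using avg_diff[OF small_b[OF t], of 0] \<rho>
    by (intro lp_le_scale[OF p b_bound[OF t] \<Lambda>(1)]) (simp add: avg_0)
  from lp_le_difference(2)[OF p this]
  show ?thesis
    by (rule lp_le_weaken[OF lp_le_mono[OF p]]) (simp_all add: wa'_def norm_mult)
qed

lemma wa_lipschitz: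
  assumes "s \<in> {0..\<tau>}" "t \<in> {0..\<tau>}"
  shows "lp_le p (\<lambda>n. wa s n - wa t n) (4 * \<Lambda> * (\<epsilon> * N) * \<bar>s - t\<bar>)"
  by (rule lp_le_lipschitz[OF p wa_deriv wa'_bound assms])

lemma continuous_on_wa: "continuous_on {0..\<tau>} (\<lambda>t. wa t n)"
  by (rule continuous_on_vector_derivative[OF wa_deriv])

lemma continuous_on_b: "continuous_on {0..\<tau>} (\<lambda>t. b t n)"
  unfolding b_def by (intro continuous_intros continuous_on_wa)

text \<open>
  The accumulated deviation of the leading force from its mean.
\<close>
definition "Q t n = integral {0..t} (\<lambda>s. osc s (b s n) - avg (b s n))"

lemma continuous_on_avg [continuous_intros]: "continuous_on S u \<Longrightarrow> continuous_on S (\<lambda>x. avg (u x))"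
  unfolding avg_def using \<alpha> by (intro continuous_intros continuous_on_powr') auto

lemma continuous_on_osc: "continuous_on S u \<Longrightarrow> continuous_on S v \<Longrightarrow> continuous_on S (\<lambda>x. osc (u x) (v x))"
  unfolding osc_def by (intro continuous_intros continuous_on_compose2[OF continuous_on_h[of UNIV]]) auto

lemma Q_bound:
  assumes t: "t \<in> {0..\<tau>}"
  shows "lp_le p (Q t) (8 * pi * \<Lambda> * (\<epsilon> * N) * (4 * \<Lambda> * t + 1))"
proof -
  define q where "q s z = osc s z - avg z" for s z
  have "lp_le p (\<lambda>n. integral {0..t} (\<lambda>s. q s (b s n))) (2 * \<Lambda> * (2 * pi) * (8 * \<Lambda> * (\<epsilon> * N) * t + 2 * (\<epsilon> * N)))"
  proof (rule lp_averaging[OF p, where P = "2 * pi" and \<Lambda> = "2 * \<Lambda>" and D = "8 * \<Lambda> * (\<epsilon> * N)" and R = "2 * (\<epsilon> * N)"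
        and q = q and b = b and \<tau> = \<tau>])
    show "continuous_on UNIV (\<lambda>(s, z). q s z)"
      unfolding q_def case_prod_unfold by (intro continuous_intros continuous_on_osc)
    show "q (s + 2 * pi) z = q s z" for s z
    proof -
      have "cis (s + 2 * pi) = cis s" "cis (- (s + 2 * pi)) = cis (- s)"
        using cos_minus[of "s + 2 * pi"] sin_minus[of "s + 2 * pi"]
        by (simp_all only: complex_eq_iff cis.sel cos_minus sin_minus cos_periodic sin_periodic)
      then show ?thesis by (simp only: q_def osc_def)
    qed
    show "((\<lambda>s. q s z) has_integral 0) {0..2 * pi}" for z
      using has_integral_diff[OF has_integral_osc[of z] has_integral_const_real[of "avg z" 0 "2 * pi"]]
      by (simp add: q_def scaleR_conv_of_real)
    show "norm (q s z - q s z') \<le> 2 * \<Lambda> * norm (z - z')"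
      if z: "norm z \<le> 2 * (\<epsilon> * N)" "norm z' \<le> 2 * (\<epsilon> * N)" for s z z'
    proof -
      have small: "2 * norm z \<le> \<rho>" "2 * norm z' \<le> \<rho>"
        using z \<epsilon> by (auto simp: \<rho>_def algebra_simps)
      have "q s z - q s z' = (osc s z - osc s z') - (avg z - avg z')" by (simp add: q_def)
      then show ?thesis
        using norm_triangle_ineq4[of "osc s z - osc s z'" "avg z - avg z'"] osc_diff[OF small, of s] avg_diff[OF small]
        by simp
    qed
    show "q s 0 = 0" for s by (simp add: q_def osc_def avg_0 h_0)
    show "lp_le p (\<lambda>n. b s n - b t n) (8 * \<Lambda> * (\<epsilon> * N) * \<bar>s - t\<bar>)" if "s \<in> {0..\<tau>}" "t \<in> {0..\<tau>}" for s t
      using lp_le_difference(1)[OF p wa_lipschitz[OF that]] by (simp add: b_def algebra_simps)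
  qed (use \<Lambda> \<epsilon> N continuous_on_b b_bound t in auto)
  then show ?thesis
    by (rule lp_le_weaken[OF lp_le_mono[OF p]]) (simp_all add: Q_def q_def algebra_simps)
qed

text \<open>
  The time integral of the residual of \<open>wa\<close>, cf. \<open>r_deriv\<close>; writing it through \<open>Q\<close> makes the averaging lemma
  applicable.
\<close>
definition "r t n = - \<i> * (Q t (n + 1) - Q t n) + integral {0..t} (\<lambda>s. rot_field g f s (wa s) n)"

lemma rot_field_leading: "rot_field h (\<lambda>_. 0) t (wa t) n = - \<i> * (osc t (b t (n + 1)) - osc t (b t n))"
proof -
  have "sqrt 2 * Re (cis t * wa t m) - sqrt 2 * Re (cis t * wa t (m - 1)) = sqrt 2 * Re (cis t * b t m)" for m
    by (simp add: b_def algebra_simps)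
  note step = this[of n] this[of "n + 1", unfolded add_diff_cancel_right']
  show ?thesis
    unfolding rot_field_def chain_force_def osc_def step by (simp add: diff_divide_distrib right_diff_distrib mult.assoc)
qed

lemma continuous_on_local:
  assumes "\<And>r s. \<bar>r\<bar> \<le> \<rho> \<Longrightarrow> \<bar>s\<bar> \<le> \<rho> \<Longrightarrow> \<bar>k r - k s\<bar> \<le> L * \<bar>r - s\<bar>"
  shows "continuous_on {- \<rho>..\<rho>} (k :: real \<Rightarrow> real)"
proof (rule lipschitz_on_continuous_on[of "max 0 L"], rule lipschitz_onI)
  fix r s assume "r \<in> {- \<rho>..\<rho>}" "s \<in> {- \<rho>..\<rho>}"
  then have "\<bar>k r - k s\<bar> \<le> L * \<bar>r - s\<bar>" by (intro assms) auto
  also have "\<dots> \<le> max 0 L * \<bar>r - s\<bar>" by (intro mult_right_mono) auto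
  finally show "dist (k r) (k s) \<le> max 0 L * dist r s" by (simp add: dist_real_def)
qed simp

lemma small_x:
  assumes "t \<in> {0..\<tau>}"
  shows "sqrt 2 * Re (cis t * wa t n) \<in> {- \<rho>..\<rho>}"
    "sqrt 2 * Re (cis t * wa t n) - sqrt 2 * Re (cis t * wa t (n - 1)) \<in> {- \<rho>..\<rho>}"
proof -
  have "\<bar>sqrt 2 * Re (cis t * wa t n)\<bar> \<le> \<rho> / 2" for n
  proof -
    have "\<bar>sqrt 2 * Re (cis t * wa t n)\<bar> \<le> 2 * norm (wa t n)"
      unfolding abs_mult using sqrt2_bounds abs_Re_cis_mult_le[of t "wa t n"] by (intro mult_mono) auto
    then show ?thesis using small_wa[OF assms, of n] by simp
  qed
  from this[of n] this[of "n - 1"]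
  show "sqrt 2 * Re (cis t * wa t n) \<in> {- \<rho>..\<rho>}"
    "sqrt 2 * Re (cis t * wa t n) - sqrt 2 * Re (cis t * wa t (n - 1)) \<in> {- \<rho>..\<rho>}"
    using \<rho> by (auto simp: abs_le_iff)
qed

lemma continuous_on_rot_field: "continuous_on {0..\<tau>} (\<lambda>s. rot_field g f s (wa s) n)"
proof -
  have g: "continuous_on {- \<rho>..\<rho>} g" by (rule continuous_on_local) (rule g_diff)
  have f: "continuous_on {- \<rho>..\<rho>} f" by (rule continuous_on_local) (rule f_diff)
  have x: "continuous_on {0..\<tau>} (\<lambda>s. sqrt 2 * Re (cis s * wa s m))" for m
    by (intro continuous_intros continuous_on_wa)
  have d: "continuous_on {0..\<tau>} (\<lambda>s. sqrt 2 * Re (cis s * wa s m) - sqrt 2 * Re (cis s * wa s (m - 1)))" for m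
    by (intro continuous_on_diff x)
  have "continuous_on {0..\<tau>} (\<lambda>s. g (sqrt 2 * Re (cis s * wa s m) - sqrt 2 * Re (cis s * wa s (m - 1))))" for m
    by (rule continuous_on_compose2[OF g d]) (intro image_subsetI small_x)
  from this[of n] this[of "n + 1"]
  have "continuous_on {0..\<tau>} (\<lambda>s. g (sqrt 2 * Re (cis s * wa s n) - sqrt 2 * Re (cis s * wa s (n - 1))))"
    "continuous_on {0..\<tau>} (\<lambda>s. g (sqrt 2 * Re (cis s * wa s (n + 1)) - sqrt 2 * Re (cis s * wa s n)))"
    by simp_all
  moreover have "continuous_on {0..\<tau>} (\<lambda>s. f (sqrt 2 * Re (cis s * wa s n)))"
    by (rule continuous_on_compose2[OF f x]) (intro image_subsetI small_x)
  ultimately show ?thesis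
    unfolding rot_field_def chain_force_def by (intro continuous_intros) auto
qed

lemma r_deriv:
  assumes t: "t \<in> {0..\<tau>}"
  shows "((\<lambda>t. r t n) has_vector_derivative rot_field (\<lambda>x. h x + g x) f t (wa t) n - wa' t n) (at t within {0..\<tau>})"
proof -
  have Q: "((\<lambda>t. Q t m) has_vector_derivative osc t (b t m) - avg (b t m)) (at t within {0..\<tau>})" for m
    unfolding Q_def
    by (rule integral_has_vector_derivative[OF _ t]) (intro continuous_intros continuous_on_osc continuous_on_b)
  have "((\<lambda>t. r t n) has_vector_derivative - \<i> * ((osc t (b t (n + 1)) - avg (b t (n + 1))) - (osc t (b t n) - avg (b t n)))
      + rot_field g f t (wa t) n) (at t within {0..\<tau>})"
    unfolding r_def
    by (intro has_vector_derivative_add has_vector_derivative_mult_right has_vector_derivative_diff Q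
        integral_has_vector_derivative[OF continuous_on_rot_field t])
  moreover have "- \<i> * ((osc t (b t (n + 1)) - avg (b t (n + 1))) - (osc t (b t n) - avg (b t n)))
      + rot_field g f t (wa t) n = rot_field (\<lambda>x. h x + g x) f t (wa t) n - wa' t n"
    unfolding rot_field_add[of h g f t "wa t" n] rot_field_leading wa'_def by (simp add: algebra_simps)
  ultimately show ?thesis by (simp only:)
qed

lemma r_0: "r 0 n = 0"
  by (simp add: r_def Q_def)

text \<open>
  Averaging makes \<open>Q\<close> of order \<open>\<Lambda> \<epsilon>\<close> on the whole interval, that is \<open>O(\<epsilon> powr \<alpha>)\<close>, because \<open>\<Lambda> * t\<close> stays bounded; the
  perturbations contribute \<open>\<Lambda>' \<epsilon> t\<close>, which is \<open>O(\<epsilon> powr (1 + \<eta>))\<close>. The first power is the smaller one as \<open>\<eta> \<le> \<alpha> - 1\<close>.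
\<close>
lemma r_bound:
  assumes t: "t \<in> {0..\<tau>}"
  shows "lp_le p (r t) (residual_const \<alpha> \<eta> C T N * \<epsilon> powr (1 + \<eta>))"
proof -
  let ?G = "\<lambda>t n. integral {0..t} (\<lambda>s. rot_field g f s (wa s) n)"
  have "lp_le p (\<lambda>n. ?G t n - ?G 0 n) (5 * \<Lambda>' * (\<epsilon> * N) * t - 5 * \<Lambda>' * (\<epsilon> * N) * 0)"
  proof (rule lp_le_mean_value[OF p, where u = ?G and u' = "\<lambda>s. rot_field g f s (wa s)"
        and \<psi> = "\<lambda>t. 5 * \<Lambda>' * (\<epsilon> * N) * t" and \<psi>' = "\<lambda>_. 5 * \<Lambda>' * (\<epsilon> * N)"])
    show "0 \<le> t" using t by simp
    fix s assume "s \<in> {0..t}"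
    then have s: "s \<in> {0..\<tau>}" using t by auto
    show "((\<lambda>t. ?G t n) has_vector_derivative rot_field g f s (wa s) n) (at s within {0..t})" for n
      by (rule has_vector_derivative_within_subset[OF integral_has_vector_derivative[OF continuous_on_rot_field s]])
        (use t in auto)
    show "((\<lambda>t. 5 * \<Lambda>' * (\<epsilon> * N) * t) has_real_derivative 5 * \<Lambda>' * (\<epsilon> * N)) (at s within {0..t})"
      by (rule DERIV_cmult_Id)
    have "lp_le p (\<lambda>n. rot_field g f s (wa s) n - rot_field g f s (\<lambda>_. 0) n) (5 * \<Lambda>' * (\<epsilon> * N))"
      by (rule rot_field_lp_lipschitz[OF p, where \<rho> = \<rho>, OF g_diff f_diff])
        (use \<Lambda> \<rho> small_wa[OF s] wa_bound[OF s] in auto)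
    moreover have "rot_field g f s (\<lambda>_. 0) n = 0" for n
      using chain_force_zero[of f, OF f_0] by (simp add: rot_field_def)
    ultimately show "lp_le p (rot_field g f s (wa s)) (5 * \<Lambda>' * (\<epsilon> * N))" by simp
  qed
  then have G: "lp_le p (?G t) (5 * \<Lambda>' * (\<epsilon> * N) * t)" by simp
  have "lp_le p (\<lambda>n. - \<i> * (Q t (n + 1) - Q t n)) (2 * (8 * pi * \<Lambda> * (\<epsilon> * N) * (4 * \<Lambda> * t + 1)))"
    by (rule lp_le_mono[OF p lp_le_difference(2)[OF p Q_bound[OF t]]]) (simp add: norm_mult)
  from lp_le_add[OF p this G]
  have "lp_le p (r t) (16 * pi * \<Lambda> * (\<epsilon> * N) * (4 * \<Lambda> * t + 1) + 5 * \<Lambda>' * (\<epsilon> * N) * t)"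
    by (simp add: r_def[abs_def] mult.assoc)
  then show ?thesis
  proof (rule lp_le_weaken)
    define A where "A = C * (4 * (N + 1)) powr (\<alpha> - 1)"
    define B where "B = C * (4 * (N + 1)) powr (\<alpha> - 1 + \<eta>)"
    have A: "0 \<le> A" "0 \<le> B" using C by (auto simp: A_def B_def)
    have \<Lambda>t: "\<Lambda> * t \<le> A * T" "\<Lambda>' * t \<le> B * T * \<epsilon> powr \<eta>"
      using mult_left_mono[of t \<tau> \<Lambda>] mult_left_mono[of t \<tau> \<Lambda>'] t \<Lambda> unfolding \<Lambda>_time A_def B_def by auto
    have "\<epsilon> powr (\<alpha> - 1) \<le> \<epsilon> powr \<eta>"
      using \<eta> \<epsilon> by (intro powr_mono') auto
    then have \<Lambda>_le: "\<Lambda> \<le> A * \<epsilon> powr \<eta>"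
      unfolding \<Lambda>_eq A_def[symmetric] using A by (intro mult_left_mono)
    have \<epsilon>N: "0 \<le> \<epsilon> * N" "\<epsilon> * N \<le> \<epsilon> * (N + 1)" using \<epsilon> N by auto
    have "0 \<le> \<Lambda> * t" using \<Lambda> t by simp
    then have "\<Lambda> * (\<epsilon> * N) * (4 * (\<Lambda> * t) + 1) \<le> (A * \<epsilon> powr \<eta>) * (\<epsilon> * (N + 1)) * (4 * (A * T) + 1)"
      using \<Lambda>t(1) \<Lambda>_le \<epsilon>N \<Lambda> A \<epsilon> N by (intro mult_mono mult_nonneg_nonneg) auto
    then have "16 * pi * (\<Lambda> * (\<epsilon> * N) * (4 * (\<Lambda> * t) + 1)) \<le> 16 * pi * ((A * \<epsilon> powr \<eta>) * (\<epsilon> * (N + 1)) * (4 * (A * T) + 1))"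
      by (rule mult_left_mono) simp
    moreover have "(\<Lambda>' * t) * (\<epsilon> * N) \<le> (B * T * \<epsilon> powr \<eta>) * (\<epsilon> * (N + 1))"
      by (rule mult_mono[OF \<Lambda>t(2) \<epsilon>N(2)]) (use \<epsilon>N A T in auto)
    moreover have "\<epsilon> powr (1 + \<eta>) = \<epsilon> * \<epsilon> powr \<eta>" using \<epsilon> by (simp add: powr_add)
    ultimately show "16 * pi * \<Lambda> * (\<epsilon> * N) * (4 * \<Lambda> * t + 1) + 5 * \<Lambda>' * (\<epsilon> * N) * t
        \<le> residual_const \<alpha> \<eta> C T N * \<epsilon> powr (1 + \<eta>)"
      unfolding residual_const_def Let_def A_def[symmetric] B_def[symmetric] mult.assoc[of 5 C, folded B_def]
      by (simp add: algebra_simps)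
  qed
qed

text \<open>
  After the initial error and the integrated residual \<open>r\<close> have been subtracted, the difference \<open>w - wa\<close> moves with the difference of
  the field at \<open>w\<close> and at \<open>wa\<close>, to which Gronwall's inequality applies. The forces \<open>vc\<close> and \<open>fc\<close> are truncations that
  agree with the true ones along \<open>wa\<close>.
\<close>
lemma error_bound:
  assumes vc: "\<And>x. \<bar>x\<bar> \<le> \<rho> \<Longrightarrow> vc x = h x + g x" "\<And>x y. \<bar>vc x - vc y\<bar> \<le> 2 * \<Lambda> * \<bar>x - y\<bar>"
    and fc: "\<And>x. \<bar>x\<bar> \<le> \<rho> \<Longrightarrow> fc x = f x" "\<And>x y. \<bar>fc x - fc y\<bar> \<le> 2 * \<Lambda> * \<bar>x - y\<bar>"
    and w: "\<And>t n. t \<in> {0..\<tau>} \<Longrightarrow> ((\<lambda>t. w t n) has_vector_derivative rot_field vc fc t (w t) n) (at t within {0..\<tau>})"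
    and w_bound: "\<And>t. t \<in> {0..\<tau>} \<Longrightarrow> lp_le p (w t) K"
    and initial: "lp_le p (\<lambda>n. w 0 n - wa 0 n) (Ci * \<epsilon> powr (1 + \<eta>))"
    and t: "t \<in> {0..\<tau>}"
  shows "lp_le p (\<lambda>n. w t n - wa t n) (error_const \<alpha> \<eta> C T Ci N * \<epsilon> powr (1 + \<eta>))"
proof -
  define A where "A = Ci * \<epsilon> powr (1 + \<eta>) + residual_const \<alpha> \<eta> C T N * \<epsilon> powr (1 + \<eta>)"
  define u where "u t n = w t n - wa t n" for t n
  define v where "v t n = u t n - u 0 n - r t n" for t n
  define v' where "v' t n = rot_field vc fc t (w t) n - rot_field vc fc t (wa t) n" for t n
  have true_field: "rot_field vc fc t (wa t) n = rot_field (\<lambda>x. h x + g x) f t (wa t) n" if t: "t \<in> {0..\<tau>}" for t n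
    using small_x(1)[OF t, of n] small_x(2)[OF t, of n] small_x(2)[OF t, of "n + 1"]
    unfolding rot_field_def chain_force_def by (simp only: vc fc abs_le_iff atLeastAtMost_iff add_diff_cancel_right' minus_le_iff)
  have "lp_le p (u t) (2 * A * exp (2 * (10 * \<Lambda>) * t))"
  proof (rule lp_gronwall[OF p, where u = u and v = v and v' = v' and L = "10 * \<Lambda>" and \<tau> = \<tau>])
    show "0 \<le> 10 * \<Lambda>" "0 \<le> \<tau>" using \<Lambda> \<tau> by auto
    show "v 0 n = 0" for n by (simp add: v_def r_0)
    show "t \<in> {0..\<tau>}" by (rule t)
  next
    fix t n assume t: "t \<in> {0..\<tau>}"
    have "((\<lambda>t. v t n) has_vector_derivative
        rot_field vc fc t (w t) n - wa' t n - 0 - (rot_field (\<lambda>x. h x + g x) f t (wa t) n - wa' t n)) (at t within {0..\<tau>})"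
      unfolding v_def u_def
      by (intro has_vector_derivative_diff w[OF t] wa_deriv[OF t] r_deriv[OF t] has_vector_derivative_const)
    then show "((\<lambda>t. v t n) has_vector_derivative v' t n) (at t within {0..\<tau>})"
      by (simp add: v'_def true_field[OF t])
  next
    fix t assume t: "t \<in> {0..\<tau>}"
    have "lp_le p (u 0) (Ci * \<epsilon> powr (1 + \<eta>))"
      using initial by (simp add: u_def[abs_def])
    from lp_le_add[OF p this r_bound[OF t]]
    show "lp_le p (\<lambda>n. u t n - v t n) A"
      by (simp add: v_def A_def)
    show "lp_le p (u t) (K + \<epsilon> * N)"
      unfolding u_def by (rule lp_le_diff[OF p w_bound[OF t] wa_bound[OF t]])
  next
    fix t M assume t: "t \<in> {0..\<tau>}" and M: "lp_le p (u t) M"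
    have "lp_le p (v' t) (5 * (2 * \<Lambda>) * M)"
      unfolding v'_def
    proof (rule rot_field_lp_lipschitz[OF p, where \<rho> = "4 * max K (\<epsilon> * N)"])
      show "4 * norm (w t n) \<le> 4 * max K (\<epsilon> * N)" "4 * norm (wa t n) \<le> 4 * max K (\<epsilon> * N)" for n
        using lp_le_component[OF p w_bound[OF t], of n] lp_le_component[OF p wa_bound[OF t], of n] by auto
      show "lp_le p (\<lambda>n. w t n - wa t n) M" using M by (simp add: u_def[abs_def])
    qed (use vc(2) fc(2) \<Lambda> in auto)
    then show "lp_le p (v' t) (10 * \<Lambda> * M)" by simp
  qed
  then have "lp_le p (\<lambda>n. w t n - wa t n) (2 * A * exp (20 * (\<Lambda> * t)))"
    by (simp add: u_def[abs_def] mult.assoc)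
  then show ?thesis
  proof (rule lp_le_weaken)
    have A: "0 \<le> A"
      unfolding A_def using lp_le_nonneg[OF initial] lp_le_nonneg[OF r_bound[OF t]] by simp
    have "\<Lambda> * t \<le> \<Lambda> * \<tau>" using t \<Lambda> by (intro mult_left_mono) auto
    then have "exp (20 * (\<Lambda> * t)) \<le> exp (20 * C * (4 * (N + 1)) powr (\<alpha> - 1) * T)"
      unfolding \<Lambda>_time by (simp add: mult.assoc)
    then have "2 * A * exp (20 * (\<Lambda> * t)) \<le> 2 * A * exp (20 * C * (4 * (N + 1)) powr (\<alpha> - 1) * T)"
      using A by (intro mult_left_mono) auto
    also have "2 * A * exp (20 * C * (4 * (N + 1)) powr (\<alpha> - 1) * T) = error_const \<alpha> \<eta> C T Ci N * \<epsilon> powr (1 + \<eta>)"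
      by (simp add: A_def error_const_def algebra_simps)
    finally show "2 * A * exp (20 * (\<Lambda> * t)) \<le> error_const \<alpha> \<eta> C T Ci N * \<epsilon> powr (1 + \<eta>)" .
  qed
qed

end

section \<open>Solutions of the lattice near the approximation\<close>

text \<open>
  For a continuous function the essential supremum bounds every value, the endpoints included: the sublevel set is closed
  and contains almost every point of the open interval.
\<close>
lemma le_Linf_norm:
  fixes T :: real and F :: "real \<Rightarrow> real"
  assumes T: "0 < T" and cont: "continuous_on {0..T} F" and nonneg: "\<And>t. t \<in> {0..T} \<Longrightarrow> 0 \<le> F t"
    and t: "t \<in> {0..T}"
  shows "F t \<le> real_of_ereal (esssup (lebesgue_on {0..T}) (\<lambda>t. ereal (F t)))"
proof -
  define E where "E = esssup (lebesgue_on {0..T}) (\<lambda>t. ereal (F t))"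
  have le: "F t \<le> e" if e: "E \<le> ereal e" and t: "t \<in> {0..T}" for e t
  proof -
    have "AE x in lebesgue_on {0..T}. ereal (F x) \<le> E"
      unfolding E_def by (rule esssup_AE)
    then have "AE x in lebesgue_on {0..T}. F x \<le> e"
      by (rule AE_mp) (use e in \<open>auto intro!: AE_I2 dest: order_trans\<close>)
    then have "AE x in lebesgue. x \<in> {0..T} \<longrightarrow> F x \<le> e"
      by (simp add: AE_restrict_space_iff)
    then have ae: "AE x in lebesgue. x \<in> {0<..<T} \<longrightarrow> x \<in> {x \<in> {0..T}. F x \<le> e}"
      by (rule AE_mp) (auto intro!: AE_I2)
    have closed: "closed {x \<in> {0..T}. F x \<le> e}"
      using cont by (intro continuous_on_closed_Collect_le continuous_intros) auto
    have "{0<..<T} \<subseteq> {x \<in> {0..T}. F x \<le> e}"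
      using mem_closed_if_AE_lebesgue_open[OF open_greaterThanLessThan closed ae] by blast
    then have "closure {0<..<T} \<subseteq> {x \<in> {0..T}. F x \<le> e}"
      using closed by (rule closure_minimal)
    then show ?thesis using T t by auto
  qed
  obtain B where B: "\<And>x. x \<in> {0..T} \<Longrightarrow> F x \<le> B"
    using compact_imp_bounded[OF compact_continuous_image[OF cont compact_Icc]]
    unfolding bounded_iff real_norm_def by (metis abs_le_D1 imageI)
  have "(\<lambda>t. ereal (F t)) \<in> borel_measurable (lebesgue_on {0..T})"
    using continuous_imp_measurable_on_sets_lebesgue[OF cont] by simp
  then have "E \<le> ereal B"
    unfolding E_def by (rule esssup_I) (use B in \<open>auto intro!: AE_I2\<close>)
  moreover have "E \<noteq> - \<infinity>"
  proof
    assume "E = - \<infinity>"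
    then have "F t \<le> - 1" by (intro le t) auto
    then show False using nonneg[OF t] by simp
  qed
  ultimately obtain e where "E = ereal e" by (cases E) auto
  then show ?thesis using le[of e, OF _ t] by (simp add: E_def)
qed

lemma C2_real_lipschitz_on_bounded:
  assumes "C2_real V"
  obtains L where "0 \<le> L" "\<And>r s. \<bar>r\<bar> \<le> R \<Longrightarrow> \<bar>s\<bar> \<le> R \<Longrightarrow> \<bar>deriv V r - deriv V s\<bar> \<le> L * \<bar>r - s\<bar>"
proof -
  have "bounded ((\<lambda>x. deriv (deriv V) x) ` {- R..R})"
    using C2_real_derivatives(3)[OF assms]
    by (intro compact_imp_bounded compact_continuous_image) (auto intro: continuous_on_subset)
  then obtain L where L: "0 < L" "\<And>x. x \<in> {- R..R} \<Longrightarrow> norm (deriv (deriv V) x) \<le> L"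
    unfolding bounded_pos by blast
  show thesis
  proof
    show "0 \<le> L" using L by simp
    fix r s assume "\<bar>r\<bar> \<le> R" "\<bar>s\<bar> \<le> R"
    then have "norm (deriv V r - deriv V s) \<le> L * norm (r - s)"
      using L(2) by (intro field_differentiable_bound[where S = "{- R..R}" and f' = "deriv (deriv V)"])
        (auto intro: has_field_derivative_at_within C2_real_derivatives(2)[OF assms] simp: abs_le_iff)
    then show "\<bar>deriv V r - deriv V s\<bar> \<le> L * \<bar>r - s\<bar>" by simp
  qed
qed

text \<open>
  Up to the factor \<open>\<surd>2\<close> the change to the rotating frame is an isometry.
\<close>
lemma norm_rotated_difference:
  fixes x y :: real and z :: complex
  shows "norm ((x, y) - (sqrt 2 * Re (cis t * z), - (sqrt 2 * Im (cis t * z))))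
    = sqrt 2 * norm (cis (- t) * Complex x (- y) / of_real (sqrt 2) - z)"
proof -
  define \<zeta> where "\<zeta> = cis t * z"
  have "cis (- t) * Complex x (- y) / of_real (sqrt 2) - z = cis (- t) * (Complex x (- y) / of_real (sqrt 2) - \<zeta>)"
    by (simp add: \<zeta>_def right_diff_distrib cis_mult flip: mult.assoc)
  then have "sqrt 2 * norm (cis (- t) * Complex x (- y) / of_real (sqrt 2) - z)
      = norm (of_real (sqrt 2) * (Complex x (- y) / of_real (sqrt 2) - \<zeta>))"
    by (simp add: norm_mult)
  also have "of_real (sqrt 2) * (Complex x (- y) / of_real (sqrt 2) - \<zeta>) = Complex x (- y) - of_real (sqrt 2) * \<zeta>"
    by (simp add: right_diff_distrib)
  also have "norm (Complex x (- y) - of_real (sqrt 2) * \<zeta>) = norm ((x, y) - (sqrt 2 * Re \<zeta>, - (sqrt 2 * Im \<zeta>)))"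
    by (simp add: cmod_def norm_Pair) (simp add: power2_eq_square algebra_simps)
  finally show ?thesis unfolding \<zeta>_def by simp
qed

lemma X_approx_eq:
  "X_approx \<alpha> a \<epsilon> t n = (sqrt 2 * Re (cis t * (of_real \<epsilon> * a (\<epsilon> powr (\<alpha> - 1) * t) n)),
    - (sqrt 2 * Im (cis t * (of_real \<epsilon> * a (\<epsilon> powr (\<alpha> - 1) * t) n))))"
proof -
  define \<zeta> where "\<zeta> = cis t * (of_real \<epsilon> * a (\<epsilon> powr (\<alpha> - 1) * t) n)"
  have "exp (\<i> * of_real t) = cis t" by (simp add: cis_conv_exp)
  then have z: "of_real (\<epsilon> / sqrt 2) * a (\<epsilon> powr (\<alpha> - 1) * t) n * exp (\<i> * of_real t) = of_real (1 / sqrt 2) * \<zeta>"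
    by (simp add: \<zeta>_def mult_ac)
  have two: "2 * x / sqrt 2 = sqrt 2 * x" for x :: real
    by (simp add: field_simps)
  show ?thesis
    unfolding X_approx_def Let_def z \<zeta>_def[symmetric] by (simp add: plus_cc_def two flip: mult_2)
qed

text \<open>
  The rotation absorbs the linear part of the lattice.
\<close>
lemma rotating_frame_derivative:
  assumes X: "\<And>n. ((\<lambda>t. X t n) has_vector_derivative chain_field v f (X t) n) (at t within S)"
  defines "w \<equiv> \<lambda>t n. cis (- t) * Complex (fst (X t n)) (- snd (X t n)) / of_real (sqrt 2)"
  shows "((\<lambda>t. w t n) has_vector_derivative rot_field v f t (w t) n) (at t within S)"
proof -
  define F where "F = chain_force v f (\<lambda>m. fst (X t m)) n"
  have pos: "sqrt 2 * Re (cis t * w t m) = fst (X t m)" for m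
  proof -
    have "cis t * w t m = Complex (fst (X t m)) (- snd (X t m)) / of_real (sqrt 2)"
      by (simp add: w_def cis_mult flip: mult.assoc)
    then show ?thesis by simp
  qed
  have x: "((\<lambda>t. fst (X t n)) has_vector_derivative snd (X t n)) (at t within S)"
    using bounded_linear.has_vector_derivative[OF bounded_linear_fst X[of n]] by (simp add: chain_field_def)
  have y: "((\<lambda>t. snd (X t n)) has_vector_derivative - fst (X t n) + F) (at t within S)"
    using bounded_linear.has_vector_derivative[OF bounded_linear_snd X[of n]] by (simp add: chain_field_def F_def)
  have c: "((\<lambda>t. cis (- t)) has_vector_derivative - \<i> * cis (- t)) (at t within S)"
    unfolding has_vector_derivative_complex_iff
    by (auto intro!: derivative_eq_intros simp flip: has_real_derivative_iff_has_vector_derivative)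
  have z: "((\<lambda>t. Complex (fst (X t n)) (- snd (X t n))) has_vector_derivative
      Complex (snd (X t n)) (- (- fst (X t n) + F))) (at t within S)"
    using x has_vector_derivative_minus[OF y] 
    unfolding has_vector_derivative_complex_iff by (simp add: has_real_derivative_iff_has_vector_derivative)
  have "((\<lambda>t. w t n) has_vector_derivative
      (cis (- t) * Complex (snd (X t n)) (- (- fst (X t n) + F)) + - \<i> * cis (- t) * Complex (fst (X t n)) (- snd (X t n)))
      / of_real (sqrt 2)) (at t within S)"
    unfolding w_def by (intro has_vector_derivative_divide has_vector_derivative_mult c z)
  moreover have "(cis (- t) * Complex (snd (X t n)) (- (- fst (X t n) + F)) + - \<i> * cis (- t) * Complex (fst (X t n)) (- snd (X t n)))
      / of_real (sqrt 2) = rot_field v f t (w t) n"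
    unfolding rot_field_def pos F_def[symmetric] by (simp add: complex_eq_iff algebra_simps add_divide_distrib diff_divide_distrib)
  ultimately show ?thesis by (simp only:)
qed

context
  fixes p :: ereal
  assumes p: "1 \<le> p"
begin

text \<open>
  Two bounded solutions stay in a region where \<open>V'\<close> and \<open>\<phi>'\<close> are Lipschitz, and Gronwall's
  inequality applies with vanishing data.
\<close>
lemma chain_field_unique:
  assumes V: "C2_real V" and \<phi>: "C2_real \<phi>" and s: "0 \<le> s"
    and X: "\<And>t n. t \<in> {0..s} \<Longrightarrow> ((\<lambda>t. X t n) has_vector_derivative chain_field (deriv V) (deriv \<phi>) (X t) n) (at t within {0..s})"
    and Y: "\<And>t n. t \<in> {0..s} \<Longrightarrow> ((\<lambda>t. Y t n) has_vector_derivative chain_field (deriv V) (deriv \<phi>) (Y t) n) (at t within {0..s})"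
    and bound: "\<And>t. t \<in> {0..s} \<Longrightarrow> lp_le p (X t) K" "\<And>t. t \<in> {0..s} \<Longrightarrow> lp_le p (Y t) K"
    and "X 0 = Y 0" and t: "t \<in> {0..s}"
  shows "X t = Y t"
proof -
  obtain L1 where L1: "0 \<le> L1" "\<And>r s. \<bar>r\<bar> \<le> 2 * K \<Longrightarrow> \<bar>s\<bar> \<le> 2 * K \<Longrightarrow> \<bar>deriv V r - deriv V s\<bar> \<le> L1 * \<bar>r - s\<bar>"
    using C2_real_lipschitz_on_bounded[OF V] by blast
  obtain L2 where L2: "0 \<le> L2" "\<And>r s. \<bar>r\<bar> \<le> 2 * K \<Longrightarrow> \<bar>s\<bar> \<le> 2 * K \<Longrightarrow> \<bar>deriv \<phi> r - deriv \<phi> s\<bar> \<le> L2 * \<bar>r - s\<bar>"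
    using C2_real_lipschitz_on_bounded[OF \<phi>] by blast
  define L where "L = max L1 L2"
  have L: "0 \<le> L" "L1 \<le> L" "L2 \<le> L" using L1 by (auto simp: L_def)
  have small: "\<bar>fst (Z n)\<bar> \<le> 2 * K" "\<bar>fst (Z n) - fst (Z (n - 1))\<bar> \<le> 2 * K" if Z: "lp_le p Z K" for Z :: "int \<Rightarrow> real \<times> real" and n
  proof -
    have "\<bar>fst (Z n)\<bar> \<le> K" for n
      using lp_le_component[OF p Z, of n] norm_fst_le[of "fst (Z n)" "snd (Z n)"] by simp
    from this[of n] this[of "n - 1"] lp_le_nonneg[OF Z]
    show "\<bar>fst (Z n)\<bar> \<le> 2 * K" "\<bar>fst (Z n) - fst (Z (n - 1))\<bar> \<le> 2 * K" by linarith+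
  qed
  have "lp_le p (\<lambda>n. X t n - Y t n) (2 * 0 * exp (2 * (1 + 5 * L) * t))"
  proof (rule lp_gronwall[OF p _ s _ _ _ _ _ t, where u = "\<lambda>t n. X t n - Y t n" and v = "\<lambda>t n. X t n - Y t n"
        and v' = "\<lambda>t n. chain_field (deriv V) (deriv \<phi>) (X t) n - chain_field (deriv V) (deriv \<phi>) (Y t) n"
        and ?K0.0 = "K + K"])
    show "0 \<le> 1 + 5 * L" using L by simp
    show "X 0 n - Y 0 n = 0" for n using \<open>X 0 = Y 0\<close> by simp
  next
    fix t n assume t: "t \<in> {0..s}"
    show "((\<lambda>t. X t n - Y t n) has_vector_derivative
        chain_field (deriv V) (deriv \<phi>) (X t) n - chain_field (deriv V) (deriv \<phi>) (Y t) n) (at t within {0..s})"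
      by (intro has_vector_derivative_diff X Y t)
  next
    fix t assume t: "t \<in> {0..s}"
    show "lp_le p (\<lambda>n. X t n - Y t n - (X t n - Y t n)) 0"
      using lp_le_zero[OF p] by simp
    show "lp_le p (\<lambda>n. X t n - Y t n) (K + K)"
      by (rule lp_le_diff[OF p bound[OF t]])
    fix M assume M: "lp_le p (\<lambda>n. X t n - Y t n) M"
    show "lp_le p (\<lambda>n. chain_field (deriv V) (deriv \<phi>) (X t) n - chain_field (deriv V) (deriv \<phi>) (Y t) n) ((1 + 5 * L) * M)"
    proof (rule chain_field_lp_lipschitz[OF p, where A = "{r. \<bar>r\<bar> \<le> 2 * K}"])
      fix r s assume rs: "r \<in> {r. \<bar>r\<bar> \<le> 2 * K}" "s \<in> {r. \<bar>r\<bar> \<le> 2 * K}"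
      have "L1 * \<bar>r - s\<bar> \<le> L * \<bar>r - s\<bar>" "L2 * \<bar>r - s\<bar> \<le> L * \<bar>r - s\<bar>"
        using L by (auto intro: mult_right_mono)
      then show "\<bar>deriv V r - deriv V s\<bar> \<le> L * \<bar>r - s\<bar>" "\<bar>deriv \<phi> r - deriv \<phi> s\<bar> \<le> L * \<bar>r - s\<bar>"
        using L1(2)[of r s] L2(2)[of r s] rs by auto
    qed (use L small[OF bound(1)[OF t]] small[OF bound(2)[OF t]] M in auto)
  qed
  then have "norm (X t n - Y t n) \<le> 0" for n
    using lp_le_component[OF p] by fastforce
  then show ?thesis by auto
qed

lemma lattice_solution_component:
  assumes "lattice_solution p V \<phi> {0..s} Y" "t \<in> {0..s}"
  shows "((\<lambda>t. Y t n) has_vector_derivative chain_field (deriv V) (deriv \<phi>) (Y t) n) (at t within {0..s})"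
  using lp_has_derivative_on_component[OF p assms(1)[unfolded lattice_solution_def] assms(2)]
  by (simp add: chain_field_lattice)

lemma lattice_solution_bounded:
  assumes Y: "lattice_solution p V \<phi> {0..s} Y"
  obtains K where "\<And>t. t \<in> {0..s} \<Longrightarrow> lp_le p (Y t) K"
proof -
  note der = Y[unfolded lattice_solution_def]
  have "bounded ((\<lambda>t. lp_norm p (Y t)) ` {0..s})"
    by (intro compact_imp_bounded compact_continuous_image lp_has_derivative_on_continuous_norm[OF p der] compact_Icc)
  then obtain K where "\<And>t. t \<in> {0..s} \<Longrightarrow> norm (lp_norm p (Y t)) \<le> K"
    unfolding bounded_iff by blast
  then have "lp_le p (Y t) K" if "t \<in> {0..s}" for t
    using that der by (force simp: lp_le_def lp_has_derivative_on_def)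
  then show thesis by (rule that)
qed

end

definition truncate_at :: "real \<Rightarrow> real \<Rightarrow> real" where
  "truncate_at \<rho> x = max (- \<rho>) (min \<rho> x)"

lemma abs_truncate_at: "0 \<le> \<rho> \<Longrightarrow> \<bar>truncate_at \<rho> x\<bar> \<le> \<rho>"
  by (auto simp: truncate_at_def)

lemma truncate_at_id: "\<bar>x\<bar> \<le> \<rho> \<Longrightarrow> truncate_at \<rho> x = x"
  by (auto simp: truncate_at_def)

lemma truncate_at_diff: "\<bar>truncate_at \<rho> x - truncate_at \<rho> y\<bar> \<le> \<bar>x - y\<bar>"
  by (auto simp: truncate_at_def max_def min_def)

text \<open>
  The truncated lattice has a global solution; by the error bound and \<open>small\<close> it stays within \<open>\<epsilon>\<close> of an
  approximation of size \<open>N \<epsilon>\<close>, hence inside the ball in which nothing has been truncated.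
\<close>
lemma (in modulation) lattice_solution_near_approximation:
  assumes V: "C2_real V" "\<And>x. deriv V x = leading_force \<alpha> kminus kplus x + g x"
    and \<phi>: "C2_real \<phi>" "\<And>x. deriv \<phi> x = f x"
    and X0: "X0 \<in> lp_space p" "lp_norm p (\<lambda>n. X0 n - X_approx \<alpha> a \<epsilon> 0 n) \<le> Ci * \<epsilon> powr (1 + \<eta>)"
    and small: "error_const \<alpha> \<eta> C T Ci N * \<epsilon> powr \<eta> \<le> 1"
  obtains X where "lattice_solution p V \<phi> {0..\<tau>} X" "X 0 = X0"
    and "\<And>s Y t. s \<in> {0..\<tau>} \<Longrightarrow> lattice_solution p V \<phi> {0..s} Y \<Longrightarrow> Y 0 = X0 \<Longrightarrow> t \<in> {0..s} \<Longrightarrow> Y t = X t"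
    and "\<And>t. t \<in> {0..\<tau>} \<Longrightarrow> lp_norm p (\<lambda>n. X t n - X_approx \<alpha> a \<epsilon> t n)
      \<le> 2 * error_const \<alpha> \<eta> C T Ci N * \<epsilon> powr (1 + \<eta>)"
proof -
  define E where "E = error_const \<alpha> \<eta> C T Ci N * \<epsilon> powr (1 + \<eta>)"
  have \<rho>0: "0 \<le> \<rho>" using \<rho> by simp
  define vc where "vc x = deriv V (truncate_at \<rho> x)" for x
  define fc where "fc x = deriv \<phi> (truncate_at \<rho> x)" for x
  have vc_id: "vc x = deriv V x" and fc_id: "fc x = deriv \<phi> x" if "\<bar>x\<bar> \<le> \<rho>" for x
    using that by (simp_all add: vc_def fc_def truncate_at_id)
  have vc_lip: "\<bar>vc x - vc y\<bar> \<le> 2 * \<Lambda> * \<bar>x - y\<bar>" and fc_lip: "\<bar>fc x - fc y\<bar> \<le> 2 * \<Lambda> * \<bar>x - y\<bar>" for x y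
  proof -
    let ?x = "truncate_at \<rho> x" and ?y = "truncate_at \<rho> y"
    have xy: "\<bar>?x\<bar> \<le> \<rho>" "\<bar>?y\<bar> \<le> \<rho>" by (rule abs_truncate_at[OF \<rho>0])+
    have d: "\<Lambda> * \<bar>?x - ?y\<bar> \<le> \<Lambda> * \<bar>x - y\<bar>" "\<Lambda>' * \<bar>?x - ?y\<bar> \<le> \<Lambda> * \<bar>x - y\<bar>" "0 \<le> \<Lambda> * \<bar>x - y\<bar>"
      using \<Lambda> truncate_at_diff[of \<rho> x y] by (auto intro!: mult_mono)
    show "\<bar>vc x - vc y\<bar> \<le> 2 * \<Lambda> * \<bar>x - y\<bar>"
      using h_diff[OF xy] g_diff[OF xy] d unfolding vc_def V(2) h_def by linarith
    show "\<bar>fc x - fc y\<bar> \<le> 2 * \<Lambda> * \<bar>x - y\<bar>"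
      using f_diff[OF xy] d unfolding fc_def \<phi>(2) by linarith
  qed
  have lip_cont: "continuous_on S k" if "\<And>x y. \<bar>k x - k y\<bar> \<le> 2 * \<Lambda> * \<bar>x - y\<bar>" for S and k :: "real \<Rightarrow> real"
    by (rule lipschitz_on_continuous_on[of "2 * \<Lambda>"], rule lipschitz_onI) (use that \<Lambda> in \<open>auto simp: dist_real_def\<close>)
  have field_lip: "lp_le p (\<lambda>n. chain_field vc fc X n - chain_field vc fc Y n) ((1 + 5 * (2 * \<Lambda>)) * M)"
    if "lp_le p (\<lambda>n. X n - Y n) M" for X Y M
    by (rule chain_field_lp_lipschitz[OF p, where A = UNIV]) (use vc_lip fc_lip \<Lambda> that in auto)
  have field_0: "chain_field vc fc (\<lambda>_. 0) = (\<lambda>_. 0)"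
  proof -
    have "fc 0 = 0" using fc_id[of 0] \<rho>0 by (simp add: \<phi>(2) f_0)
    then show ?thesis by (auto simp: chain_field_def chain_force_def fun_eq_iff zero_prod_def)
  qed
  have field_cont: "continuous_on {0..\<tau>} (\<lambda>t. chain_field vc fc (u t) n)"
    if u: "\<And>m. continuous_on {0..\<tau>} (\<lambda>t. u t m)" for u n
    unfolding chain_field_def chain_force_def
    by (intro continuous_intros continuous_on_fst[OF u] continuous_on_snd[OF u]
        continuous_on_compose2[OF lip_cont[of vc UNIV, OF vc_lip]]
        continuous_on_compose2[OF lip_cont[of fc UNIV, OF fc_lip]]) auto
  obtain X K where X_0: "X 0 = X0"
    and X: "\<And>n t. t \<in> {0..\<tau>} \<Longrightarrow> ((\<lambda>t. X t n) has_vector_derivative chain_field vc fc (X t) n) (at t within {0..\<tau>})"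
    and X_bound: "\<And>t. t \<in> {0..\<tau>} \<Longrightarrow> lp_le p (X t) K"
  proof (rule lp_picard[OF p, where \<Phi> = "\<lambda>_. chain_field vc fc" and L = "1 + 5 * (2 * \<Lambda>)" and \<tau> = \<tau> and ?x0.0 = X0
        and A = "lp_norm p X0"])
    show "lp_le p X0 (lp_norm p X0)" by (rule lp_le_norm[OF X0(1)])
  qed (use \<Lambda> \<tau> field_lip field_0 field_cont in auto)

  \<comment> \<open>Passing to the rotating frame, where the error bound is available.\<close>
  define w where "w t n = cis (- t) * Complex (fst (X t n)) (- snd (X t n)) / of_real (sqrt 2)" for t n
  have norm_diff: "norm (X t n - X_approx \<alpha> a \<epsilon> t n) = sqrt 2 * norm (w t n - wa t n)" for t n
    using norm_rotated_difference[of "fst (X t n)" "snd (X t n)" t "wa t n"]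
    by (simp add: X_approx_eq w_def wa_def)
  have norm_X: "norm (X t n) = sqrt 2 * norm (w t n)" for t n
    using norm_rotated_difference[of "fst (X t n)" "snd (X t n)" t 0] by (simp add: w_def zero_prod_def[symmetric])
  have err: "lp_le p (\<lambda>n. w t n - wa t n) E" if t: "t \<in> {0..\<tau>}" for t
    unfolding E_def
  proof (rule error_bound[OF _ vc_lip _ fc_lip _ _ _ t])
    show "vc x = h x + g x" "fc x = f x" if "\<bar>x\<bar> \<le> \<rho>" for x
      using vc_id[OF that] fc_id[OF that] by (simp_all add: V(2) \<phi>(2) h_def)
    show "((\<lambda>t. w t n) has_vector_derivative rot_field vc fc t (w t) n) (at t within {0..\<tau>})" if "t \<in> {0..\<tau>}" for t n
      using rotating_frame_derivative[OF X[OF that]] by (simp add: w_def[abs_def])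
    show "lp_le p (w t) K" if "t \<in> {0..\<tau>}" for t
      by (rule lp_le_mono[OF p X_bound[OF that]]) (use sqrt2_bounds in \<open>simp add: norm_X mult_le_cancel_right1\<close>)
    have "0 \<in> {0..\<tau>}" using \<tau> by simp
    have "lp_le p (\<lambda>n. X0 n - X_approx \<alpha> a \<epsilon> 0 n) (Ci * \<epsilon> powr (1 + \<eta>))"
    proof -
      have "lp_le p (\<lambda>n. X_approx \<alpha> a \<epsilon> 0 n) (2 * (\<epsilon> * N))"
      proof (rule lp_le_scale[OF p wa_bound[OF \<open>0 \<in> {0..\<tau>}\<close>]])
        have "Complex 0 0 = 0" by (simp add: complex_eq_iff)
        then show "norm (X_approx \<alpha> a \<epsilon> 0 n) \<le> 2 * norm (wa 0 n)" for n
          using norm_rotated_difference[of 0 0 0 "wa 0 n"] sqrt2_bounds mult_right_mono[of "sqrt 2" 2 "norm (wa 0 n)"]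
          by (simp add: X_approx_eq wa_def norm_Pair)
      qed simp
      from lp_le_diff[OF p lp_le_norm[OF X0(1)] this] X0(2) show ?thesis
        by (simp add: lp_le_def)
    qed
    then show "lp_le p (\<lambda>n. w 0 n - wa 0 n) (Ci * \<epsilon> powr (1 + \<eta>))"
      by (rule lp_le_mono[OF p])
        (use norm_diff[of 0] sqrt2_bounds in \<open>simp add: X_0[symmetric] mult_le_cancel_right1\<close>)
  qed
  have E_le: "E \<le> \<epsilon>"
    using mult_left_mono[OF small, of \<epsilon>] \<epsilon> by (simp add: E_def powr_add mult_ac)
  have X_small: "\<bar>fst (X t n)\<bar> \<le> \<rho> / 2" if t: "t \<in> {0..\<tau>}" for t n
  proof -
    have "lp_le p (\<lambda>n. (w t n - wa t n) + wa t n) (E + \<epsilon> * N)"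
      by (intro lp_le_add[OF p] err wa_bound t)
    then have "norm (w t n) \<le> \<epsilon> + \<epsilon> * N"
      using lp_le_component[OF p, of _ _ n] E_le by fastforce
    then have "norm (X t n) \<le> 2 * (\<epsilon> + \<epsilon> * N)"
      unfolding norm_X using sqrt2_bounds by (intro mult_mono) auto
    then show ?thesis
      using norm_fst_le[of "fst (X t n)" "snd (X t n)"] by (simp add: \<rho>_def algebra_simps)
  qed
  have field_eq: "chain_field vc fc (X t) n = chain_field (deriv V) (deriv \<phi>) (X t) n" if t: "t \<in> {0..\<tau>}" for t n
  proof -
    have "\<bar>fst (X t m) - fst (X t (m - 1))\<bar> \<le> \<rho>" "\<bar>fst (X t m)\<bar> \<le> \<rho>" for m
      using X_small[OF t, of m] X_small[OF t, of "m - 1"] \<rho>0 by linarith+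
    from this(1)[of n] this(1)[of "n + 1"] this(2)[of n] show ?thesis
      by (simp add: chain_field_def chain_force_def vc_id fc_id)
  qed
  define B where "B = (1 + 5 * (2 * \<Lambda>)) * K"
  have field_bound: "lp_le p (chain_field vc fc (X t)) B" if "t \<in> {0..\<tau>}" for t
    using field_lip[of "X t" "\<lambda>_. 0" K] X_bound[OF that] by (simp add: field_0 B_def)
  have solution: "lattice_solution p V \<phi> {0..\<tau>} X"
    unfolding lattice_solution_def chain_field_lattice[symmetric]
  proof (rule lp_has_derivative_onI[OF p, where C = "(1 + 5 * (2 * \<Lambda>)) * B"])
    show "((\<lambda>t. X t n) has_vector_derivative chain_field (deriv V) (deriv \<phi>) (X t) n) (at t within {0..\<tau>})"
      if "t \<in> {0..\<tau>}" for n t using X[OF that] field_eq[OF that] by simp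
    show "X t \<in> lp_space p" if "t \<in> {0..\<tau>}" for t using X_bound[OF that] by (simp add: lp_le_def)
    show "(\<lambda>n. chain_field (deriv V) (deriv \<phi>) (X t) n) \<in> lp_space p" if "t \<in> {0..\<tau>}" for t
      using field_bound[OF that] by (simp add: lp_le_def flip: field_eq[OF that])
    show "lp_le p (\<lambda>n. chain_field (deriv V) (deriv \<phi>) (X s) n - chain_field (deriv V) (deriv \<phi>) (X t) n)
        ((1 + 5 * (2 * \<Lambda>)) * B * \<bar>s - t\<bar>)" if st: "s \<in> {0..\<tau>}" "t \<in> {0..\<tau>}" for s t
      using field_lip[OF lp_le_lipschitz[OF p X field_bound st]] by (simp add: mult.assoc flip: field_eq[OF st(1)] field_eq[OF st(2)])
  qed
  show thesis
  proof (rule that[OF solution X_0])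
    fix s Y t assume s: "s \<in> {0..\<tau>}" and Y: "lattice_solution p V \<phi> {0..s} Y" "Y 0 = X0" and t: "t \<in> {0..s}"
    obtain K' where K': "\<And>t. t \<in> {0..s} \<Longrightarrow> lp_le p (Y t) K'"
      using lattice_solution_bounded[OF p Y(1)] by blast
    show "Y t = X t"
    proof (rule chain_field_unique[OF p V(1) \<phi>(1), where s = s and K = "max K K'"])
      fix t n assume t: "t \<in> {0..s}"
      then have t': "t \<in> {0..\<tau>}" using s by auto
      show "((\<lambda>t. Y t n) has_vector_derivative chain_field (deriv V) (deriv \<phi>) (Y t) n) (at t within {0..s})"
        by (rule lattice_solution_component[OF p Y(1) t])
      have "((\<lambda>t. X t n) has_vector_derivative chain_field vc fc (X t) n) (at t within {0..s})"
        by (rule has_vector_derivative_within_subset[OF X[OF t']]) (use s in auto)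
      then show "((\<lambda>t. X t n) has_vector_derivative chain_field (deriv V) (deriv \<phi>) (X t) n) (at t within {0..s})"
        by (simp only: field_eq[OF t'])
    next
      fix t assume t: "t \<in> {0..s}"
      then have t': "t \<in> {0..\<tau>}" using s by auto
      show "lp_le p (Y t) (max K K')" by (rule lp_le_weaken[OF K'[OF t]]) simp
      show "lp_le p (X t) (max K K')" by (rule lp_le_weaken[OF X_bound[OF t']]) simp
    qed (use s t Y X_0 in auto)
  next
    fix t assume t: "t \<in> {0..\<tau>}"
    have "lp_le p (\<lambda>n. X t n - X_approx \<alpha> a \<epsilon> t n) (2 * E)"
    proof (rule lp_le_scale[OF p err[OF t]])
      show "norm (X t n - X_approx \<alpha> a \<epsilon> t n) \<le> 2 * norm (w t n - wa t n)" for n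
        unfolding norm_diff using sqrt2_bounds by (intro mult_right_mono) auto
    qed simp
    then show "lp_norm p (\<lambda>n. X t n - X_approx \<alpha> a \<epsilon> t n) \<le> 2 * error_const \<alpha> \<eta> C T Ci N * \<epsilon> powr (1 + \<eta>)"
      by (simp add: lp_le_def E_def mult.assoc)
  qed
qed

section \<open>The approximation theorem\<close>

lemma residual_const_mono:
  assumes "0 \<le> C" "0 < T" "1 < \<alpha>" "0 < \<eta>" "0 \<le> N" "N \<le> N'"
  shows "0 \<le> residual_const \<alpha> \<eta> C T N" "residual_const \<alpha> \<eta> C T N \<le> residual_const \<alpha> \<eta> C T N'"
  unfolding residual_const_def Let_def using assms
  by (auto intro!: add_mono mult_mono powr_mono2 add_nonneg_nonneg mult_nonneg_nonneg)

lemma error_const_mono: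
  assumes "0 \<le> C" "0 < T" "1 < \<alpha>" "0 < \<eta>" "0 < Ci" "0 \<le> N" "N \<le> N'"
  shows "Ci \<le> error_const \<alpha> \<eta> C T Ci N" "error_const \<alpha> \<eta> C T Ci N \<le> error_const \<alpha> \<eta> C T Ci N'"
proof -
  let ?e = "\<lambda>N. exp (20 * C * (4 * (N + 1)) powr (\<alpha> - 1) * T)"
  note res = residual_const_mono[OF assms(1-4,6,7)]
  have "1 \<le> ?e N" using assms by simp
  have "Ci * 1 \<le> 2 * (Ci + residual_const \<alpha> \<eta> C T N) * ?e N"
    using res \<open>1 \<le> ?e N\<close> assms by (intro mult_mono) auto
  then show "Ci \<le> error_const \<alpha> \<eta> C T Ci N" by (simp add: error_const_def)
  have "?e N \<le> ?e N'"
    using assms by (auto intro!: mult_right_mono mult_left_mono powr_mono2)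
  then show "error_const \<alpha> \<eta> C T Ci N \<le> error_const \<alpha> \<eta> C T Ci N'"
    unfolding error_const_def using res assms by (intro mult_mono add_mono) auto
qed

lemma continuous_on_error_const: "continuous_on {0..} (error_const \<alpha> \<eta> C T Ci)"
  unfolding error_const_def residual_const_def Let_def
  by (intro continuous_intros) auto

theorem theorem2p15:
  fixes \<alpha> \<beta> \<gamma> kminus kplus \<eta> Ci T :: real
    and V W \<phi> :: "real \<Rightarrow> real"
    and p :: ereal
  assumes "\<alpha> > 1" and "(kminus, kplus) \<noteq> (0, 0)" and "\<beta> > 0" and "\<gamma> > 0"
    and "C2_real V"
    and "\<And>r. V r = V_alpha \<alpha> kminus kplus r + W r"
    and "deriv W 0 = 0"
    and "deriv (deriv W) \<in> O[at 0](\<lambda>r. \<bar>r\<bar> powr (\<alpha> - 1 + \<beta>))"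
    and "C2_real \<phi>"
    and "deriv \<phi> 0 = 0"
    and "deriv (deriv \<phi>) \<in> O[at 0](\<lambda>x. \<bar>x\<bar> powr (\<alpha> - 1 + \<gamma>))"
    and "1 \<le> p"
    and "\<eta> = Min {\<alpha> - 1, \<beta>, \<gamma>}"
    and "Ci > 0" and "T > 0"
  shows "\<exists>\<epsilon>\<^sub>T C\<^sub>T :: real \<Rightarrow> real.
    continuous_on {0..} \<epsilon>\<^sub>T \<and> antimono_on {0..} \<epsilon>\<^sub>T \<and> \<epsilon>\<^sub>T \<in> {0..} \<rightarrow> {0<..} \<and>
    continuous_on {0..} C\<^sub>T \<and> mono_on {0..} C\<^sub>T \<and> C\<^sub>T \<in> {0..} \<rightarrow> {Ci..} \<and>
    (\<forall>a N \<epsilon> X0.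
       lp_C2_on p {0..T} a \<longrightarrow>
       amplitude_solution p \<alpha> kminus kplus {0..T} a \<longrightarrow>
       N = Linf_lp_norm p {0..T} a \<longrightarrow>
       \<epsilon> \<in> {0<..\<epsilon>\<^sub>T N} \<longrightarrow>
       X0 \<in> lp_space p \<longrightarrow>
       lp_norm p (\<lambda>n. X0 n - X_approx \<alpha> a \<epsilon> 0 n) \<le> Ci * \<epsilon> powr (1 + \<eta>) \<longrightarrow>
       (\<exists>X. lattice_solution p V \<phi> {0..T / \<epsilon> powr (\<alpha> - 1)} X \<and> X 0 = X0 \<and>
          (\<forall>s\<in>{0..T / \<epsilon> powr (\<alpha> - 1)}. \<forall>Y.
             lattice_solution p V \<phi> {0..s} Y \<and> Y 0 = X0 \<longrightarrow> (\<forall>t\<in>{0..s}. Y t = X t)) \<and>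
          (\<forall>t\<in>{0..T / \<epsilon> powr (\<alpha> - 1)}.
             lp_norm p (\<lambda>n. X t n - X_approx \<alpha> a \<epsilon> t n) \<le> C\<^sub>T N * \<epsilon> powr (1 + \<eta>))))"
proof -
  note \<alpha> = assms(1) and V = assms(5,6) and \<phi> = assms(9,10) and p = assms(12)
  have \<eta>: "0 < \<eta>" "\<eta> \<le> \<alpha> - 1" "\<eta> \<le> \<beta>" "\<eta> \<le> \<gamma>"
    using assms(1,3,4) by (auto simp: assms(13))
  obtain CW \<rho>W where W: "0 \<le> CW" "0 < \<rho>W" "lip_near_zero (deriv W) CW (\<alpha> - 1 + \<beta>) \<rho>W"
    using lip_near_zero_bigo[OF perturbation_derivatives(2,3)[OF \<alpha> V] assms(8)] \<alpha> assms(3) by auto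
  obtain C\<phi> \<rho>\<phi> where F: "0 \<le> C\<phi>" "0 < \<rho>\<phi>" "lip_near_zero (deriv \<phi>) C\<phi> (\<alpha> - 1 + \<gamma>) \<rho>\<phi>"
    using lip_near_zero_bigo[OF C2_real_derivatives(2,3)[OF \<phi>(1)] assms(11)] \<alpha> assms(4) by auto
  define C where "C = max (\<alpha> * (\<bar>kplus\<bar> + \<bar>kminus\<bar>)) (max CW C\<phi>)"
  define \<rho>0 where "\<rho>0 = min 1 (min \<rho>W \<rho>\<phi>)"
  have C: "0 \<le> C" using W by (simp add: C_def)
  have \<rho>0: "0 < \<rho>0" "\<rho>0 \<le> 1" using W F by (auto simp: \<rho>0_def)
  have h_lip: "lip_near_zero (leading_force \<alpha> kminus kplus) C (\<alpha> - 1) \<rho>0"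
    by (rule lip_near_zero_weaken[OF lip_near_zero_leading_force[OF \<alpha>, where ?\<rho>0.0 = \<rho>0]]) (use C \<rho>0 in \<open>auto simp: C_def\<close>)
  have W_lip: "lip_near_zero (deriv W) C (\<alpha> - 1 + \<eta>) \<rho>0"
    by (rule lip_near_zero_weaken[OF W(3)]) (use C \<rho>0 \<eta> in \<open>auto simp: C_def \<rho>0_def\<close>)
  have \<phi>_lip: "lip_near_zero (deriv \<phi>) C (\<alpha> - 1 + \<eta>) \<rho>0"
    by (rule lip_near_zero_weaken[OF F(3)]) (use C \<rho>0 \<eta> in \<open>auto simp: C_def \<rho>0_def\<close>)

  \<comment> \<open>The factor \<open>2\<close> covers the \<open>\<surd>2\<close> of the change of frame. The conditions in \<open>\<epsilon>\<^sub>T\<close> say in turn that \<open>\<epsilon> \<le> 1\<close>,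
    that the radius \<open>\<rho>\<close> stays where the growth conditions hold, and that the error is at most \<open>\<epsilon>\<close>.\<close>
  define C\<^sub>T where "C\<^sub>T N = 2 * error_const \<alpha> \<eta> C T Ci N" for N
  define \<epsilon>\<^sub>T where "\<epsilon>\<^sub>T N = min (min 1 (\<rho>0 / (4 * (N + 1)))) (C\<^sub>T N powr (- 1 / \<eta>))" for N
  note const = error_const_mono[OF C \<open>T > 0\<close> \<alpha> \<eta>(1) \<open>Ci > 0\<close>]
  have C\<^sub>T_ge: "2 * Ci \<le> C\<^sub>T N" if "0 \<le> N" for N
    using const(1)[OF that order_refl] by (simp add: C\<^sub>T_def)
  have C\<^sub>T_pos: "0 < C\<^sub>T N" if "0 \<le> N" for N
    using that[THEN C\<^sub>T_ge] \<open>Ci > 0\<close> by simp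
  have C\<^sub>T_nz: "C\<^sub>T N \<noteq> 0" if "0 \<le> N" for N
    using C\<^sub>T_pos[OF that] by simp
  have C\<^sub>T_cont: "continuous_on {0..} C\<^sub>T"
    unfolding C\<^sub>T_def by (intro continuous_intros continuous_on_error_const)
  have C\<^sub>T_mono: "mono_on {0..} C\<^sub>T"
    by (rule mono_onI) (simp add: C\<^sub>T_def const(2))
  have "continuous_on {0..} \<epsilon>\<^sub>T"
    unfolding \<epsilon>\<^sub>T_def by (intro continuous_intros C\<^sub>T_cont) (use C\<^sub>T_nz in auto)
  moreover have "antimono_on {0..} \<epsilon>\<^sub>T"
  proof (rule monotone_onI)
    fix N N' :: real assume N: "N \<in> {0..}" "N' \<in> {0..}" "N \<le> N'"
    have d1: "\<rho>0 / (4 * (N' + 1)) \<le> \<rho>0 / (4 * (N + 1))"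
      by (rule divide_left_mono) (use N \<rho>0 in auto)
    have "0 \<le> N" using N by simp
    have "C\<^sub>T N \<le> C\<^sub>T N'"
      unfolding C\<^sub>T_def using const(2)[OF \<open>0 \<le> N\<close> N(3)] by simp
    then have d2: "C\<^sub>T N' powr (- 1 / \<eta>) \<le> C\<^sub>T N powr (- 1 / \<eta>)"
      by (intro powr_mono2' C\<^sub>T_pos[OF \<open>0 \<le> N\<close>]) (use \<eta> in simp)
    show "\<epsilon>\<^sub>T N' \<le> \<epsilon>\<^sub>T N"
      unfolding \<epsilon>\<^sub>T_def by (rule min.mono[OF min.mono[OF order_refl d1] d2])
  qed
  moreover have "\<epsilon>\<^sub>T \<in> {0..} \<rightarrow> {0<..}"
    using C\<^sub>T_nz \<rho>0 by (auto simp: \<epsilon>\<^sub>T_def)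
  moreover have "C\<^sub>T \<in> {0..} \<rightarrow> {Ci..}"
    using C\<^sub>T_ge \<open>Ci > 0\<close> by fastforce
  moreover have "\<exists>X. lattice_solution p V \<phi> {0..T / \<epsilon> powr (\<alpha> - 1)} X \<and> X 0 = X0 \<and>
      (\<forall>s\<in>{0..T / \<epsilon> powr (\<alpha> - 1)}. \<forall>Y.
         lattice_solution p V \<phi> {0..s} Y \<and> Y 0 = X0 \<longrightarrow> (\<forall>t\<in>{0..s}. Y t = X t)) \<and>
      (\<forall>t\<in>{0..T / \<epsilon> powr (\<alpha> - 1)}.
         lp_norm p (\<lambda>n. X t n - X_approx \<alpha> a \<epsilon> t n) \<le> C\<^sub>T N * \<epsilon> powr (1 + \<eta>))"
    if a: "amplitude_solution p \<alpha> kminus kplus {0..T} a" and N: "N = Linf_lp_norm p {0..T} a"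
      and \<epsilon>: "\<epsilon> \<in> {0<..\<epsilon>\<^sub>T N}" and X0: "X0 \<in> lp_space p"
        "lp_norm p (\<lambda>n. X0 n - X_approx \<alpha> a \<epsilon> 0 n) \<le> Ci * \<epsilon> powr (1 + \<eta>)"
    for a N \<epsilon> X0
  proof -
    obtain a' where a': "lp_has_derivative_on p {0..T} a a'"
      and a_eq: "\<And>t n. t \<in> {0..T} \<Longrightarrow> \<i> * a' t n = delta_plus (amplitude_f \<alpha> kminus kplus (delta_minus (a t))) n"
      using a unfolding amplitude_solution_def by blast
    have a_lp: "a t \<in> lp_space p" if "t \<in> {0..T}" for t
      using a' that by (auto simp: lp_has_derivative_on_def)
    have norm_le_N: "lp_norm p (a t) \<le> N" if "t \<in> {0..T}" for t
      unfolding N Linf_lp_norm_def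
      by (rule le_Linf_norm[OF \<open>T > 0\<close> lp_has_derivative_on_continuous_norm[OF p a'] lp_norm_nonneg[OF a_lp] that])
    have N0: "0 \<le> N"
      using norm_le_N[of 0] lp_norm_nonneg[OF a_lp, of 0] \<open>T > 0\<close> by simp
    have \<epsilon>0: "0 < \<epsilon>" "\<epsilon> \<le> 1" "\<epsilon> \<le> \<rho>0 / (4 * (N + 1))" "\<epsilon> \<le> C\<^sub>T N powr (- 1 / \<eta>)"
      using \<epsilon> by (auto simp: \<epsilon>\<^sub>T_def)
    interpret modulation p \<alpha> \<eta> kminus kplus C \<rho>0 T N \<epsilon> "deriv W" "deriv \<phi>" a a'
    proof
      show "4 * (N + 1) * \<epsilon> \<le> \<rho>0" using \<epsilon>0(3) N0 by (simp add: field_simps)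
      show "lp_le p (a t) N" if "t \<in> {0..T}" for t
        using a_lp[OF that] norm_le_N[OF that] by (simp add: lp_le_def)
      show "((\<lambda>t. a t n) has_vector_derivative a' t n) (at t within {0..T})" if "t \<in> {0..T}" for t n
        by (rule lp_has_derivative_on_component[OF p a' that])
    qed (use p \<alpha> \<eta> \<open>T > 0\<close> N0 \<epsilon>0 \<rho>0 C h_lip W_lip \<phi>_lip \<phi>(2) a_eq in auto)
    have "error_const \<alpha> \<eta> C T Ci N * \<epsilon> powr \<eta> \<le> 1"
    proof -
      have "\<epsilon> powr \<eta> \<le> (C\<^sub>T N powr (- 1 / \<eta>)) powr \<eta>"
        using \<epsilon>0 \<eta> by (intro powr_mono2) auto
      also have "\<dots> = C\<^sub>T N powr (- 1)"
        using \<eta> by (simp only: powr_powr) simp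
      also have "\<dots> = inverse (C\<^sub>T N)"
        using C\<^sub>T_pos[OF N0] powr_minus[of "C\<^sub>T N" 1] by simp
      finally have "C\<^sub>T N * \<epsilon> powr \<eta> \<le> C\<^sub>T N * inverse (C\<^sub>T N)"
        using C\<^sub>T_pos[OF N0] by (intro mult_left_mono) auto
      then have "C\<^sub>T N * \<epsilon> powr \<eta> \<le> 1" using C\<^sub>T_pos[OF N0] by simp
      moreover have "error_const \<alpha> \<eta> C T Ci N * \<epsilon> powr \<eta> \<le> C\<^sub>T N * \<epsilon> powr \<eta>"
        using C\<^sub>T_pos[OF N0] by (intro mult_right_mono) (auto simp: C\<^sub>T_def)
      ultimately show ?thesis by linarith
    qed
    note near = lattice_solution_near_approximation[OF V(1) perturbation_derivatives(1)[OF \<alpha> V] \<phi>(1) refl X0 this]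
    obtain X where X: "lattice_solution p V \<phi> {0..\<tau>} X" "X 0 = X0"
      and unique: "\<And>s Y t. s \<in> {0..\<tau>} \<Longrightarrow> lattice_solution p V \<phi> {0..s} Y \<Longrightarrow> Y 0 = X0 \<Longrightarrow> t \<in> {0..s} \<Longrightarrow> Y t = X t"
      and error: "\<And>t. t \<in> {0..\<tau>} \<Longrightarrow> lp_norm p (\<lambda>n. X t n - X_approx \<alpha> a \<epsilon> t n)
        \<le> 2 * error_const \<alpha> \<eta> C T Ci N * \<epsilon> powr (1 + \<eta>)"
      by (rule near) (assumption | rule that)+
    show ?thesis
      unfolding \<tau>_def[symmetric] C\<^sub>T_def
    proof (intro exI[of _ X] conjI ballI allI impI X)
      fix s Y t assume "s \<in> {0..\<tau>}" "lattice_solution p V \<phi> {0..s} Y \<and> Y 0 = X0" "t \<in> {0..s}"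
      then show "Y t = X t" using unique[of s Y t] by blast
    next
      fix t assume "t \<in> {0..\<tau>}"
      then show "lp_norm p (\<lambda>n. X t n - X_approx \<alpha> a \<epsilon> t n) \<le> 2 * error_const \<alpha> \<eta> C T Ci N * \<epsilon> powr (1 + \<eta>)"
        by (rule error)
    qed
  qed
  ultimately show ?thesis
    using C\<^sub>T_cont C\<^sub>T_mono by (intro exI[of _ \<epsilon>\<^sub>T] exI[of _ C\<^sub>T]) blast
qed

end
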